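(* The free product of two $\mathbf{IND}$-tabled groups is $\mathbf{IND}$-tabled.
   Context: For a word $w=a_1\cdots a_n$ write $w^{\mathrm{rev}}=a_n\cdots a_1$. Let $G$ be a group generated as a monoid by a finite set $A$, with surjective monoid homomorphism $\pi_G\colon A^\ast\to G$. A regular language $R\subseteq A^\ast$ is a language of normal forms for $G$ if every element of $G$ is represented (via $\pi_G$) by exactly one word of $R$. With $\#_1,\#_2$ new symbols not in $A$, let $\mathcal{T}_G(R)=\{u\#_1v\#_2w^{\mathrm{rev}}\mid u,v,w\in R,\ \pi_G(u)\pi_G(v)=\pi_G(w)\}$. For a class $\mathbf{C}$ of languages, $G$ is $\mathbf{C}$-tabled if (for some finite generating set $A$) there is a regular language $R\subseteq A^\ast$ of normal forms for $G$ with $\mathcal{T}_G(R)\in\mathbf{C}$. $\mathbf{IND}$ is the class of indexed languages (Aho): an indexed grammar has disjoint finite sets $N$ (nonterminals), $T$ (terminals), $F$ (indices, or flags), a start symbol $\Sigma\in N$, a finite set $P$ of productions $B\to\alpha$ with $B\in N$, $\alpha\in(NF^\ast\cup T)^\ast$, and each index $f\in F$ is itself a finite set of index productions $B\to\alpha$ with $B\in N$, $\alpha\in(N\cup T)^\ast$. Sentential forms are words in $(NF^\ast\cup T)^\ast$. A derivation step is either: (i) replace a factor $B\delta$ (with $B\in N$ and $\delta\in F^\ast$ its full index string) by $X_1\eta_1\delta_1\cdots X_k\eta_k\delta_k$, where $B\to X_1\eta_1\cdots X_k\eta_k$ is in $P$ with $X_i\in N\cup T$, $\eta_i\in F^\ast$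 ($\eta_i=\varepsilon$ if $X_i\in T$), and $\delta_i=\delta$ if $X_i\in N$, $\delta_i=\varepsilon$ if $X_i\in T$; or (ii) replace a factor $Bf\delta$ (with $f\delta$ the full index string of $B$) by $X_1\delta_1\cdots X_k\delta_k$, where $B\to X_1\cdots X_k$ is an index production in $f$ and the $\delta_i$ are as in (i). The language generated is the set of words in $T^\ast$ derivable from $\Sigma$. *)

theory Defs
  imports "HOL-Algebra.Group"
begin

text \<open>
  The free product is the monoid of words over the disjoint union of the two carriers, modulo the
  congruence generated by the two multiplication tables and by the deletion of identity letters.
\<close>

abbreviation fp_words :: "('a, 'c) monoid_scheme \<Rightarrow> ('b, 'd) monoid_scheme \<Rightarrow> ('a + 'b) list set"
  where "fp_words G H \<equiv> lists (carrier G <+> carrier H)"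

inductive fp_step ::
  "('a, 'c) monoid_scheme \<Rightarrow> ('b, 'd) monoid_scheme \<Rightarrow> ('a + 'b) list \<Rightarrow> ('a + 'b) list \<Rightarrow> bool"
  for G (structure) and H (structure) where
  mult1: "\<lbrakk>u \<in> fp_words G H; v \<in> fp_words G H; x \<in> carrier G; y \<in> carrier G\<rbrakk>
    \<Longrightarrow> fp_step G H (u @ [Inl x, Inl y] @ v) (u @ [Inl (x \<otimes>\<^bsub>G\<^esub> y)] @ v)"
| mult2: "\<lbrakk>u \<in> fp_words G H; v \<in> fp_words G H; x \<in> carrier H; y \<in> carrier H\<rbrakk>
    \<Longrightarrow> fp_step G H (u @ [Inr x, Inr y] @ v) (u @ [Inr (x \<otimes>\<^bsub>H\<^esub> y)] @ v)"
| one1: "\<lbrakk>u \<in> fp_words G H; v \<in> fp_words G H\<rbrakk>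
    \<Longrightarrow> fp_step G H (u @ [Inl \<one>\<^bsub>G\<^esub>] @ v) (u @ v)"
| one2: "\<lbrakk>u \<in> fp_words G H; v \<in> fp_words G H\<rbrakk>
    \<Longrightarrow> fp_step G H (u @ [Inr \<one>\<^bsub>H\<^esub>] @ v) (u @ v)"

definition fp_rel ::
  "('a, 'c) monoid_scheme \<Rightarrow> ('b, 'd) monoid_scheme \<Rightarrow> (('a + 'b) list \<times> ('a + 'b) list) set"
  where "fp_rel G H =
    {(u, v). u \<in> fp_words G H \<and> v \<in> fp_words G H \<and> equivclp (fp_step G H) u v}"

definition free_product ::
  "('a, 'c) monoid_scheme \<Rightarrow> ('b, 'd) monoid_scheme \<Rightarrow> ('a + 'b) list set monoid"
  where "free_product G H =
    \<lparr>carrier = fp_words G H // fp_rel G H,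
     mult = (\<lambda>X Y. \<Union>u\<in>X. \<Union>v\<in>Y. fp_rel G H `` {u @ v}),
     one = fp_rel G H `` {[]}\<rparr>"

lemma Inl_Inr_in_Plus [simp]:
  "Inl x \<in> A <+> B \<longleftrightarrow> x \<in> A" "Inr y \<in> A <+> B \<longleftrightarrow> y \<in> B"
  by auto

lemma equiv_fp_rel: "equiv (fp_words G H) (fp_rel G H)"
proof (rule equivI)
  show "fp_rel G H \<subseteq> fp_words G H \<times> fp_words G H" by (auto simp: fp_rel_def)
  show "refl_on (fp_words G H) (fp_rel G H)" by (auto simp: fp_rel_def refl_on_def)
  show "sym (fp_rel G H)" by (auto simp: fp_rel_def sym_def intro: equivclp_sym)
  show "trans (fp_rel G H)" by (auto simp: fp_rel_def trans_def intro: equivclp_trans)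
qed

lemma fp_step_ctxt:
  assumes "fp_step G H u v" "x \<in> fp_words G H" "y \<in> fp_words G H"
  shows "fp_step G H (x @ u @ y) (x @ v @ y)"
  using assms(1)
proof cases
  case (mult1 a b g h)
  then show ?thesis using fp_step.mult1[of "x @ a" G H "b @ y" g h] assms by auto
next
  case (mult2 a b g h)
  then show ?thesis using fp_step.mult2[of "x @ a" G H "b @ y" g h] assms by auto
next
  case (one1 a b)
  then show ?thesis using fp_step.one1[of "x @ a" G H "b @ y"] assms by auto
next
  case (one2 a b)
  then show ?thesis using fp_step.one2[of "x @ a" G H "b @ y"] assms by auto
qed

lemma fp_equivclp_ctxt:
  assumes "equivclp (fp_step G H) u v" "x \<in> fp_words G H" "y \<in> fp_words G H"
  shows "equivclp (fp_step G H) (x @ u @ y) (x @ v @ y)"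
  using assms(1)
proof (induction rule: equivclp_induct)
  case base
  then show ?case by simp
next
  case (step v w)
  then have "equivclp (fp_step G H) (x @ v @ y) (x @ w @ y)"
    using fp_step_ctxt[OF _ assms(2,3)] by (blast intro: r_into_equivclp converse_r_into_equivclp)
  then show ?case using step.IH by (rule equivclp_trans[rotated])
qed

lemma fp_rel_append:
  assumes "(u, u') \<in> fp_rel G H" "(v, v') \<in> fp_rel G H"
  shows "(u @ v, u' @ v') \<in> fp_rel G H"
proof -
  have "equivclp (fp_step G H) (u @ v) (u' @ v)"
    using fp_equivclp_ctxt[of G H u u' "[]" v] assms by (auto simp: fp_rel_def)
  moreover have "equivclp (fp_step G H) (u' @ v) (u' @ v')"
    using fp_equivclp_ctxt[of G H v v' u' "[]"] assms by (auto simp: fp_rel_def)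
  ultimately show ?thesis
    using assms by (auto simp: fp_rel_def intro: equivclp_trans)
qed

lemma fp_rel_stepI:
  "\<lbrakk>fp_step G H u v; u \<in> fp_words G H; v \<in> fp_words G H\<rbrakk> \<Longrightarrow> (u, v) \<in> fp_rel G H"
  by (auto simp: fp_rel_def)

lemma free_product_mult_class:
  assumes "u \<in> fp_words G H" "v \<in> fp_words G H"
  shows "fp_rel G H `` {u} \<otimes>\<^bsub>free_product G H\<^esub> fp_rel G H `` {v} = fp_rel G H `` {u @ v}"
proof -
  have "congruent2 (fp_rel G H) (fp_rel G H) (\<lambda>u v. fp_rel G H `` {u @ v})"
    by (intro congruent2I') (rule equiv_class_eq[OF equiv_fp_rel fp_rel_append])
  from UN_equiv_class2[OF equiv_fp_rel equiv_fp_rel this assms] show ?thesis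
    by (simp add: free_product_def)
qed

lemma fp_left_inverse:
  assumes "group G" "group H" "w \<in> fp_words G H"
  shows "\<exists>w' \<in> fp_words G H. (w' @ w, []) \<in> fp_rel G H"
  using assms(3)
proof (induction w)
  case Nil
  then show ?case by (intro bexI[of _ "[]"]) (auto simp: fp_rel_def)
next
  case (Cons a w)
  interpret G: group G by fact
  interpret H: group H by fact
  have "\<exists>b \<in> carrier G <+> carrier H. ([b, a], []) \<in> fp_rel G H"
  proof (cases a)
    case (Inl x)
    with Cons have x: "x \<in> carrier G" by auto
    have "([Inl (inv\<^bsub>G\<^esub> x), Inl x], [Inl \<one>\<^bsub>G\<^esub>]) \<in> fp_rel G H"
      using fp_step.mult1[of "[]" G H "[]" "inv\<^bsub>G\<^esub> x" x] x by (intro fp_rel_stepI) auto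
    moreover have "([Inl \<one>\<^bsub>G\<^esub>], []) \<in> fp_rel G H"
      using fp_step.one1[of "[]" G H "[]"] by (intro fp_rel_stepI) auto
    ultimately have "([Inl (inv\<^bsub>G\<^esub> x), Inl x], []) \<in> fp_rel G H"
      using equiv_fp_rel[of G H] by (meson equivE transD)
    then show ?thesis using Inl x by blast
  next
    case (Inr x)
    with Cons have x: "x \<in> carrier H" by auto
    have "([Inr (inv\<^bsub>H\<^esub> x), Inr x], [Inr \<one>\<^bsub>H\<^esub>]) \<in> fp_rel G H"
      using fp_step.mult2[of "[]" G H "[]" "inv\<^bsub>H\<^esub> x" x] x by (intro fp_rel_stepI) auto
    moreover have "([Inr \<one>\<^bsub>H\<^esub>], []) \<in> fp_rel G H"
      using fp_step.one2[of "[]" G H "[]"] by (intro fp_rel_stepI) auto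
    ultimately have "([Inr (inv\<^bsub>H\<^esub> x), Inr x], []) \<in> fp_rel G H"
      using equiv_fp_rel[of G H] by (meson equivE transD)
    then show ?thesis using Inr x by blast
  qed
  then obtain b where b: "b \<in> carrier G <+> carrier H" "([b, a], []) \<in> fp_rel G H" by blast
  obtain w' where w': "w' \<in> fp_words G H" "(w' @ w, []) \<in> fp_rel G H" using Cons by blast
  have w: "w \<in> fp_words G H" using Cons by auto
  then have r: "(w', w') \<in> fp_rel G H" "(w, w) \<in> fp_rel G H" using w' by (auto simp: fp_rel_def)
  have "((w' @ [b]) @ a # w, w' @ w) \<in> fp_rel G H"
    using fp_rel_append[OF r(1) fp_rel_append[OF b(2) r(2)]] by simp
  then have "((w' @ [b]) @ a # w, []) \<in> fp_rel G H"
    using w'(2) equiv_fp_rel[of G H] by (meson equivE transD)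
  then show ?case using w' b by (intro bexI[of _ "w' @ [b]"]) auto
qed

lemma free_product_carrierE:
  assumes "X \<in> carrier (free_product G H)"
  obtains u where "u \<in> fp_words G H" "X = fp_rel G H `` {u}"
  using assms by (auto simp: free_product_def elim!: quotientE)

lemma free_product_classI:
  "u \<in> fp_words G H \<Longrightarrow> fp_rel G H `` {u} \<in> carrier (free_product G H)"
  by (auto simp: free_product_def intro: quotientI)

lemma free_product_one: "\<one>\<^bsub>free_product G H\<^esub> = fp_rel G H `` {[]}"
  by (simp add: free_product_def)

theorem group_free_product:
  assumes "group G" "group H"
  shows "group (free_product G H)"
proof (rule groupI)
  fix X Y assume "X \<in> carrier (free_product G H)" "Y \<in> carrier (free_product G H)"
  then show "X \<otimes>\<^bsub>free_product G H\<^esub> Y \<in> carrier (free_product G H)"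
    by (elim free_product_carrierE) (simp add: free_product_mult_class free_product_classI)
next
  show "\<one>\<^bsub>free_product G H\<^esub> \<in> carrier (free_product G H)"
    by (simp add: free_product_one free_product_classI)
next
  fix X Y Z
  assume "X \<in> carrier (free_product G H)" "Y \<in> carrier (free_product G H)"
    "Z \<in> carrier (free_product G H)"
  then show "X \<otimes>\<^bsub>free_product G H\<^esub> Y \<otimes>\<^bsub>free_product G H\<^esub> Z =
    X \<otimes>\<^bsub>free_product G H\<^esub> (Y \<otimes>\<^bsub>free_product G H\<^esub> Z)"
    by (elim free_product_carrierE) (simp add: free_product_mult_class)
next
  fix X assume "X \<in> carrier (free_product G H)"
  then show "\<one>\<^bsub>free_product G H\<^esub> \<otimes>\<^bsub>free_product G H\<^esub> X = X"
    by (elim free_product_carrierE) (simp add: free_product_mult_class free_product_one)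
next
  fix X assume "X \<in> carrier (free_product G H)"
  then obtain u where u: "u \<in> fp_words G H" "X = fp_rel G H `` {u}"
    by (elim free_product_carrierE)
  obtain u' where u': "u' \<in> fp_words G H" "(u' @ u, []) \<in> fp_rel G H"
    using fp_left_inverse[OF assms u(1)] by blast
  then have "fp_rel G H `` {u'} \<otimes>\<^bsub>free_product G H\<^esub> X = \<one>\<^bsub>free_product G H\<^esub>"
    using u equiv_class_eq[OF equiv_fp_rel u'(2)]
    by (simp add: free_product_mult_class free_product_one)
  then show "\<exists>Y\<in>carrier (free_product G H).
      Y \<otimes>\<^bsub>free_product G H\<^esub> X = \<one>\<^bsub>free_product G H\<^esub>"
    using free_product_classI[OF u'(1)] by blast
qed

theorem free_product_universal:
  fixes K :: "('k, 'e) monoid_scheme"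
  assumes "group G" "group H" "group K" and f: "f \<in> hom G K" and g: "g \<in> hom H K"
  defines "\<iota>\<^sub>1 \<equiv> (\<lambda>x. fp_rel G H `` {[Inl x]})" and "\<iota>\<^sub>2 \<equiv> (\<lambda>y. fp_rel G H `` {[Inr y]})"
  shows "\<iota>\<^sub>1 \<in> hom G (free_product G H)" "\<iota>\<^sub>2 \<in> hom H (free_product G H)"
    and "\<exists>h \<in> hom (free_product G H) K.
      (\<forall>x\<in>carrier G. h (\<iota>\<^sub>1 x) = f x) \<and> (\<forall>y\<in>carrier H. h (\<iota>\<^sub>2 y) = g y)"
    and "\<lbrakk>h \<in> hom (free_product G H) K; h' \<in> hom (free_product G H) K;
      \<forall>x\<in>carrier G. h (\<iota>\<^sub>1 x) = h' (\<iota>\<^sub>1 x); \<forall>y\<in>carrier H. h (\<iota>\<^sub>2 y) = h' (\<iota>\<^sub>2 y);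
      X \<in> carrier (free_product G H)\<rbrakk> \<Longrightarrow> h X = h' X"
proof -
  interpret G: group G by fact
  interpret H: group H by fact
  interpret K: group K by fact
  interpret P: group "free_product G H" by (rule group_free_product) fact+
  interpret f: group_hom G K f by unfold_locales (rule f)
  interpret g: group_hom H K g by unfold_locales (rule g)
  show \<iota>\<^sub>1: "\<iota>\<^sub>1 \<in> hom G (free_product G H)"
  proof (rule homI)
    fix x y assume xy: "x \<in> carrier G" "y \<in> carrier G"
    have "([Inl x, Inl y], [Inl (x \<otimes>\<^bsub>G\<^esub> y)]) \<in> fp_rel G H"
      using fp_step.mult1[of "[]" G H "[]" x y] xy by (intro fp_rel_stepI) auto
    then have "fp_rel G H `` {[Inl x, Inl y]} = fp_rel G H `` {[Inl (x \<otimes>\<^bsub>G\<^esub> y)]}"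
      by (rule equiv_class_eq[OF equiv_fp_rel])
    then show "\<iota>\<^sub>1 (x \<otimes>\<^bsub>G\<^esub> y) = \<iota>\<^sub>1 x \<otimes>\<^bsub>free_product G H\<^esub> \<iota>\<^sub>1 y"
      using xy
      by (simp add: \<iota>\<^sub>1_def free_product_mult_class)
  qed (auto simp: \<iota>\<^sub>1_def intro!: free_product_classI)
  show \<iota>\<^sub>2: "\<iota>\<^sub>2 \<in> hom H (free_product G H)"
  proof (rule homI)
    fix x y assume xy: "x \<in> carrier H" "y \<in> carrier H"
    have "([Inr x, Inr y], [Inr (x \<otimes>\<^bsub>H\<^esub> y)]) \<in> fp_rel G H"
      using fp_step.mult2[of "[]" G H "[]" x y] xy by (intro fp_rel_stepI) auto
    then have "fp_rel G H `` {[Inr x, Inr y]} = fp_rel G H `` {[Inr (x \<otimes>\<^bsub>H\<^esub> y)]}"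
      by (rule equiv_class_eq[OF equiv_fp_rel])
    then show "\<iota>\<^sub>2 (x \<otimes>\<^bsub>H\<^esub> y) = \<iota>\<^sub>2 x \<otimes>\<^bsub>free_product G H\<^esub> \<iota>\<^sub>2 y"
      using xy
      by (simp add: \<iota>\<^sub>2_def free_product_mult_class)
  qed (auto simp: \<iota>\<^sub>2_def intro!: free_product_classI)
  define ev where "ev = (\<lambda>w. foldr (\<lambda>s z. case_sum f g s \<otimes>\<^bsub>K\<^esub> z) w \<one>\<^bsub>K\<^esub>)"
  have ev_closed: "ev w \<in> carrier K" if "w \<in> fp_words G H" for w
    using that by (induction w) (auto simp: ev_def)
  have ev_append: "ev (u @ v) = ev u \<otimes>\<^bsub>K\<^esub> ev v"
    if "u \<in> fp_words G H" "v \<in> fp_words G H" for u v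
    using that(1)
  proof (induction u)
    case Nil
    then show ?case using ev_closed[OF that(2)] by (simp add: ev_def)
  next
    case (Cons a u)
    then have "case_sum f g a \<in> carrier K" "u \<in> fp_words G H" by auto
    then show ?case
      using Cons ev_closed[OF that(2)] ev_closed[of u] by (simp add: ev_def K.m_assoc)
  qed
  have ev_one: "x \<in> carrier G \<Longrightarrow> ev [Inl x] = f x" "y \<in> carrier H \<Longrightarrow> ev [Inr y] = g y" for x y
    by (simp_all add: ev_def)
  have ev_step: "ev u = ev v" if "fp_step G H u v" for u v
    using that
  proof cases
    case (mult1 a b x y)
    then have "ev [Inl x, Inl y] = ev [Inl (x \<otimes>\<^bsub>G\<^esub> y)]" by (simp add: ev_def)
    then show ?thesis using mult1 by (simp add: ev_append del: append_Cons)
  next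
    case (mult2 a b x y)
    then have "ev [Inr x, Inr y] = ev [Inr (x \<otimes>\<^bsub>H\<^esub> y)]" by (simp add: ev_def)
    then show ?thesis using mult2 by (simp add: ev_append del: append_Cons)
  next
    case (one1 a b)
    then show ?thesis using ev_closed by (simp add: ev_append del: append_Cons) (simp add: ev_def)
  next
    case (one2 a b)
    then show ?thesis using ev_closed by (simp add: ev_append del: append_Cons) (simp add: ev_def)
  qed
  have ev_equiv: "ev u = ev v" if "(u, v) \<in> fp_rel G H" for u v
  proof -
    have "equivclp (fp_step G H) u v" using that by (simp add: fp_rel_def)
    then show ?thesis by (induction rule: equivclp_induct) (use ev_step in force)+
  qed
  define h where "h = (\<lambda>X. the_elem (ev ` X))"
  have h: "h (fp_rel G H `` {u}) = ev u" if "u \<in> fp_words G H" for u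
  proof -
    have "u \<in> fp_rel G H `` {u}" using that by (auto simp: fp_rel_def)
    moreover have "ev v = ev u" if "v \<in> fp_rel G H `` {u}" for v
      using that ev_equiv by auto
    ultimately have "ev ` (fp_rel G H `` {u}) = {ev u}" by blast
    then show ?thesis by (simp add: h_def)
  qed
  have "h \<in> hom (free_product G H) K"
  proof (rule homI)
    fix X assume "X \<in> carrier (free_product G H)"
    then show "h X \<in> carrier K" by (elim free_product_carrierE) (simp add: h ev_closed)
  next
    fix X Y assume "X \<in> carrier (free_product G H)" "Y \<in> carrier (free_product G H)"
    then show "h (X \<otimes>\<^bsub>free_product G H\<^esub> Y) = h X \<otimes>\<^bsub>K\<^esub> h Y"
      by (elim free_product_carrierE) (simp add: free_product_mult_class h ev_append)
  qed
  moreover have "h (\<iota>\<^sub>1 x) = f x" if "x \<in> carrier G" for x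
    using that h[of "[Inl x]"] by (auto simp: \<iota>\<^sub>1_def ev_one)
  moreover have "h (\<iota>\<^sub>2 y) = g y" if "y \<in> carrier H" for y
    using that h[of "[Inr y]"] by (auto simp: \<iota>\<^sub>2_def ev_one)
  ultimately show "\<exists>h \<in> hom (free_product G H) K.
      (\<forall>x\<in>carrier G. h (\<iota>\<^sub>1 x) = f x) \<and> (\<forall>y\<in>carrier H. h (\<iota>\<^sub>2 y) = g y)" by blast
  show "h X = h' X"
    if hom: "h \<in> hom (free_product G H) K" "h' \<in> hom (free_product G H) K"
      and eq: "\<forall>x\<in>carrier G. h (\<iota>\<^sub>1 x) = h' (\<iota>\<^sub>1 x)" "\<forall>y\<in>carrier H. h (\<iota>\<^sub>2 y) = h' (\<iota>\<^sub>2 y)"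
      and X: "X \<in> carrier (free_product G H)" for h h' X
  proof -
    have "h (fp_rel G H `` {u}) = h' (fp_rel G H `` {u})" if "u \<in> fp_words G H" for u
      using that
    proof (induction u)
      case Nil
      have "h \<one>\<^bsub>free_product G H\<^esub> = h' \<one>\<^bsub>free_product G H\<^esub>"
        using hom_one[OF hom(1) P.is_group K.is_group] hom_one[OF hom(2) P.is_group K.is_group]
        by simp
      then show ?case by (simp add: free_product_one)
    next
      case (Cons a u)
      let ?a = "fp_rel G H `` {[a]}" and ?u = "fp_rel G H `` {u}"
      have m: "[a] \<in> fp_words G H" "u \<in> fp_words G H" using Cons by auto
      then have c: "?a \<in> carrier (free_product G H)" "?u \<in> carrier (free_product G H)"
        by (simp_all add: free_product_classI)
      have "fp_rel G H `` {a # u} = ?a \<otimes>\<^bsub>free_product G H\<^esub> ?u"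
        using free_product_mult_class[OF m] by simp
      moreover have "h ?a = h' ?a"
        using Cons eq by (cases a) (auto simp: \<iota>\<^sub>1_def \<iota>\<^sub>2_def)
      ultimately show ?case
        using Cons hom c by (simp add: hom_mult)
    qed
    then show ?thesis using X by (elim free_product_carrierE) simp
  qed
qed

text \<open>
  Acceptance by a complete deterministic finite automaton over the alphabet \<open>A\<close>.
  Naming the finitely many states by natural numbers is no restriction.
\<close>

definition regular_language :: "'a set \<Rightarrow> 'a list set \<Rightarrow> bool"
  where "regular_language A R \<longleftrightarrow>
    (\<exists>(Q :: nat set) q\<^sub>0 E \<delta>.
       finite A \<and> finite Q \<and> q\<^sub>0 \<in> Q \<and> E \<subseteq> Q \<and> (\<forall>q\<in>Q. \<forall>a\<in>A. \<delta> q a \<in> Q) \<and>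
       R = {w \<in> lists A. foldl \<delta> q\<^sub>0 w \<in> E})"

text \<open>
  \<open>NT B \<eta>\<close> is the nonterminal \<open>B\<close> together with its full index string \<open>\<eta>\<close>, leftmost
  index first, so that a word in $(NF^* \cup T)^*$ is a list of such symbols and splits into
  factors in only one way.
\<close>

datatype ('n, 't, 'f) isym = NT 'n "'f list" | Tm 't

text \<open>An index is literally a set of index productions \<open>B \<rightarrow> \<alpha>\<close> with $\alpha \in (N \cup T)^*$.\<close>

type_synonym ('n, 't) index = "('n \<times> ('n + 't) list) set"

record ('n, 't) indexed_grammar =
  nonterminals :: "'n set"
  terminals :: "'t set"
  indices :: "('n, 't) index set"
  start :: 'n
  productions :: "('n \<times> ('n, 't, ('n, 't) index) isym list) set"

definition isyms :: "('n, 't) indexed_grammar \<Rightarrow> ('n, 't, ('n, 't) index) isym set"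
  where "isyms \<Gamma> =
    {NT B \<eta> | B \<eta>. B \<in> nonterminals \<Gamma> \<and> \<eta> \<in> lists (indices \<Gamma>)} \<union> Tm ` terminals \<Gamma>"

definition is_indexed_grammar :: "('n, 't) indexed_grammar \<Rightarrow> bool"
  where "is_indexed_grammar \<Gamma> \<longleftrightarrow>
    finite (nonterminals \<Gamma>) \<and> finite (terminals \<Gamma>) \<and> finite (indices \<Gamma>) \<and>
    start \<Gamma> \<in> nonterminals \<Gamma> \<and>
    finite (productions \<Gamma>) \<and> productions \<Gamma> \<subseteq> nonterminals \<Gamma> \<times> lists (isyms \<Gamma>) \<and>
    (\<forall>f\<in>indices \<Gamma>. finite f \<and>
       f \<subseteq> nonterminals \<Gamma> \<times> lists (nonterminals \<Gamma> <+> terminals \<Gamma>))"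

fun distribute :: "'f list \<Rightarrow> ('n, 't, 'f) isym \<Rightarrow> ('n, 't, 'f) isym" where
  "distribute \<delta> (NT X \<eta>) = NT X (\<eta> @ \<delta>)"
| "distribute \<delta> (Tm a) = Tm a"

fun unflagged :: "'n + 't \<Rightarrow> ('n, 't, 'f) isym" where
  "unflagged (Inl X) = NT X []"
| "unflagged (Inr a) = Tm a"

inductive derives1 ::
  "('n, 't) indexed_grammar \<Rightarrow> ('n, 't, ('n, 't) index) isym list \<Rightarrow>
   ('n, 't, ('n, 't) index) isym list \<Rightarrow> bool"
  for \<Gamma> where
  production: "(B, \<alpha>) \<in> productions \<Gamma>
    \<Longrightarrow> derives1 \<Gamma> (u @ [NT B \<delta>] @ v) (u @ map (distribute \<delta>) \<alpha> @ v)"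
| index_production: "\<lbrakk>f \<in> indices \<Gamma>; (B, \<alpha>) \<in> f\<rbrakk>
    \<Longrightarrow> derives1 \<Gamma> (u @ [NT B (f # \<delta>)] @ v)
          (u @ map (\<lambda>X. distribute \<delta> (unflagged X)) \<alpha> @ v)"

definition generated_language :: "('n, 't) indexed_grammar \<Rightarrow> 't list set"
  where "generated_language \<Gamma> =
    {w \<in> lists (terminals \<Gamma>). (derives1 \<Gamma>)\<^sup>*\<^sup>* [NT (start \<Gamma>) []] (map Tm w)}"

text \<open>Naming the finitely many nonterminals by natural numbers is no restriction.\<close>

definition IND :: "'t list set set"
  where "IND = {generated_language \<Gamma> | \<Gamma> :: (nat, 't) indexed_grammar. is_indexed_grammar \<Gamma>}"

definition free_monoid :: "'a set \<Rightarrow> 'a list monoid"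
  where "free_monoid A = \<lparr>carrier = lists A, mult = (@), one = []\<rparr>"

text \<open>
  Members of \<open>epi\<close> need not preserve the identity in general; into a group they do, since
  the image of \<open>[]\<close> is idempotent.
\<close>

definition monoid_generators :: "('g, 'm) monoid_scheme \<Rightarrow> 'a set \<Rightarrow> ('a list \<Rightarrow> 'g) \<Rightarrow> bool"
  where "monoid_generators G A \<pi> \<longleftrightarrow> finite A \<and> \<pi> \<in> epi (free_monoid A) G"

definition regular_normal_forms ::
  "('g, 'm) monoid_scheme \<Rightarrow> 'a set \<Rightarrow> ('a list \<Rightarrow> 'g) \<Rightarrow> 'a list set \<Rightarrow> bool"
  where "regular_normal_forms G A \<pi> R \<longleftrightarrow>
    regular_language A R \<and> (\<forall>g\<in>carrier G. \<exists>!w. w \<in> R \<and> \<pi> w = g)"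

text \<open>The new separators $\#_1, \#_2$ are distinct from all letters by construction.\<close>

datatype 'a tsym = Letter 'a | Hash1 | Hash2

definition mult_table ::
  "('g, 'm) monoid_scheme \<Rightarrow> ('a list \<Rightarrow> 'g) \<Rightarrow> 'a list set \<Rightarrow> 'a tsym list set"
  where "mult_table G \<pi> R =
    {map Letter u @ [Hash1] @ map Letter v @ [Hash2] @ map Letter (rev w) | u v w.
       u \<in> R \<and> v \<in> R \<and> w \<in> R \<and> \<pi> u \<otimes>\<^bsub>G\<^esub> \<pi> v = \<pi> w}"

text \<open>
  The finite generating set is given as a finite alphabet of natural numbers with a
  surjection \<open>\<pi>\<close> from its words; \<open>\<pi>\<close> may identify letters.
\<close>

definition tabled :: "nat tsym list set set \<Rightarrow> ('g, 'm) monoid_scheme \<Rightarrow> bool"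
  where "tabled \<C> G \<longleftrightarrow>
    (\<exists>(A :: nat set) \<pi> R.
       monoid_generators G A \<pi> \<and> regular_normal_forms G A \<pi> R \<and> mult_table G \<pi> R \<in> \<C>)"

end

theory Submission
  imports Defs
begin

text \<open>
  Write elements of the free product as alternating products of nonidentity elements of the factors,
  and spell each of these by its normal form. If $u = p s$ and $v = s^{-1} q$ with $s$ as long as
  possible, then the reduced form of $uv$ is $pq$, except that the last syllable of $p$ and the first
  of $q$ are multiplied when they lie in the same factor. Hence a word of the multiplication table
  consists of nested pieces: syllables of $p$ together with their mirror images, syllables of $s$
  around $\#_1$ together with their inverses, syllables of $q$ around $\#_2$ together with their
  mirror images, and at most one genuine product in a factor. This is a context-free grammar
  except that the right-hand sides of a nonterminal form infinite languages. Each of them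
  is the image of the multiplication table of a factor under a finite-state transduction, which
  erases the entries that are the identity. So it suffices that the indexed languages are closed
  under transductions (attach to each nonterminal the states before and after the word derived from
  it) and under context-free nesting (attach to each nonterminal the grammar it belongs to).
\<close>

section \<open>Indexed grammars as infinite context-free grammars\<close>

text \<open>The table of one factor supplies every kind of nesting. Its entries with product the
  identity pair a syllable with its inverse. Those whose left entry is the identity pair a syllable
  with its mirror image, because the third component is reversed. The remaining ones carry genuine
  products. A transducer separates these kinds by comparing each entry with the normal form of the
  identity, and writes nonterminals in place of the separators.

  The factors of the syllables where \<open>p\<close>, \<open>s\<close> and \<open>q\<close> meet
  decide the shape of the grammar. If \<open>s\<close> is not empty, the last syllable of
  \<open>p\<close> and the first of \<open>q\<close> both lie in the factor opposite to that of the
  first syllable of \<open>s\<close>. Hence they have to be multiplied, and maximality of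
  \<open>s\<close> makes their product a nonidentity element, after which nothing cancels any more.
  They can lie in different factors only if \<open>s\<close> is empty, and then \<open>p\<close> and
  \<open>q\<close> are simply joined. It is therefore enough that each nonterminal remembers the
  factor in which its piece begins.\<close>

text \<open>
  \<open>yields\<close> allows infinitely many nonterminals, so that a nonterminal of an indexed grammar together
  with its index string is one of them.
\<close>

inductive yields :: "('v \<Rightarrow> ('v + 't) list set) \<Rightarrow> ('v + 't) list \<Rightarrow> 't list \<Rightarrow> bool"
  for S where
  Nil: "yields S [] []"
| Term: "yields S \<alpha> w \<Longrightarrow> yields S (Inr a # \<alpha>) (a # w)"
| Rule: "\<lbrakk>\<beta> \<in> S v; yields S \<beta> u; yields S \<alpha> w\<rbrakk> \<Longrightarrow> yields S (Inl v # \<alpha>) (u @ w)"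

lemma yields_Nil [simp]: "yields S [] w \<longleftrightarrow> w = []"
  by (auto intro: yields.Nil elim: yields.cases)

lemma yields_Inr [simp]: "yields S (Inr a # \<alpha>) w \<longleftrightarrow> (\<exists>w'. w = a # w' \<and> yields S \<alpha> w')"
  by (auto intro: yields.Term elim: yields.cases)

lemma yields_Inl:
  "yields S (Inl v # \<alpha>) w \<longleftrightarrow>
    (\<exists>\<beta>\<in>S v. \<exists>u w'. w = u @ w' \<and> yields S \<beta> u \<and> yields S \<alpha> w')"
proof
  assume "yields S (Inl v # \<alpha>) w"
  then show "\<exists>\<beta>\<in>S v. \<exists>u w'. w = u @ w' \<and> yields S \<beta> u \<and> yields S \<alpha> w'"
    by cases auto
qed (auto intro: yields.Rule)

lemma yields_single: "yields S [Inl v] w \<longleftrightarrow> (\<exists>\<beta>\<in>S v. yields S \<beta> w)"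
  by (simp add: yields_Inl)

lemma yields_append:
  "yields S (\<alpha> @ \<beta>) w \<longleftrightarrow> (\<exists>u v. w = u @ v \<and> yields S \<alpha> u \<and> yields S \<beta> v)"
proof (induction \<alpha> arbitrary: w)
  case (Cons x \<alpha>)
  show ?case
  proof (cases x)
    case (Inl v)
    have "yields S ((x # \<alpha>) @ \<beta>) w \<longleftrightarrow>
        (\<exists>\<gamma>\<in>S v. \<exists>u u1 u2. w = u @ u1 @ u2 \<and> yields S \<gamma> u \<and> yields S \<alpha> u1 \<and> yields S \<beta> u2)"
      by (simp add: Inl yields_Inl Cons) blast
    also have "\<dots> \<longleftrightarrow> (\<exists>u v. w = u @ v \<and> yields S (x # \<alpha>) u \<and> yields S \<beta> v)"
      by (simp add: Inl yields_Inl) (metis append.assoc)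
    finally show ?thesis .
  next
    case (Inr a)
    then show ?thesis by (simp add: Cons) (metis append_Cons)
  qed
qed simp

lemma yields_map_Inr [simp]: "yields S (map Inr u) w \<longleftrightarrow> w = u"
  by (induction u arbitrary: w) auto

text \<open>Undoes one rewriting step inside a sentential form. This is the induction step that
  turns derivation sequences into derivation trees.\<close>

lemma yields_rewrite:
  assumes "\<gamma> \<in> S x" "yields S (u @ \<gamma> @ v) w"
  shows "yields S (u @ Inl x # v) w"
proof -
  obtain w1 w2 w3 where "w = w1 @ w2 @ w3" "yields S u w1" "yields S \<gamma> w2" "yields S v w3"
    using assms(2) by (auto simp: yields_append)
  with assms(1) show ?thesis by (auto simp: yields_append intro: yields.Rule)
qed

text \<open>A derivation tree can be relabelled from the root downwards, since each rule applied at
  \<open>v\<close> has a counterpart at every related \<open>v'\<close>. Changes of grammar that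
  rename nonterminals or adjoin data to them are handled by two such simulations, one in each
  direction.\<close>

lemma yields_sim:
  assumes "yields S \<alpha> w" "list_all2 (rel_sum R (=)) \<alpha> \<alpha>'"
    and "\<And>v v' \<beta>. \<lbrakk>R v v'; \<beta> \<in> S v\<rbrakk> \<Longrightarrow> \<exists>\<beta>'\<in>S' v'. list_all2 (rel_sum R (=)) \<beta> \<beta>'"
  shows "yields S' \<alpha>' w"
  using assms(1,2)
proof (induction arbitrary: \<alpha>')
  case (Term \<alpha> w a)
  then obtain \<gamma> where "\<alpha>' = Inr a # \<gamma>" "list_all2 (rel_sum R (=)) \<alpha> \<gamma>"
    by (auto simp: list_all2_Cons1 elim: rel_sum.cases)
  then show ?case using Term by simp
next
  case (Rule \<beta> v u \<alpha> w)
  then obtain v' \<gamma> where \<gamma>: "\<alpha>' = Inl v' # \<gamma>" "R v v'" "list_all2 (rel_sum R (=)) \<alpha> \<gamma>"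
    by (auto simp: list_all2_Cons1 elim: rel_sum.cases)
  obtain \<beta>' where "\<beta>' \<in> S' v'" "list_all2 (rel_sum R (=)) \<beta> \<beta>'"
    using assms(3) Rule.hyps \<gamma> by blast
  then show ?case using Rule.IH \<gamma> by (auto intro: yields.Rule)
qed simp

lemma yields_terminals:
  assumes "yields S \<alpha> w" "Inr -` set \<alpha> \<subseteq> T" "\<And>v \<beta>. \<beta> \<in> S v \<Longrightarrow> Inr -` set \<beta> \<subseteq> T"
  shows "w \<in> lists T"
  using assms(1,2) by induction (use assms(3) in \<open>auto simp: vimage_def\<close>)

section \<open>Substituting languages for nonterminals\<close>

primrec expand :: "('x \<Rightarrow> 't list set) \<Rightarrow> ('x + 't) list \<Rightarrow> 't list set" where
  "expand M [] = {[]}"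
| "expand M (s # \<alpha>) =
    {u @ w | u w. (case s of Inl x \<Rightarrow> u \<in> M x | Inr a \<Rightarrow> u = [a]) \<and> w \<in> expand M \<alpha>}"

lemma expand_append: "expand M (\<alpha> @ \<beta>) = {u @ w | u w. u \<in> expand M \<alpha> \<and> w \<in> expand M \<beta>}"
proof (induction \<alpha>)
  case (Cons s \<alpha>)
  let ?C = "\<lambda>u. case s of Inl x \<Rightarrow> u \<in> M x | Inr a \<Rightarrow> u = [a]"
  have "x \<in> expand M ((s # \<alpha>) @ \<beta>) \<longleftrightarrow>
      (\<exists>u v w. x = u @ v @ w \<and> ?C u \<and> v \<in> expand M \<alpha> \<and> w \<in> expand M \<beta>)" for x
    by (simp add: Cons) blast
  moreover have "x \<in> {u @ w | u w. u \<in> expand M (s # \<alpha>) \<and> w \<in> expand M \<beta>} \<longleftrightarrow>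
      (\<exists>u v w. x = u @ v @ w \<and> ?C u \<and> v \<in> expand M \<alpha> \<and> w \<in> expand M \<beta>)" for x
    by simp (metis append.assoc)
  ultimately show ?case by blast
qed auto

lemma expand_map_Inr [simp]: "expand M (map Inr u) = {u}"
  by (induction u) auto

lemma yields_iff_expand:
  "yields S \<alpha> w \<longleftrightarrow> w \<in> expand (\<lambda>x. {w. yields S [Inl x] w}) \<alpha>"
proof (induction \<alpha> arbitrary: w)
  case (Cons s \<alpha>)
  have "yields S (s # \<alpha>) w \<longleftrightarrow> (\<exists>u v. w = u @ v \<and> yields S [s] u \<and> yields S \<alpha> v)"
    using yields_append[of S "[s]" \<alpha> w] by simp
  then show ?case by (cases s) (auto simp: Cons)
qed simp

text \<open>The generated languages form the least solution of the inclusions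
  \<open>expand M \<beta> \<subseteq> M x\<close>. To prove a grammar sound it thus suffices to
  check each rule against an intended meaning \<open>M\<close>.\<close>

lemma yields_least:
  assumes "yields S \<alpha> w" "\<And>x \<beta>. \<beta> \<in> S x \<Longrightarrow> expand M \<beta> \<subseteq> M x"
  shows "w \<in> expand M \<alpha>"
  using assms(1)
proof induction
  case (Rule \<beta> v u \<alpha> w)
  then show ?case using assms(2)[of \<beta> v] by auto
qed auto

text \<open>Indices are mere names here, and \<open>I\<close> lists their productions. A
  construction can then keep the index set and change the productions, which is impossible while an
  index is literally its set of productions.\<close>

definition rules :: "('n \<times> ('n \<times> 'f list + 't) list) set \<Rightarrow> ('f \<Rightarrow> ('n \<times> ('n + 't) list) set)
    \<Rightarrow> 'n \<times> 'f list \<Rightarrow> ('n \<times> 'f list + 't) list set"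
  where "rules P I = (\<lambda>(B, \<delta>).
    {map (map_sum (\<lambda>(X, \<eta>). (X, \<eta> @ \<delta>)) id) \<beta> | \<beta>. (B, \<beta>) \<in> P} \<union>
    {map (map_sum (\<lambda>X. (X, \<delta>')) id) \<beta> | f \<delta>' \<beta>. \<delta> = f # \<delta>' \<and> (B, \<beta>) \<in> I f})"

lemma rules_cases:
  assumes "\<gamma> \<in> rules P I (B, \<delta>)"
  obtains (prod) \<beta> where "(B, \<beta>) \<in> P" "\<gamma> = map (map_sum (\<lambda>(X, \<eta>). (X, \<eta> @ \<delta>)) id) \<beta>"
  | (index) f \<delta>' \<beta> where "\<delta> = f # \<delta>'" "(B, \<beta>) \<in> I f" "\<gamma> = map (map_sum (\<lambda>X. (X, \<delta>')) id) \<beta>"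
  using assms by (auto simp: rules_def)

lemma rules_prod:
  "(B, \<beta>) \<in> P \<Longrightarrow> map (map_sum (\<lambda>(X, \<eta>). (X, \<eta> @ \<delta>)) id) \<beta> \<in> rules P I (B, \<delta>)"
  by (auto simp: rules_def)

lemma rules_index:
  "(B, \<beta>) \<in> I f \<Longrightarrow> map (map_sum (\<lambda>X. (X, \<delta>)) id) \<beta> \<in> rules P I (B, f # \<delta>)"
  by (auto simp: rules_def)

text \<open>The last clause allows \<open>rules\<close> to make no mention of the index set: a flag
  outside \<open>F\<close> can never be consumed.\<close>

definition indexed_rules :: "'n set \<Rightarrow> 'f set \<Rightarrow> 't set \<Rightarrow> ('n \<times> ('n \<times> 'f list + 't) list) set \<Rightarrow>
    ('f \<Rightarrow> ('n \<times> ('n + 't) list) set) \<Rightarrow> bool"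
  where "indexed_rules N F T P I \<longleftrightarrow>
    finite N \<and> finite F \<and> finite T \<and>
    finite P \<and> P \<subseteq> N \<times> lists (N \<times> lists F <+> T) \<and>
    (\<forall>f\<in>F. finite (I f) \<and> I f \<subseteq> N \<times> lists (N <+> T)) \<and> (\<forall>f. f \<notin> F \<longrightarrow> I f = {})"

lemma Inr_eq_map_sum: "Inr b = map_sum f g s \<longleftrightarrow> (\<exists>a. s = Inr a \<and> b = g a)"
  by (cases s) auto

lemma rules_terminals:
  assumes "indexed_rules N F T P I" "\<gamma> \<in> rules P I v"
  shows "Inr -` set \<gamma> \<subseteq> T"
proof -
  obtain B \<delta> where "v = (B, \<delta>)" by (cases v)
  with assms(2) have "\<gamma> \<in> rules P I (B, \<delta>)" by simp
  then show ?thesis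
  proof (cases rule: rules_cases)
    case (prod \<beta>)
    then have "\<beta> \<in> lists (N \<times> lists F <+> T)" using assms(1) by (auto simp: indexed_rules_def)
    then show ?thesis using prod by (auto simp: Inr_eq_map_sum)
  next
    case (index f \<delta>' \<beta>)
    then have "f \<in> F" using assms(1) unfolding indexed_rules_def by (metis empty_iff)
    then have "I f \<subseteq> N \<times> lists (N <+> T)" using assms(1) by (simp add: indexed_rules_def)
    with index have "\<beta> \<in> lists (N <+> T)" by blast
    then show ?thesis using index by (auto simp: Inr_eq_map_sum)
  qed
qed

section \<open>Passage between indexed grammars and systems of rules\<close>

fun sum_of_isym :: "('n, 't, 'f) isym \<Rightarrow> 'n \<times> 'f list + 't" where
  "sum_of_isym (NT B \<eta>) = Inl (B, \<eta>)"
| "sum_of_isym (Tm a) = Inr a"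

lemma Inr_eq_sum_of_isym: "Inr a = sum_of_isym s \<longleftrightarrow> s = Tm a"
  by (cases s) auto

lemma Inl_eq_sum_of_isym: "Inl x = sum_of_isym s \<longleftrightarrow> s = NT (fst x) (snd x)"
  by (cases s) auto

lemma sum_of_isym_distribute:
  "sum_of_isym (distribute \<delta> s) = map_sum (\<lambda>(X, \<eta>). (X, \<eta> @ \<delta>)) id (sum_of_isym s)"
  by (cases s) auto

lemma sum_of_isym_unflagged:
  "sum_of_isym (distribute \<delta> (unflagged s)) = map_sum (\<lambda>X. (X, \<delta>)) id s"
  by (cases s) auto

definition grammar_rules ::
  "('n, 't) indexed_grammar \<Rightarrow> 'n \<times> ('n, 't) index list \<Rightarrow> ('n \<times> ('n, 't) index list + 't) list set"
  where "grammar_rules \<Gamma> = rules (map_prod id (map sum_of_isym) ` productions \<Gamma>)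
    (\<lambda>f. if f \<in> indices \<Gamma> then f else {})"

lemma derives_context:
  "(derives1 \<Gamma>)\<^sup>*\<^sup>* \<alpha> \<beta> \<Longrightarrow> (derives1 \<Gamma>)\<^sup>*\<^sup>* (u @ \<alpha> @ v) (u @ \<beta> @ v)"
proof (induction rule: rtranclp_induct)
  case (step \<beta> \<gamma>)
  from step(2) have "derives1 \<Gamma> (u @ \<beta> @ v) (u @ \<gamma> @ v)"
  proof cases
    case (production B \<alpha> u' \<delta> v')
    then show ?thesis
      using derives1.production[OF production(3), of "u @ u'" \<delta> "v' @ v"] by simp
  next
    case (index_production f B \<alpha> u' \<delta> v')
    then show ?thesis
      using derives1.index_production[OF index_production(3,4), of "u @ u'" \<delta> "v' @ v"] by simp
  qed
  then show ?case using step(3) by simp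
qed simp

lemma derives1_rule:
  assumes "derives1 \<Gamma> \<alpha> \<beta>"
  shows "\<exists>u v x \<gamma>. map sum_of_isym \<alpha> = u @ [Inl x] @ v \<and> map sum_of_isym \<beta> = u @ \<gamma> @ v \<and>
    \<gamma> \<in> grammar_rules \<Gamma> x"
  using assms
proof cases
  case (production B \<gamma> u \<delta> v)
  then have "map sum_of_isym (map (distribute \<delta>) \<gamma>) \<in> grammar_rules \<Gamma> (B, \<delta>)"
    unfolding grammar_rules_def rules_def
    by (force simp: sum_of_isym_distribute comp_def intro!: exI[of _ "map sum_of_isym \<gamma>"])
  then show ?thesis using production by fastforce
next
  case (index_production f B \<gamma> u \<delta> v)
  then have "map sum_of_isym (map (\<lambda>X. distribute \<delta> (unflagged X)) \<gamma>) \<in> grammar_rules \<Gamma> (B, f # \<delta>)"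
    unfolding grammar_rules_def rules_def by (auto simp: sum_of_isym_unflagged comp_def)
  then show ?thesis using index_production by fastforce
qed

lemma rule_derives1:
  assumes "\<gamma> \<in> grammar_rules \<Gamma> (B, \<delta>)"
  shows "\<exists>\<beta>. derives1 \<Gamma> [NT B \<delta>] \<beta> \<and> \<gamma> = map sum_of_isym \<beta>"
  using assms unfolding grammar_rules_def
proof (cases rule: rules_cases)
  case (prod \<beta>)
  then obtain \<alpha> where "(B, \<alpha>) \<in> productions \<Gamma>" "\<beta> = map sum_of_isym \<alpha>" by auto
  then show ?thesis
    using prod derives1.production[of B \<alpha> \<Gamma> "[]" \<delta> "[]"]
    by (auto simp: sum_of_isym_distribute intro!: exI[of _ "map (distribute \<delta>) \<alpha>"])
next
  case (index f \<delta>' \<beta>)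
  then show ?thesis
    using derives1.index_production[of f \<Gamma> B \<beta> "[]" \<delta>' "[]"]
    by (auto simp: sum_of_isym_unflagged split: if_splits
        intro!: exI[of _ "map (\<lambda>X. distribute \<delta>' (unflagged X)) \<beta>"])
qed

text \<open>From left to right, the derivation is read from its end and each step is undone by
  \<open>yields_rewrite\<close>. From right to left, the subtrees are derived one after the other,
  the leftmost first.\<close>

lemma derives_iff_yields:
  "(derives1 \<Gamma>)\<^sup>*\<^sup>* \<alpha> (map Tm w) \<longleftrightarrow> yields (grammar_rules \<Gamma>) (map sum_of_isym \<alpha>) w"
proof
  assume "(derives1 \<Gamma>)\<^sup>*\<^sup>* \<alpha> (map Tm w)"
  then show "yields (grammar_rules \<Gamma>) (map sum_of_isym \<alpha>) w"
  proof (induction rule: converse_rtranclp_induct)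
    case base
    have "map sum_of_isym (map Tm w) = map Inr w" by simp
    then show ?case by (metis yields_map_Inr)
  next
    case (step \<alpha> \<beta>)
    obtain u v x \<gamma> where "map sum_of_isym \<alpha> = u @ [Inl x] @ v"
      "map sum_of_isym \<beta> = u @ \<gamma> @ v" "\<gamma> \<in> grammar_rules \<Gamma> x"
      using derives1_rule[OF step(1)] by blast
    then show ?case using step(3) yields_rewrite[of \<gamma> _ x u v w] by simp
  qed
next
  assume "yields (grammar_rules \<Gamma>) (map sum_of_isym \<alpha>) w"
  then show "(derives1 \<Gamma>)\<^sup>*\<^sup>* \<alpha> (map Tm w)"
  proof (induction "map sum_of_isym \<alpha>" w arbitrary: \<alpha>)
    case (Term \<sigma> w a)
    then obtain \<alpha>' where "\<alpha> = Tm a # \<alpha>'" "\<sigma> = map sum_of_isym \<alpha>'"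
      by (auto simp: Cons_eq_map_conv Inr_eq_sum_of_isym)
    then show ?case using Term derives_context[of \<Gamma> \<alpha>' "map Tm w" "[Tm a]" "[]"] by simp
  next
    case (Rule \<gamma> x u \<sigma> w)
    then obtain B \<delta> \<alpha>' where \<alpha>: "\<alpha> = NT B \<delta> # \<alpha>'" "x = (B, \<delta>)" "\<sigma> = map sum_of_isym \<alpha>'"
      by (cases x) (auto simp: Cons_eq_map_conv Inl_eq_sum_of_isym)
    obtain \<beta> where \<beta>: "derives1 \<Gamma> [NT B \<delta>] \<beta>" "\<gamma> = map sum_of_isym \<beta>"
      using rule_derives1[of \<gamma> \<Gamma> B \<delta>] Rule(1) \<alpha>(2) by auto
    then have "(derives1 \<Gamma>)\<^sup>*\<^sup>* [NT B \<delta>] (map Tm u)"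
      using Rule(3)[OF \<beta>(2)] by (simp add: converse_rtranclp_into_rtranclp)
    then have "(derives1 \<Gamma>)\<^sup>*\<^sup>* \<alpha> (map Tm u @ \<alpha>')"
      using derives_context[of \<Gamma> "[NT B \<delta>]" _ "[]" \<alpha>'] \<alpha> by simp
    also have "(derives1 \<Gamma>)\<^sup>*\<^sup>* (map Tm u @ \<alpha>') (map Tm (u @ w))"
      using derives_context[of \<Gamma> \<alpha>' "map Tm w" "map Tm u" "[]"] Rule \<alpha> by simp
    finally show ?case .
  qed simp
qed

lemma IND_E:
  assumes "L \<in> (IND :: 't list set set)"
  obtains N :: "nat set" and F :: "(nat, 't) index set" and T P I s
  where "indexed_rules N F T P I" "s \<in> N" "L = {w. yields (rules P I) [Inl (s, [])] w}"
proof -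
  obtain \<Gamma> :: "(nat, 't) indexed_grammar"
    where \<Gamma>: "is_indexed_grammar \<Gamma>" "L = generated_language \<Gamma>"
    using assms by (auto simp: IND_def)
  let ?P = "map_prod id (map sum_of_isym) ` productions \<Gamma>"
  let ?I = "\<lambda>f. if f \<in> indices \<Gamma> then f else {}"
  have P: "map_prod id (map sum_of_isym) ` productions \<Gamma> \<subseteq> nonterminals \<Gamma> \<times>
      lists (nonterminals \<Gamma> \<times> lists (indices \<Gamma>) <+> terminals \<Gamma>)"
  proof -
    have "sum_of_isym s \<in> nonterminals \<Gamma> \<times> lists (indices \<Gamma>) <+> terminals \<Gamma>" if "s \<in> isyms \<Gamma>" for s
      using that by (auto simp: isyms_def)
    then show ?thesis
      using \<Gamma>(1) by (fastforce simp: is_indexed_grammar_def lists_eq_set)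
  qed
  then have ir: "indexed_rules (nonterminals \<Gamma>) (indices \<Gamma>) (terminals \<Gamma>) ?P ?I"
    using \<Gamma>(1) by (auto simp: indexed_rules_def is_indexed_grammar_def)
  have "w \<in> lists (terminals \<Gamma>)" if "yields (rules ?P ?I) [Inl (start \<Gamma>, [])] w" for w
    using that
  proof (rule yields_terminals)
    fix v \<beta> assume "\<beta> \<in> rules ?P ?I v"
    then show "Inr -` set \<beta> \<subseteq> terminals \<Gamma>" by (rule rules_terminals[OF ir])
  qed (simp add: vimage_def)
  then have "L = {w. yields (rules ?P ?I) [Inl (start \<Gamma>, [])] w}"
    using \<Gamma> derives_iff_yields[of \<Gamma> "[NT (start \<Gamma>) []]"]
    by (auto simp: generated_language_def grammar_rules_def)
  then show ?thesis
    using that[OF ir, of "start \<Gamma>"] \<Gamma>(1) unfolding is_indexed_grammar_def by blast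
qed


lemma IND_I:
  fixes N :: "'n set" and F :: "'f set" and T :: "'t set"
  assumes ir: "indexed_rules N F T P I" and "S\<^sub>0 \<subseteq> N"
  shows "{w. \<exists>s\<in>S\<^sub>0. yields (rules P I) [Inl (s, [])] w} \<in> IND"
proof -
  have fin: "finite N" "finite F" "finite T" "finite P"
    and P: "P \<subseteq> N \<times> lists (N \<times> lists F <+> T)"
    and I: "\<And>f. f \<in> F \<Longrightarrow> finite (I f) \<and> I f \<subseteq> N \<times> lists (N <+> T)"
    and I0: "\<And>f. f \<notin> F \<Longrightarrow> I f = {}"
    using ir by (auto simp: indexed_rules_def)
  have I': "I f \<subseteq> N \<times> lists (N <+> T)" for f using I I0 by (cases "f \<in> F") auto
  obtain enc0 :: "'n \<Rightarrow> nat" where enc0: "inj_on enc0 N"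
    using finite_imp_inj_to_nat_seg[OF fin(1)] by blast
  \<comment> \<open>The successor keeps \<open>0\<close> free for a new start symbol, whose
    productions choose among the symbols of \<open>S\<^sub>0\<close>.\<close>
  define enc where "enc = Suc \<circ> enc0"
  have enc: "enc x = enc y \<longleftrightarrow> x = y" if "x \<in> N" "y \<in> N" for x y
    using enc0 that by (auto simp: enc_def inj_on_def)
  have enc_nz: "enc x \<noteq> 0" for x by (simp add: enc_def)
  \<comment> \<open>A flag becomes the literal set of its encoded productions. Flags with equal
    productions are merged, which is harmless: \<open>rel\<close> always compares an encoded string
    with a given preimage, so no inverse of \<open>\<phi>\<close> is ever taken.\<close>
  define \<phi> where "\<phi> f = map_prod enc (map (map_sum enc id)) ` I f" for f
  define sym :: "'n \<times> 'f list + 't \<Rightarrow> (nat, 't, (nat, 't) index) isym"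
    where "sym = case_sum (\<lambda>(X, \<eta>). NT (enc X) (map \<phi> \<eta>)) Tm"
  define \<Gamma> where "\<Gamma> = \<lparr>nonterminals = insert 0 (enc ` N), terminals = T, indices = \<phi> ` F, start = 0,
    productions = (\<lambda>s. (0, [NT (enc s) []])) ` S\<^sub>0 \<union> map_prod enc (map sym) ` P\<rparr>"
  let ?E = "map_sum (\<lambda>(X, \<eta>). (enc X, map \<phi> \<eta>)) id"
  have sym: "sum_of_isym (sym s) = ?E s" for s
    by (auto simp: sym_def split: sum.split prod.split)
  have sym_in: "sym s \<in> isyms \<Gamma>" if "s \<in> N \<times> lists F <+> T" for s
    using that by (auto simp: sym_def isyms_def \<Gamma>_def)
  have \<Gamma>: "is_indexed_grammar \<Gamma>"
  proof -
    have "productions \<Gamma> \<subseteq> nonterminals \<Gamma> \<times> lists (isyms \<Gamma>)"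
    proof -
      have "map_prod enc (map sym) ` P \<subseteq> nonterminals \<Gamma> \<times> lists (isyms \<Gamma>)"
      proof
        fix p assume "p \<in> map_prod enc (map sym) ` P"
        then obtain B \<beta> where "p = (enc B, map sym \<beta>)" "B \<in> N" "\<beta> \<in> lists (N \<times> lists F <+> T)"
          using P by auto
        then show "p \<in> nonterminals \<Gamma> \<times> lists (isyms \<Gamma>)"
          using sym_in by (auto simp: in_lists_conv_set \<Gamma>_def)
      qed
      moreover have "(\<lambda>s. (0, [NT (enc s) []])) ` S\<^sub>0 \<subseteq> nonterminals \<Gamma> \<times> lists (isyms \<Gamma>)"
        using assms(2) by (auto simp: \<Gamma>_def isyms_def)
      ultimately show ?thesis by (simp add: \<Gamma>_def)
    qed
    moreover have "finite (\<phi> f) \<and> \<phi> f \<subseteq> nonterminals \<Gamma> \<times> lists (nonterminals \<Gamma> <+> T)"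
      if "f \<in> F" for f
    proof -
      have "p \<in> nonterminals \<Gamma> \<times> lists (nonterminals \<Gamma> <+> T)" if p: "p \<in> \<phi> f" for p
      proof -
        obtain B \<beta> where p: "(B, \<beta>) \<in> I f" "p = (enc B, map (map_sum enc id) \<beta>)"
          using p by (auto simp: \<phi>_def)
        then have "B \<in> N" "\<beta> \<in> lists (N <+> T)" using I'[of f] by blast+
        moreover have "map_sum enc id s \<in> nonterminals \<Gamma> <+> T" if "s \<in> N <+> T" for s
          using that by (auto simp: \<Gamma>_def)
        ultimately show ?thesis using p(2) by (auto simp: in_lists_conv_set \<Gamma>_def)
      qed
      then show ?thesis using I[OF that] by (auto simp: \<phi>_def)
    qed
    ultimately show ?thesis
      using fin finite_subset[OF assms(2)] by (simp add: is_indexed_grammar_def \<Gamma>_def)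
  qed
  let ?P = "map_prod id (map sum_of_isym) ` productions \<Gamma>"
  let ?I = "\<lambda>f. if f \<in> indices \<Gamma> then f else {}"
  have P_eq: "?P = (\<lambda>s. (0, [Inl (enc s, [])])) ` S\<^sub>0 \<union> map_prod enc (map ?E) ` P"
    by (simp add: \<Gamma>_def image_Un image_image map_prod_def split_def sym comp_def)
  \<comment> \<open>Outside \<open>F\<close> the set \<open>\<phi> f\<close> is empty, and then both
    sides are empty whether or not the empty set is itself an index of the grammar.\<close>
  have I_eq: "?I (\<phi> f) = \<phi> f" for f
    using I0[of f] by (cases "f \<in> F") (auto simp: \<Gamma>_def \<phi>_def)
  define rel where "rel v v' \<longleftrightarrow> fst v \<in> N \<and> v' = (enc (fst v), map \<phi> (snd v))"
    for v :: "'n \<times> 'f list" and v'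
  have rel_prod: "list_all2 (rel_sum rel (=)) (map (map_sum (\<lambda>(X, \<eta>). (X, \<eta> @ \<delta>)) id) \<beta>)
      (map (map_sum (\<lambda>(X, \<eta>). (X, \<eta> @ map \<phi> \<delta>)) id) (map ?E \<beta>))"
    if "(B, \<beta>) \<in> P" for B \<beta> \<delta>
  proof -
    have "\<beta> \<in> lists (N \<times> lists F <+> T)" using P that by auto
    then show ?thesis
      by (auto simp: list_all2_map1 list_all2_map2 in_lists_conv_set rel_def intro!: list_all2_same[THEN iffD2])
  qed
  have rel_index: "list_all2 (rel_sum rel (=)) (map (map_sum (\<lambda>X. (X, \<delta>)) id) \<beta>)
      (map (map_sum (\<lambda>X. (X, map \<phi> \<delta>)) id) (map (map_sum enc id) \<beta>))"
    if "(B, \<beta>) \<in> I f" for B \<beta> f \<delta>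
  proof -
    have "\<beta> \<in> lists (N <+> T)" using I'[of f] that by auto
    then show ?thesis
      by (auto simp: list_all2_map1 list_all2_map2 in_lists_conv_set rel_def intro!: list_all2_same[THEN iffD2])
  qed
  have to_enc: "\<exists>\<beta>'\<in>grammar_rules \<Gamma> v'. list_all2 (rel_sum rel (=)) \<beta> \<beta>'"
    if vv': "rel v v'" and \<beta>: "\<beta> \<in> rules P I v" for v v' \<beta>
  proof -
    obtain B \<delta> where v: "v = (B, \<delta>)" "B \<in> N" "v' = (enc B, map \<phi> \<delta>)"
      using vv' by (cases v) (auto simp: rel_def)
    have "\<beta> \<in> rules P I (B, \<delta>)" using \<beta> v by simp
    then show ?thesis
    proof (cases rule: rules_cases)
      case (prod \<alpha>)
      then have "(enc B, map ?E \<alpha>) \<in> ?P" unfolding P_eq by force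
      from rules_prod[OF this] prod rel_prod show ?thesis
        unfolding v grammar_rules_def by blast
    next
      case (index f \<delta>' \<alpha>)
      then have "(enc B, map (map_sum enc id) \<alpha>) \<in> ?I (\<phi> f)"
        unfolding I_eq by (force simp: \<phi>_def)
      note r = rules_index[of _ _ ?I, OF this, of "map \<phi> \<delta>'" ?P]
      have "v' = (enc B, \<phi> f # map \<phi> \<delta>')" using v index by simp
      with rel_index[OF index(2), of \<delta>'] r show ?thesis
        unfolding index(3) grammar_rules_def by (simp only:) (rule bexI)
    qed
  qed
  have from_enc: "\<exists>\<beta>\<in>rules P I v. list_all2 (rel_sum (\<lambda>x y. rel y x) (=)) \<beta>' \<beta>"
    if vv': "rel v v'" and \<beta>': "\<beta>' \<in> grammar_rules \<Gamma> v'" for v v' \<beta>'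
  proof -
    have flip: "list_all2 (rel_sum (\<lambda>x y. rel y x) (=)) \<beta>' \<beta>"
      if "list_all2 (rel_sum rel (=)) \<beta> \<beta>'" for \<beta> \<beta>'
      using that by (auto simp: list_all2_conv_all_nth rel_sum.simps)
    obtain B \<delta> where v: "v = (B, \<delta>)" "B \<in> N" "v' = (enc B, map \<phi> \<delta>)"
      using vv' by (cases v) (auto simp: rel_def)
    have "\<beta>' \<in> rules ?P ?I (enc B, map \<phi> \<delta>)" using \<beta>' v by (simp add: grammar_rules_def)
    then show ?thesis
    proof (cases rule: rules_cases)
      case (prod \<alpha>')
      from prod(1) have "(enc B, \<alpha>') \<in> map_prod enc (map ?E) ` P"
        unfolding P_eq by (elim UnE) (simp_all add: image_iff enc_nz)
      then obtain B' \<alpha> where \<alpha>: "(B', \<alpha>) \<in> P" "enc B' = enc B" "\<alpha>' = map ?E \<alpha>"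
        by (auto simp del: map_eq_conv)
      then have "B' = B" using enc v(2) P by blast
      with \<alpha>(1) have B: "(B, \<alpha>) \<in> P" by simp
      from flip[OF rel_prod[OF B]] rules_prod[OF B] show ?thesis
        unfolding v(1) prod(2) \<alpha>(3) by (rule bexI)
    next
      case (index f' \<delta>' \<alpha>')
      then obtain f \<delta>'' where \<delta>: "\<delta> = f # \<delta>''" "f' = \<phi> f" "\<delta>' = map \<phi> \<delta>''" by auto
      then have "(enc B, \<alpha>') \<in> \<phi> f" using index(2) unfolding \<delta>(2) I_eq by simp
      then obtain B' \<alpha> where \<alpha>: "(B', \<alpha>) \<in> I f" "enc B' = enc B" "\<alpha>' = map (map_sum enc id) \<alpha>"
        by (auto simp: \<phi>_def)
      then have "B' = B" using enc v(2) I'[of f] by blast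
      with \<alpha>(1) have B: "(B, \<alpha>) \<in> I f" by simp
      from flip[OF rel_index[OF B]] rules_index[of _ _ I, OF B] show ?thesis
        unfolding v(1) index(3) \<alpha>(3) \<delta> by (rule bexI)
    qed
  qed
  have start_iff: "yields (rules P I) [Inl (s, [])] w \<longleftrightarrow> yields (grammar_rules \<Gamma>) [Inl (enc s, [])] w"
    if "s \<in> N" for s w
  proof
    assume "yields (rules P I) [Inl (s, [])] w"
    then show "yields (grammar_rules \<Gamma>) [Inl (enc s, [])] w"
      by (rule yields_sim[OF _ _ to_enc]) (simp_all add: rel_def that)
  next
    assume "yields (grammar_rules \<Gamma>) [Inl (enc s, [])] w"
    then show "yields (rules P I) [Inl (s, [])] w"
      by (rule yields_sim[OF _ _ from_enc]) (simp_all add: rel_def that)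
  qed
  have "grammar_rules \<Gamma> (0, []) = {[Inl (enc s, [])] | s. s \<in> S\<^sub>0}"
  proof
    show "grammar_rules \<Gamma> (0, []) \<subseteq> {[Inl (enc s, [])] | s. s \<in> S\<^sub>0}"
      unfolding grammar_rules_def P_eq by (auto simp: rules_def enc_nz[symmetric])
    have "[Inl (enc s, [])] \<in> grammar_rules \<Gamma> (0, [])" if "s \<in> S\<^sub>0" for s
      using rules_prod[of 0 "[Inl (enc s, [])]" ?P "[]" ?I] that unfolding P_eq grammar_rules_def
      by simp
    then show "{[Inl (enc s, [])] | s. s \<in> S\<^sub>0} \<subseteq> grammar_rules \<Gamma> (0, [])" by blast
  qed
  then have "yields (grammar_rules \<Gamma>) [Inl (0, [])] w \<longleftrightarrow>
      (\<exists>s\<in>S\<^sub>0. yields (grammar_rules \<Gamma>) [Inl (enc s, [])] w)" for w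
    by (subst yields_single) auto
  then have "yields (grammar_rules \<Gamma>) [Inl (0, [])] w \<longleftrightarrow>
      (\<exists>s\<in>S\<^sub>0. yields (rules P I) [Inl (s, [])] w)" for w
    using start_iff assms(2) by blast
  moreover have "w \<in> lists T" if "yields (rules P I) [Inl (s, [])] w" for s w
    using yields_terminals[OF that, of T] rules_terminals[OF ir] by (auto simp: vimage_def)
  ultimately have "generated_language \<Gamma> = {w. \<exists>s\<in>S\<^sub>0. yields (rules P I) [Inl (s, [])] w}"
    using derives_iff_yields[of \<Gamma> "[NT 0 []]"] by (auto simp: generated_language_def) (auto simp: \<Gamma>_def)
  then show ?thesis using \<Gamma> by (auto simp: IND_def)
qed

section \<open>Closure under finite-state transductions\<close>

text \<open>The hypothesis describes all rules of \<open>S'\<close> at \<open>r x\<close>, so the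
  graph of \<open>r\<close> is a simulation in both directions, even where \<open>r\<close> merges
  nonterminals.\<close>

lemma yields_rename:
  assumes "\<And>x. S' (r x) = map (map_sum r id) ` S x"
  shows "yields S' (map (map_sum r id) \<alpha>) w \<longleftrightarrow> yields S \<alpha> w"
proof
  have rel: "list_all2 (rel_sum (\<lambda>x y. y = r x) (=)) \<alpha> (map (map_sum r id) \<alpha>)" for \<alpha> :: "('a + 'c) list"
    by (simp add: list.rel_map sum.rel_map list.rel_refl sum.rel_refl)
  assume "yields S \<alpha> w"
  from this rel show "yields S' (map (map_sum r id) \<alpha>) w"
    by (rule yields_sim) (use assms rel in blast)
next
  have rel: "list_all2 (rel_sum (\<lambda>x y. x = r y) (=)) (map (map_sum r id) \<alpha>) \<alpha>" for \<alpha> :: "('a + 'c) list"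
    by (simp add: list.rel_map sum.rel_map list.rel_refl sum.rel_refl)
  assume "yields S' (map (map_sum r id) \<alpha>) w"
  from this rel show "yields S \<alpha> w"
    by (rule yields_sim) (clarsimp simp only: assms image_iff, use rel in blast)
qed

primrec run :: "('q \<Rightarrow> 'a \<Rightarrow> ('b list \<times> 'q) set) \<Rightarrow> 'q \<Rightarrow> 'a list \<Rightarrow> ('b list \<times> 'q) set" where
  "run \<delta> p [] = {([], p)}"
| "run \<delta> p (a # w) = {(u @ v, r) | u q v r. (u, q) \<in> \<delta> p a \<and> (v, r) \<in> run \<delta> q w}"

lemma run_append:
  "run \<delta> p (w @ w') = {(u @ v, r) | u q v r. (u, q) \<in> run \<delta> p w \<and> (v, r) \<in> run \<delta> q w'}"
proof (induction w arbitrary: p)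
  case (Cons a w)
  have "x \<in> run \<delta> p ((a # w) @ w') \<longleftrightarrow> (\<exists>u1 u2 u3 q q' r. x = (u1 @ u2 @ u3, r) \<and>
      (u1, q) \<in> \<delta> p a \<and> (u2, q') \<in> run \<delta> q w \<and> (u3, r) \<in> run \<delta> q' w')" for x
    by (simp add: Cons) blast
  moreover have "x \<in> {(u @ v, r) | u q v r. (u, q) \<in> run \<delta> p (a # w) \<and> (v, r) \<in> run \<delta> q w'} \<longleftrightarrow>
      (\<exists>u1 u2 u3 q q' r. x = (u1 @ u2 @ u3, r) \<and>
      (u1, q) \<in> \<delta> p a \<and> (u2, q') \<in> run \<delta> q w \<and> (u3, r) \<in> run \<delta> q' w')" for x
    by simp (metis append.assoc)
  ultimately show ?case by blast
qed auto

text \<open>The annotation in the triple construction of Bar-Hillel, Perles and Shamir, adapted to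
  transducers: the state after a nonterminal is guessed, whereas a terminal is replaced by the
  output of a transition.\<close>

primrec triples :: "('q \<Rightarrow> 'a \<Rightarrow> ('b list \<times> 'q) set) \<Rightarrow> 'q set \<Rightarrow> 'q \<Rightarrow> ('v + 'a) list \<Rightarrow>
    ((('q \<times> 'v \<times> 'q) + 'b) list \<times> 'q) set" where
  "triples \<delta> Q p [] = {([], p)}"
| "triples \<delta> Q p (s # \<alpha>) = (case s of
      Inl v \<Rightarrow> {(Inl (p, v, q) # \<gamma>, r) | q \<gamma> r. q \<in> Q \<and> (\<gamma>, r) \<in> triples \<delta> Q q \<alpha>}
    | Inr a \<Rightarrow> {(map Inr u @ \<gamma>, r) | u q \<gamma> r. (u, q) \<in> \<delta> p a \<and> (\<gamma>, r) \<in> triples \<delta> Q q \<alpha>})"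

text \<open>The annotation does not look inside nonterminals, so it commutes with attaching index
  strings to them. Hence states need to be guessed only on the finitely many productions, not on
  their infinitely many instances.\<close>

lemma triples_map:
  "triples \<delta> Q p (map (map_sum f id) \<alpha>) =
    {(map (map_sum (\<lambda>(p, v, q). (p, f v, q)) id) \<gamma>, r) | \<gamma> r. (\<gamma>, r) \<in> triples \<delta> Q p \<alpha>}"
proof (induction \<alpha> arbitrary: p)
  case (Cons s \<alpha>)
  let ?m = "map (map_sum (\<lambda>(p, v, q). (p, f v, q)) id)"
  show ?case
  proof (cases s)
    case (Inl v)
    have "triples \<delta> Q p (map (map_sum f id) (s # \<alpha>)) =
        {(Inl (p, f v, q) # ?m \<gamma>, r) | q \<gamma> r. q \<in> Q \<and> (\<gamma>, r) \<in> triples \<delta> Q q \<alpha>}"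
      by (simp only: Inl list.map map_sum.simps triples.simps sum.case Cons) blast
    also have "\<dots> = {(?m \<gamma>, r) | \<gamma> r. (\<gamma>, r) \<in> triples \<delta> Q p (s # \<alpha>)}"
      by (force simp: Inl)
    finally show ?thesis .
  next
    case (Inr a)
    have "map_sum f id (Inr a) = Inr a" by simp
    then have "triples \<delta> Q p (map (map_sum f id) (s # \<alpha>)) =
        {(map Inr u @ ?m \<gamma>, r) | u q \<gamma> r. (u, q) \<in> \<delta> p a \<and> (\<gamma>, r) \<in> triples \<delta> Q q \<alpha>}"
      by (simp only: Inr list.map triples.simps sum.case Cons) blast
    also have "\<dots> = {(?m (map Inr u @ \<gamma>), r) | u q \<gamma> r. (u, q) \<in> \<delta> p a \<and> (\<gamma>, r) \<in> triples \<delta> Q q \<alpha>}"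
      by (simp add: comp_def)
    also have "\<dots> = {(?m \<gamma>, r) | \<gamma> r. (\<gamma>, r) \<in> triples \<delta> Q p (s # \<alpha>)}"
      unfolding Inr triples.simps sum.case by blast
    finally show ?thesis .
  qed
qed simp

section \<open>The triple construction\<close>

locale transducer =
  fixes \<delta> :: "'q \<Rightarrow> 'a \<Rightarrow> ('b list \<times> 'q) set" and Q :: "'q set"
  assumes finite_Q: "finite Q"
    and finite_step: "p \<in> Q \<Longrightarrow> finite (\<delta> p a)"
    and step_closed: "\<lbrakk>p \<in> Q; (u, q) \<in> \<delta> p a\<rbrakk> \<Longrightarrow> q \<in> Q"
begin

lemma run_closed: "\<lbrakk>(u, q) \<in> run \<delta> p w; p \<in> Q\<rbrakk> \<Longrightarrow> q \<in> Q"
  by (induction w arbitrary: p u) (auto dest: step_closed)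

lemma triples_closed: "\<lbrakk>(\<gamma>, q) \<in> triples \<delta> Q p \<alpha>; p \<in> Q\<rbrakk> \<Longrightarrow> q \<in> Q"
  by (induction \<alpha> arbitrary: p \<gamma>) (auto split: sum.splits dest: step_closed)

lemma finite_triples: "p \<in> Q \<Longrightarrow> finite (triples \<delta> Q p \<alpha>)"
proof (induction \<alpha> arbitrary: p)
  case (Cons s \<alpha>)
  show ?case
  proof (cases s)
    case (Inl v)
    have "triples \<delta> Q p (s # \<alpha>) = (\<Union>q\<in>Q. (\<lambda>(\<gamma>, r). (Inl (p, v, q) # \<gamma>, r)) ` triples \<delta> Q q \<alpha>)"
      by (auto simp: Inl)
    then show ?thesis using Cons finite_Q by simp
  next
    case (Inr a)
    have "triples \<delta> Q p (s # \<alpha>) =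
        (\<Union>(u, q)\<in>\<delta> p a. (\<lambda>(\<gamma>, r). (map Inr u @ \<gamma>, r)) ` triples \<delta> Q q \<alpha>)"
      by (auto simp: Inr)
    then show ?thesis using Cons finite_step step_closed by auto
  qed
qed simp

definition triple_rules :: "('v \<Rightarrow> ('v + 'a) list set) \<Rightarrow> 'q \<times> 'v \<times> 'q \<Rightarrow> (('q \<times> 'v \<times> 'q) + 'b) list set"
  where "triple_rules S = (\<lambda>(p, v, q). {\<gamma>. p \<in> Q \<and> (\<exists>\<beta>\<in>S v. (\<gamma>, q) \<in> triples \<delta> Q p \<beta>)})"

text \<open>The run on the derived word is cut at the boundaries of the subtrees of its derivation;
  the states at the cuts are the right guesses.\<close>

lemma triple_rules_complete:
  assumes "yields S \<alpha> w" "(u, q) \<in> run \<delta> p w" "p \<in> Q"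
  shows "\<exists>\<gamma>. (\<gamma>, q) \<in> triples \<delta> Q p \<alpha> \<and> yields (triple_rules S) \<gamma> u"
  using assms
proof (induction arbitrary: u p q)
  case (Term \<alpha> w a)
  then obtain u1 r u2 where u: "u = u1 @ u2" "(u1, r) \<in> \<delta> p a" "(u2, q) \<in> run \<delta> r w" by auto
  then obtain \<gamma> where "(\<gamma>, q) \<in> triples \<delta> Q r \<alpha>" "yields (triple_rules S) \<gamma> u2"
    using Term step_closed by blast
  moreover from this(1) have "(map Inr u1 @ \<gamma>, q) \<in> triples \<delta> Q p (Inr a # \<alpha>)"
    using u by (simp only: triples.simps sum.case) blast
  moreover have "yields (triple_rules S) (map Inr u1 @ \<gamma>) u"
    using u(1) calculation(2) by (simp add: yields_append)
  ultimately show ?case by blast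
next
  case (Rule \<beta> v w1 \<alpha> w2)
  then obtain u1 r u2 where u: "u = u1 @ u2" "(u1, r) \<in> run \<delta> p w1" "(u2, q) \<in> run \<delta> r w2"
    by (auto simp: run_append)
  then have r: "r \<in> Q" using run_closed Rule by blast
  obtain \<gamma>1 \<gamma>2 where \<gamma>: "(\<gamma>1, r) \<in> triples \<delta> Q p \<beta>" "yields (triple_rules S) \<gamma>1 u1"
    "(\<gamma>2, q) \<in> triples \<delta> Q r \<alpha>" "yields (triple_rules S) \<gamma>2 u2"
    using Rule.IH(1)[OF u(2) Rule.prems(2)] Rule.IH(2)[OF u(3) r] by blast
  then have "\<gamma>1 \<in> triple_rules S (p, v, r)" using Rule by (auto simp: triple_rules_def)
  then have "yields (triple_rules S) (Inl (p, v, r) # \<gamma>2) u"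
    using \<gamma> u by (auto intro: yields.Rule)
  then show ?case using \<gamma> r by (intro exI[of _ "Inl (p, v, r) # \<gamma>2"]) auto
qed simp

text \<open>An application of \<open>yields_least\<close>: outputs of the parts of an annotated
  right-hand side come from runs that fit together at the guessed states.\<close>

lemma triple_rules_sound:
  assumes "yields (triple_rules S) [Inl (p, v, q)] u"
  shows "\<exists>w. yields S [Inl v] w \<and> (u, q) \<in> run \<delta> p w"
proof -
  define M where "M = (\<lambda>(p, v, q). {u. \<exists>w. yields S [Inl v] w \<and> (u, q) \<in> run \<delta> p w})"
  have trip: "\<exists>w. yields S \<alpha> w \<and> (u, q) \<in> run \<delta> p w"
    if "(\<gamma>, q) \<in> triples \<delta> Q p \<alpha>" "u \<in> expand M \<gamma>" for \<gamma> q p \<alpha> u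
    using that
  proof (induction \<alpha> arbitrary: p \<gamma> u)
    case (Cons s \<alpha>)
    show ?case
    proof (cases s)
      case (Inl v)
      then obtain r \<gamma>' where \<gamma>: "\<gamma> = Inl (p, v, r) # \<gamma>'" "(\<gamma>', q) \<in> triples \<delta> Q r \<alpha>"
        using Cons by auto
      then obtain u1 u2 w1 where u: "u = u1 @ u2" "yields S [Inl v] w1" "(u1, r) \<in> run \<delta> p w1"
        "u2 \<in> expand M \<gamma>'"
        using Cons by (auto simp: M_def)
      then obtain w2 where "yields S \<alpha> w2" "(u2, q) \<in> run \<delta> r w2" using Cons \<gamma> by blast
      then have "yields S ([s] @ \<alpha>) (w1 @ w2)" "(u, q) \<in> run \<delta> p (w1 @ w2)"
        using u Inl unfolding yields_append run_append by blast+
      then show ?thesis by auto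
    next
      case (Inr a)
      then obtain u1 r \<gamma>' where \<gamma>: "\<gamma> = map Inr u1 @ \<gamma>'" "(u1, r) \<in> \<delta> p a"
        "(\<gamma>', q) \<in> triples \<delta> Q r \<alpha>"
        using Cons by auto
      then obtain u2 where u: "u = u1 @ u2" "u2 \<in> expand M \<gamma>'"
        using Cons by (auto simp: expand_append)
      then obtain w where w: "yields S \<alpha> w" "(u2, q) \<in> run \<delta> r w" using Cons \<gamma> by blast
      then have "(u, q) \<in> run \<delta> p (a # w)" using \<gamma> u by auto
      moreover have "yields S (s # \<alpha>) (a # w)" using w Inr by simp
      ultimately show ?thesis by blast
    qed
  qed simp
  have "expand M \<gamma> \<subseteq> M x" if "\<gamma> \<in> triple_rules S x" for \<gamma> x
    using that trip by (fastforce simp: triple_rules_def M_def yields_single)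
  then have "u \<in> expand M [Inl (p, v, q)]" by (intro yields_least[OF assms])
  then show ?thesis by (simp add: M_def)
qed

theorem IND_transduce:
  assumes "L \<in> (IND :: 'a list set set)" "q\<^sub>0 \<in> Q" "E \<subseteq> Q"
  shows "{u. \<exists>w\<in>L. \<exists>q\<in>E. (u, q) \<in> run \<delta> q\<^sub>0 w} \<in> IND"
proof -
  obtain N :: "nat set" and F :: "(nat, 'a) index set" and T P I s
    where ir: "indexed_rules N F T P I" and s: "s \<in> N"
      and L: "L = {w. yields (rules P I) [Inl (s, [])] w}"
    using IND_E[OF assms(1)] by blast
  \<comment> \<open>The index string belongs to the grammar and not to the transducer. Moving it out
    of the triple leaves a finite set of nonterminals and the old set of flags.\<close>
  let ?r = "\<lambda>(p, (X, \<eta>), q). ((p, X, q), \<eta>)"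
  define P' where "P' = {((p, B, q), map (map_sum ?r id) \<gamma>) | p B q \<gamma>.
    p \<in> Q \<and> (\<exists>\<beta>. (B, \<beta>) \<in> P \<and> (\<gamma>, q) \<in> triples \<delta> Q p \<beta>)}"
  define I' where "I' f = {((p, B, q), \<gamma>) | p B q \<gamma>.
    p \<in> Q \<and> (\<exists>\<beta>. (B, \<beta>) \<in> I f \<and> (\<gamma>, q) \<in> triples \<delta> Q p \<beta>)}" for f
  \<comment> \<open>The type of output letters may be infinite; only letters written while reading
    terminals of the grammar are collected.\<close>
  define T' where "T' = (\<Union>p\<in>Q. \<Union>a\<in>T. \<Union>(u, q)\<in>\<delta> p a. set u)"
  have fin: "finite N" "finite F" "finite T" "finite P"
    and P: "P \<subseteq> N \<times> lists (N \<times> lists F <+> T)"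
    and I: "\<And>f. f \<in> F \<Longrightarrow> finite (I f) \<and> I f \<subseteq> N \<times> lists (N <+> T)"
    and I0: "\<And>f. f \<notin> F \<Longrightarrow> I f = {}"
    using ir by (auto simp: indexed_rules_def)
  have trip: "set \<gamma> \<subseteq> (Q \<times> V \<times> Q) <+> T'"
    if "(\<gamma>, q) \<in> triples \<delta> Q p \<beta>" "p \<in> Q" "\<beta> \<in> lists (V <+> T)" for \<gamma> p q V and \<beta> :: "('v + 'a) list"
    using that
  proof (induction \<beta> arbitrary: \<gamma> p)
    case (Cons x \<beta>)
    show ?case
    proof (cases x)
      case (Inl v)
      then obtain r \<gamma>' where *: "\<gamma> = Inl (p, v, r) # \<gamma>'" "r \<in> Q" "(\<gamma>', q) \<in> triples \<delta> Q r \<beta>"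
        using Cons.prems by auto
      then have "set \<gamma>' \<subseteq> Q \<times> V \<times> Q <+> T'" using Cons by auto
      then show ?thesis using * Cons.prems Inl by auto
    next
      case (Inr a)
      then obtain u r \<gamma>' where *: "\<gamma> = map Inr u @ \<gamma>'" "(u, r) \<in> \<delta> p a" "(\<gamma>', q) \<in> triples \<delta> Q r \<beta>"
        using Cons.prems by auto
      have "a \<in> T" "r \<in> Q" using Cons.prems Inr * step_closed by auto
      then have "set \<gamma>' \<subseteq> Q \<times> V \<times> Q <+> T'" using Cons * by auto
      moreover have "set u \<subseteq> T'" using * Cons.prems \<open>a \<in> T\<close> unfolding T'_def by blast
      ultimately show ?thesis using * by auto
    qed
  qed simp
  have ir': "indexed_rules (Q \<times> N \<times> Q) F T' P' I'"
    unfolding indexed_rules_def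
  proof (intro conjI ballI allI impI)
    show "finite (Q \<times> N \<times> Q)" "finite F" using fin finite_Q by auto
    show "finite T'" using fin finite_Q finite_step by (auto simp: T'_def)
    show "finite P'"
    proof (rule finite_subset)
      show "P' \<subseteq> (\<lambda>((p, B, \<beta>), \<gamma>, q). ((p, B, q), map (map_sum ?r id) \<gamma>)) `
          (SIGMA (p, B, \<beta>) : Q \<times> P. triples \<delta> Q p \<beta>)"
        unfolding P'_def by force
    qed (use fin finite_Q finite_triples in \<open>auto intro!: finite_imageI finite_SigmaI\<close>)
    show "P' \<subseteq> (Q \<times> N \<times> Q) \<times> lists ((Q \<times> N \<times> Q) \<times> lists F <+> T')"
    proof
      fix x assume "x \<in> P'"
      then obtain B \<beta> p \<gamma> q where x: "(B, \<beta>) \<in> P" "p \<in> Q" "(\<gamma>, q) \<in> triples \<delta> Q p \<beta>"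
        "x = ((p, B, q), map (map_sum ?r id) \<gamma>)"
        unfolding P'_def by blast
      then have "B \<in> N" "\<beta> \<in> lists (N \<times> lists F <+> T)" using P by blast+
      moreover from trip[OF x(3,2) this(2)] have "map (map_sum ?r id) \<gamma> \<in> lists ((Q \<times> N \<times> Q) \<times> lists F <+> T')"
        by (auto simp: in_lists_conv_set)
      ultimately show "x \<in> (Q \<times> N \<times> Q) \<times> lists ((Q \<times> N \<times> Q) \<times> lists F <+> T')"
        using x triples_closed by blast
    qed
    fix f
    show "finite (I' f)" if "f \<in> F"
    proof (rule finite_subset)
      show "I' f \<subseteq> (\<lambda>((p, B, \<beta>), \<gamma>, q). ((p, B, q), \<gamma>)) `
          (SIGMA (p, B, \<beta>) : Q \<times> I f. triples \<delta> Q p \<beta>)"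
        unfolding I'_def by force
    qed (use I[OF that] finite_Q finite_triples in \<open>auto intro!: finite_imageI finite_SigmaI\<close>)
    show "I' f = {}" if "f \<notin> F" using I0[OF that] by (simp add: I'_def)
    show "I' f \<subseteq> (Q \<times> N \<times> Q) \<times> lists ((Q \<times> N \<times> Q) <+> T')" if "f \<in> F"
    proof
      fix x assume "x \<in> I' f"
      then obtain B \<beta> p \<gamma> q where x: "(B, \<beta>) \<in> I f" "p \<in> Q" "(\<gamma>, q) \<in> triples \<delta> Q p \<beta>"
        "x = ((p, B, q), \<gamma>)"
        unfolding I'_def by blast
      then have B: "B \<in> N" "\<beta> \<in> lists (N <+> T)" using I[OF that] by blast+
      from trip[OF x(3,2) this(2)] have "\<gamma> \<in> lists ((Q \<times> N \<times> Q) <+> T')"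
        by (auto simp: in_lists_conv_set)
      then show "x \<in> (Q \<times> N \<times> Q) \<times> lists ((Q \<times> N \<times> Q) <+> T')"
        using x B triples_closed by blast
    qed
  qed
  \<comment> \<open>Attaching an index string and annotating with states commute by
    \<open>triples_map\<close>. The map \<open>h\<^sub>1\<close> does this for productions, which
    extend strings by \<open>\<eta>\<close>, and \<open>h\<^sub>2\<close> for index productions,
    which hand down the rest of the string.\<close>
  have r: "rules P' I' (?r x) = map (map_sum ?r id) ` triple_rules (rules P I) x" for x
  proof -
    obtain p B \<eta> q where x: "x = (p, (B, \<eta>), q)" by (metis prod.exhaust)
    have map_P: "map (map_sum ?r id) (map (map_sum (\<lambda>(p, v, q). (p, case v of (X, \<theta>) \<Rightarrow> (X, \<theta> @ \<eta>), q)) id) \<gamma>) =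
        map (map_sum (\<lambda>(X, \<theta>). (X, \<theta> @ \<eta>)) id) (map (map_sum ?r id) \<gamma>)"
      for \<gamma> :: "(('q \<times> (nat \<times> (nat, 'a) index list) \<times> 'q) + 'b) list"
      by (auto simp: sum.map_comp comp_def split_def)
    have map_I: "map (map_sum ?r id) (map (map_sum (\<lambda>(p, v, q). (p, (v, \<eta>'), q)) id) \<gamma>) =
        map (map_sum (\<lambda>X. (X, \<eta>')) id) \<gamma>"
      for \<gamma> :: "(('q \<times> nat \<times> 'q) + 'b) list" and \<eta>' :: "(nat, 'a) index list"
      by (auto simp: sum.map_comp comp_def split_def id_def)
    define h\<^sub>1 where "h\<^sub>1 = (\<lambda>(p :: 'q, v, q :: 'q). (p, case v of (X :: nat, \<theta>) \<Rightarrow> (X, \<theta> @ \<eta>), q))"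
    define h\<^sub>2 where "h\<^sub>2 \<eta>' = (\<lambda>(p :: 'q, v :: nat, q :: 'q). (p, (v, \<eta>'), q))"
      for \<eta>' :: "(nat, 'a) index list"
    have trip_P: "(\<gamma>, q) \<in> triples \<delta> Q p (map (map_sum (\<lambda>(X, \<theta>). (X, \<theta> @ \<eta>)) id) \<beta>) \<longleftrightarrow>
        (\<exists>\<gamma>'. \<gamma> = map (map_sum h\<^sub>1 id) \<gamma>' \<and> (\<gamma>', q) \<in> triples \<delta> Q p \<beta>)" for \<gamma> \<beta>
      unfolding triples_map h\<^sub>1_def by simp
    have trip_I: "(\<gamma>, q) \<in> triples \<delta> Q p (map (map_sum (\<lambda>X. (X, \<eta>')) id) \<beta>) \<longleftrightarrow>
        (\<exists>\<gamma>'. \<gamma> = map (map_sum (h\<^sub>2 \<eta>') id) \<gamma>' \<and> (\<gamma>', q) \<in> triples \<delta> Q p \<beta>)" for \<gamma> \<beta> \<eta>'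
      unfolding triples_map h\<^sub>2_def by simp
    have tr: "\<gamma> \<in> triple_rules (rules P I) x \<longleftrightarrow> p \<in> Q \<and>
        (\<exists>\<beta>\<in>rules P I (B, \<eta>). (\<gamma>, q) \<in> triples \<delta> Q p \<beta>)" for \<gamma>
      by (simp add: triple_rules_def x)
    have P'_iff: "((p, B, q), \<beta>) \<in> P' \<longleftrightarrow> p \<in> Q \<and>
        (\<exists>\<alpha> \<gamma>. (B, \<alpha>) \<in> P \<and> (\<gamma>, q) \<in> triples \<delta> Q p \<alpha> \<and> \<beta> = map (map_sum ?r id) \<gamma>)" for \<beta>
      unfolding P'_def by blast
    have I'_iff: "((p, B, q), \<beta>) \<in> I' f \<longleftrightarrow> p \<in> Q \<and>
        (\<exists>\<alpha>. (B, \<alpha>) \<in> I f \<and> (\<beta>, q) \<in> triples \<delta> Q p \<alpha>)" for \<beta> f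
      unfolding I'_def by blast
    show ?thesis
    proof (rule equalityI; rule subsetI)
      fix \<gamma> assume "\<gamma> \<in> rules P' I' (?r x)"
      then have "\<gamma> \<in> rules P' I' ((p, B, q), \<eta>)" by (simp add: x)
      then show "\<gamma> \<in> map (map_sum ?r id) ` triple_rules (rules P I) x"
      proof (cases rule: rules_cases)
        case (prod \<beta>)
        then obtain \<alpha> \<gamma>' where *: "p \<in> Q" "(B, \<alpha>) \<in> P" "(\<gamma>', q) \<in> triples \<delta> Q p \<alpha>"
          "\<beta> = map (map_sum ?r id) \<gamma>'"
          unfolding P'_iff by blast
        then have "map (map_sum h\<^sub>1 id) \<gamma>' \<in> triple_rules (rules P I) x"
          unfolding tr using rules_prod[OF *(2)] trip_P by blast
        then show ?thesis unfolding prod(2) *(4) map_P[symmetric] h\<^sub>1_def by (rule imageI)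
      next
        case (index f \<eta>' \<beta>)
        then obtain \<alpha> where *: "p \<in> Q" "(B, \<alpha>) \<in> I f" "(\<beta>, q) \<in> triples \<delta> Q p \<alpha>"
          unfolding I'_iff by blast
        then have "map (map_sum (h\<^sub>2 \<eta>') id) \<beta> \<in> triple_rules (rules P I) x"
          unfolding tr index(1) using rules_index[of B \<alpha> I f, OF *(2)] trip_I by blast
        then show ?thesis unfolding index(3) map_I[symmetric] h\<^sub>2_def by (rule imageI)
      qed
    next
      fix \<gamma> assume "\<gamma> \<in> map (map_sum ?r id) ` triple_rules (rules P I) x"
      then obtain \<alpha> \<gamma>' where \<gamma>: "\<gamma> = map (map_sum ?r id) \<gamma>'" "p \<in> Q"
        "\<alpha> \<in> rules P I (B, \<eta>)" "(\<gamma>', q) \<in> triples \<delta> Q p \<alpha>"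
        by (auto simp: tr)
      from \<gamma>(3) have "\<gamma> \<in> rules P' I' ((p, B, q), \<eta>)"
      proof (cases rule: rules_cases)
        case (prod \<beta>)
        obtain \<gamma>'' where *: "\<gamma>' = map (map_sum h\<^sub>1 id) \<gamma>''" "(\<gamma>'', q) \<in> triples \<delta> Q p \<beta>"
          using \<gamma>(4) unfolding prod(2) trip_P by blast
        then have "((p, B, q), map (map_sum ?r id) \<gamma>'') \<in> P'" unfolding P'_iff using \<gamma>(2) prod(1) by blast
        from rules_prod[OF this, of \<eta> I'] show ?thesis
          unfolding \<gamma>(1) *(1) h\<^sub>1_def map_P .
      next
        case (index f \<eta>' \<beta>)
        obtain \<gamma>'' where *: "\<gamma>' = map (map_sum (h\<^sub>2 \<eta>') id) \<gamma>''" "(\<gamma>'', q) \<in> triples \<delta> Q p \<beta>"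
          using \<gamma>(4) unfolding index(3) trip_I by blast
        then have "((p, B, q), \<gamma>'') \<in> I' f" unfolding I'_iff using \<gamma>(2) index(2) by blast
        from rules_index[of _ _ I' f, OF this, of \<eta>' P'] show ?thesis
          unfolding \<gamma>(1) *(1) h\<^sub>2_def map_I index(1) .
      qed
      then show "\<gamma> \<in> rules P' I' (?r x)" by (simp add: x)
    qed
  qed
  let ?S\<^sub>0 = "(\<lambda>q. (q\<^sub>0, s, q)) ` E"
  have "(\<exists>x\<in>?S\<^sub>0. yields (rules P' I') [Inl (x, [])] u) \<longleftrightarrow> (\<exists>w\<in>L. \<exists>q\<in>E. (u, q) \<in> run \<delta> q\<^sub>0 w)" for u
  proof -
    have "yields (rules P' I') [Inl ((q\<^sub>0, s, q), [])] u \<longleftrightarrow> (\<exists>w\<in>L. (u, q) \<in> run \<delta> q\<^sub>0 w)"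
      if "q \<in> E" for q
    proof -
      have "yields (rules P' I') [Inl ((q\<^sub>0, s, q), [])] u \<longleftrightarrow>
          yields (triple_rules (rules P I)) [Inl (q\<^sub>0, (s, []), q)] u"
        using yields_rename[where r = ?r and S' = "rules P' I'" and S = "triple_rules (rules P I)", OF r, of "[Inl (q\<^sub>0, (s, []), q)]" u] by simp
      also have "\<dots> \<longleftrightarrow> (\<exists>w\<in>L. (u, q) \<in> run \<delta> q\<^sub>0 w)"
        using triple_rules_sound[of "rules P I" q\<^sub>0 "(s, [])" q u]
          triple_rules_complete[of "rules P I" "[Inl (s, [])]" _ u q q\<^sub>0] assms(2)
        by (auto simp: L)
      finally show ?thesis .
    qed
    then show ?thesis by auto
  qed
  moreover have "{u. \<exists>x\<in>?S\<^sub>0. yields (rules P' I') [Inl (x, [])] u} \<in> IND"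
    using assms s by (intro IND_I[OF ir']) auto
  ultimately show ?thesis by simp
qed

end

section \<open>Closure under context-free nesting\<close>

lemma singleton_IND: "{u} \<in> (IND :: 't list set set)"
proof -
  have "indexed_rules {()} ({} :: unit set) (set u) {((), map Inr u)} (\<lambda>_. {})"
    by (auto simp: indexed_rules_def in_lists_conv_set)
  from IND_I[OF this, of "{()}"]
  have "{w. yields (rules {((), map Inr u)} (\<lambda>_ :: unit. {})) [Inl ((), [])] w} \<in> IND" by simp
  moreover have "rules {((), map Inr u)} (\<lambda>_ :: unit. {}) ((), []) = {map Inr u}"
    by (simp add: rules_def comp_def)
  ultimately show ?thesis by (simp add: yields_single)
qed

text \<open>Each \<open>j\<close> stands for a rule of an outer context-free grammar with left-hand
  side \<open>lhs j\<close>, whose right-hand sides form an indexed language. The outer nonterminals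
  of type \<open>'x\<close> are terminals for these inner grammars.\<close>

locale nested =
  fixes J :: "'j set" and lhs :: "'j \<Rightarrow> 'x :: finite"
    and N :: "'j \<Rightarrow> nat set" and F :: "'j \<Rightarrow> 'f set" and T :: "'j \<Rightarrow> ('x + 't) set"
    and P :: "'j \<Rightarrow> (nat \<times> (nat \<times> 'f list + ('x + 't)) list) set"
    and I :: "'j \<Rightarrow> 'f \<Rightarrow> (nat \<times> (nat + ('x + 't)) list) set"
    and s :: "'j \<Rightarrow> nat"
  assumes finite_J: "finite J"
    and indexed: "j \<in> J \<Longrightarrow> indexed_rules (N j) (F j) (T j) (P j) (I j)"
    and start: "j \<in> J \<Longrightarrow> s j \<in> N j"
begin

definition lang :: "'j \<Rightarrow> ('x + 't) list set"
  where "lang j = {w. yields (rules (P j) (I j)) [Inl (s j, [])] w}"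

definition flat :: "'x \<Rightarrow> ('x + 't) list set"
  where "flat x = {\<alpha>. \<exists>j\<in>J. lhs j = x \<and> \<alpha> \<in> lang j}"

fun embed :: "('v \<Rightarrow> 'w) \<Rightarrow> 'v + ('x + 't) \<Rightarrow> ('x + 'w) + 't" where
  "embed f (Inl v) = Inl (Inr (f v))"
| "embed f (Inr (Inl x)) = Inl (Inl x)"
| "embed f (Inr (Inr t)) = Inr t"

lemma Inr_eq_embed: "Inr a = embed f y \<longleftrightarrow> y = Inr (Inr a)"
  by (cases "(f, y)" rule: embed.cases) auto

text \<open>An intermediate system in which outer and inner steps alternate, and each call of an
  inner grammar starts with an empty index string of its own. It separates the nesting of
  derivations from the problem of inherited index strings.\<close>

fun mid :: "'x + 'j \<times> nat \<times> 'f list \<Rightarrow> (('x + 'j \<times> nat \<times> 'f list) + 't) list set" where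
  "mid (Inl x) = {[Inl (Inr (j, s j, []))] | j. j \<in> J \<and> lhs j = x}"
| "mid (Inr (j, v)) = map (embed (Pair j)) ` rules (P j) (I j) v"

text \<open>The derivation is split by freezing the outer nonterminals: the steps within grammar
  \<open>j\<close> derive \<open>\<beta>\<close> from \<open>\<gamma>\<close>, and all others belong
  to the expansion of \<open>\<beta>\<close>.\<close>

lemma mid_sound:
  "yields mid \<alpha> w \<Longrightarrow> j \<in> J \<Longrightarrow> \<alpha> = map (embed (Pair j)) \<gamma> \<Longrightarrow>
    \<exists>\<beta>. yields (rules (P j) (I j)) \<gamma> \<beta> \<and> yields flat \<beta> w"
proof (induction arbitrary: j \<gamma> rule: yields.induct)
  case (Term \<alpha> w a)
  then obtain \<gamma>' where "\<gamma> = Inr (Inr a) # \<gamma>'" "\<alpha> = map (embed (Pair j)) \<gamma>'"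
    using Term.prems by (auto simp: Cons_eq_map_conv Inr_eq_embed)
  then show ?case using Term.IH[of j \<gamma>'] Term.prems by fastforce
next
  case (Rule \<beta> v u \<alpha> w)
  obtain y \<gamma>' where \<gamma>: "\<gamma> = y # \<gamma>'" "Inl v = embed (Pair j) y" "\<alpha> = map (embed (Pair j)) \<gamma>'"
    using Rule.prems by (auto simp: Cons_eq_map_conv)
  then obtain \<beta>2 where \<beta>2: "yields (rules (P j) (I j)) \<gamma>' \<beta>2" "yields flat \<beta>2 w"
    using Rule by blast
  show ?case
  proof (cases y)
    case (Inl n)
    then have "v = Inr (j, n)" using \<gamma> by simp
    with Rule.hyps obtain \<beta>0 where \<beta>0: "\<beta>0 \<in> rules (P j) (I j) n" "\<beta> = map (embed (Pair j)) \<beta>0"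
      by auto
    then obtain \<beta>1 where "yields (rules (P j) (I j)) \<beta>0 \<beta>1" "yields flat \<beta>1 u"
      using Rule by blast
    then show ?thesis using \<beta>0 \<beta>2 \<gamma> Inl
      by (intro exI[of _ "\<beta>1 @ \<beta>2"]) (auto simp: yields_append intro: yields.Rule)
  next
    case (Inr y')
    then obtain x where x: "y' = Inl x" "v = Inl x" using \<gamma> by (cases y') auto
    with Rule.hyps obtain i where i: "i \<in> J" "lhs i = x" "\<beta> = map (embed (Pair i)) [Inl (s i, [])]"
      by auto
    then obtain \<beta>1 where "yields (rules (P i) (I i)) [Inl (s i, [])] \<beta>1" "yields flat \<beta>1 u"
      using Rule by blast
    then have "yields flat (Inl x # \<beta>2) (u @ w)"
      using i \<beta>2 by (intro yields.Rule) (auto simp: flat_def lang_def)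
    then show ?thesis using \<beta>2 \<gamma> Inr x by (intro exI[of _ "Inl x # \<beta>2"]) auto
  qed
qed simp

text \<open>The inner derivation is replayed, with each outer nonterminal among its leaves expanded
  on the spot.\<close>

lemma mid_subst:
  "yields (rules (P j) (I j)) \<gamma> \<beta> \<Longrightarrow> yields mid (map (map_sum Inl id) \<beta>) u \<Longrightarrow>
    yields mid (map (embed (Pair j)) \<gamma>) u"
proof (induction arbitrary: u rule: yields.induct)
  case (Term \<alpha> w a)
  then show ?case by (cases a) (auto simp: yields_Inl simp del: mid.simps)
next
  case (Rule \<beta> v u1 \<alpha> w)
  then obtain w1 w2 where "u = w1 @ w2" "yields mid (map (embed (Pair j)) \<beta>) w1"
    "yields mid (map (embed (Pair j)) \<alpha>) w2"
    by (auto simp: yields_append)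
  moreover have "map (embed (Pair j)) \<beta> \<in> mid (Inr (j, v))" using Rule.hyps by simp
  ultimately show ?case by (auto intro: yields.Rule simp del: mid.simps)
qed simp

lemma mid_complete: "yields flat \<alpha> w \<Longrightarrow> yields mid (map (map_sum Inl id) \<alpha>) w"
proof (induction rule: yields.induct)
  case (Rule \<beta> x u \<alpha> w)
  then obtain j where j: "j \<in> J" "lhs j = x" "yields (rules (P j) (I j)) [Inl (s j, [])] \<beta>"
    by (auto simp: flat_def lang_def)
  from mid_subst[OF this(3) Rule.IH(1)] have "yields mid [Inl (Inr (j, s j, []))] u" by simp
  then have "yields mid (Inl (Inl x) # map (map_sum Inl id) \<alpha>) (u @ w)"
    by (rule yields.Rule[rotated, OF _ Rule.IH(2)]) (use j in auto)
  then show ?case by (simp only: list.map map_sum.simps)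
qed auto

section \<open>The finite grammar for nested derivations\<close>

definition Ns :: "('x + 'j \<times> nat) set" where "Ns = range Inl \<union> Inr ` Sigma J N"
definition Fs :: "('j \<times> 'f) option set" where "Fs = insert None (Some ` Sigma J F)"
definition Ts :: "'t set" where "Ts = (\<Union>j\<in>J. Inr -` T j)"

abbreviation flag :: "'j \<Rightarrow> nat \<times> 'f list \<Rightarrow> ('x + 'j \<times> nat) \<times> ('j \<times> 'f) option list"
  where "flag j \<equiv> \<lambda>(X, \<eta>). (Inr (j, X), map (\<lambda>f. Some (j, f)) \<eta>)"

fun embed_flag :: "'j \<Rightarrow> nat \<times> 'f list + ('x + 't) \<Rightarrow> ('x + 'j \<times> nat) \<times> ('j \<times> 'f) option list + 't" where
  "embed_flag j (Inl v) = Inl (flag j v)"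
| "embed_flag j (Inr (Inl x)) = Inl (Inl x, [])"
| "embed_flag j (Inr (Inr t)) = Inr t"

fun embed_index :: "'j \<Rightarrow> nat + ('x + 't) \<Rightarrow> ('x + 'j \<times> nat) + 't" where
  "embed_index j (Inl X) = Inl (Inr (j, X))"
| "embed_index j (Inr (Inl x)) = Inl (Inl x)"
| "embed_index j (Inr (Inr t)) = Inr t"

text \<open>
  The index \<open>None\<close> has no productions. It is pushed below the indices of an embedded grammar and
  screens them from those inherited from the occurrence of the nonterminal being expanded.
\<close>

definition Ps where "Ps = {(Inl (lhs j), [Inl (Inr (j, s j), [None])]) | j. j \<in> J} \<union>
  {(Inr (j, B), map (embed_flag j) \<beta>) | j B \<beta>. j \<in> J \<and> (B, \<beta>) \<in> P j}"

definition Is :: "('j \<times> 'f) option \<Rightarrow> (('x + 'j \<times> nat) \<times> (('x + 'j \<times> nat) + 't) list) set"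
  where "Is = case_option {} (\<lambda>(j, f).
  {(Inr (j, B), map (embed_index j) \<beta>) | B \<beta>. j \<in> J \<and> (B, \<beta>) \<in> I j f})"

lemma indexed_rules_nested: "indexed_rules Ns Fs Ts Ps Is"
proof -
  have fin: "finite (N j)" "finite (F j)" "finite (T j)" "finite (P j)"
    and P: "P j \<subseteq> N j \<times> lists (N j \<times> lists (F j) <+> T j)"
    and I: "\<And>f. f \<in> F j \<Longrightarrow> finite (I j f) \<and> I j f \<subseteq> N j \<times> lists (N j <+> T j)"
    and I0: "\<And>f. f \<notin> F j \<Longrightarrow> I j f = {}" if "j \<in> J" for j
    using indexed[OF that] by (auto simp: indexed_rules_def)
  have flag: "embed_flag j y \<in> Ns \<times> lists Fs <+> Ts" if "j \<in> J" "y \<in> N j \<times> lists (F j) <+> T j" for j y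
    using that by (cases "(j, y)" rule: embed_flag.cases) (auto simp: Ns_def Fs_def Ts_def in_lists_conv_set)
  have index: "embed_index j y \<in> Ns <+> Ts" if "j \<in> J" "y \<in> N j <+> T j" for j y
    using that by (cases "(j, y)" rule: embed_index.cases) (auto simp: Ns_def Ts_def)
  show ?thesis
    unfolding indexed_rules_def
  proof (intro conjI ballI allI impI)
    show "finite Ns" "finite Fs" "finite Ts"
      using fin finite_J by (auto simp: Ns_def Fs_def Ts_def intro: finite_vimageI)
    have "Ps = (\<lambda>j. (Inl (lhs j), [Inl (Inr (j, s j), [None])])) ` J \<union>
        (\<lambda>(j, B, \<beta>). (Inr (j, B), map (embed_flag j) \<beta>)) ` Sigma J P"
      by (force simp: Ps_def)
    then show "finite Ps" using fin finite_J by simp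
    show "Ps \<subseteq> Ns \<times> lists (Ns \<times> lists Fs <+> Ts)"
    proof
      fix x assume "x \<in> Ps"
      then consider j where "j \<in> J" "x = (Inl (lhs j), [Inl (Inr (j, s j), [None])])"
        | j B \<beta> where "j \<in> J" "(B, \<beta>) \<in> P j" "x = (Inr (j, B), map (embed_flag j) \<beta>)"
        by (auto simp: Ps_def)
      then show "x \<in> Ns \<times> lists (Ns \<times> lists Fs <+> Ts)"
      proof cases
        case 1
        then show ?thesis using start by (auto simp: Ns_def Fs_def)
      next
        case 2
        then have "B \<in> N j" "\<beta> \<in> lists (N j \<times> lists (F j) <+> T j)" using P by blast+
        then show ?thesis using 2 flag by (auto simp: Ns_def in_lists_conv_set)
      qed
    qed
    fix f
    show "finite (Is f)" if f: "f \<in> Fs"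
    proof (cases f)
      case (Some jf)
      then obtain j g where "f = Some (j, g)" "j \<in> J" "g \<in> F j" using f by (auto simp: Fs_def)
      moreover have "{(Inr (j, B), map (embed_index j) \<beta>) | B \<beta>. j \<in> J \<and> (B, \<beta>) \<in> I j g} \<subseteq>
          (\<lambda>(B, \<beta>). (Inr (j, B), map (embed_index j) \<beta>)) ` I j g" by force
      ultimately show ?thesis using I by (auto simp: Is_def intro: finite_subset)
    qed (simp add: Is_def)
    show "Is f \<subseteq> Ns \<times> lists (Ns <+> Ts)" if "f \<in> Fs"
    proof
      fix x assume "x \<in> Is f"
      then obtain j g B \<beta> where x: "f = Some (j, g)" "j \<in> J" "(B, \<beta>) \<in> I j g"
        "x = (Inr (j, B), map (embed_index j) \<beta>)"
        by (auto simp: Is_def split: option.splits)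
      then have "g \<in> F j" using that by (auto simp: Fs_def)
      then have "B \<in> N j" "\<beta> \<in> lists (N j <+> T j)" using I x by blast+
      then show "x \<in> Ns \<times> lists (Ns <+> Ts)" using x index by (auto simp: Ns_def in_lists_conv_set)
    qed
    show "Is f = {}" if "f \<notin> Fs"
      using that I0 by (auto simp: Is_def Fs_def split: option.splits)
  qed
qed

text \<open>The arbitrary tail \<open>\<delta>\<close> is what has been inherited from enclosing
  grammars. It grows with the depth of the nesting, but is never read: outer nonterminals have no
  index productions, and inner ones stop at \<open>None\<close>.\<close>

inductive screened :: "'x + 'j \<times> nat \<times> 'f list \<Rightarrow> ('x + 'j \<times> nat) \<times> ('j \<times> 'f) option list \<Rightarrow> bool" where
  "screened (Inl x) (Inl x, \<delta>)"
| "j \<in> J \<Longrightarrow> screened (Inr (j, X, \<eta>)) (Inr (j, X), map (\<lambda>f. Some (j, f)) \<eta> @ None # \<delta>)"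

lemma screened_flag:
  assumes "j \<in> J"
  shows "list_all2 (rel_sum screened (=))
    (map (embed (Pair j)) (map (map_sum (\<lambda>(X, \<theta>). (X, \<theta> @ \<eta>)) id) \<beta>))
    (map (map_sum (\<lambda>(X, \<theta>). (X, \<theta> @ map (\<lambda>f. Some (j, f)) \<eta> @ None # \<delta>)) id) (map (embed_flag j) \<beta>))"
proof -
  have "rel_sum screened (=) (embed (Pair j) (map_sum (\<lambda>(X, \<theta>). (X, \<theta> @ \<eta>)) id y))
      (map_sum (\<lambda>(X, \<theta>). (X, \<theta> @ map (\<lambda>f. Some (j, f)) \<eta> @ None # \<delta>)) id (embed_flag j y))" for y
    using screened.intros(1) screened.intros(2)[OF assms, of _ "_ @ \<eta>" \<delta>]
    by (cases "(j, y)" rule: embed_flag.cases) auto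
  then show ?thesis by (simp add: list.rel_map list.rel_refl)
qed

lemma screened_index:
  assumes "j \<in> J"
  shows "list_all2 (rel_sum screened (=))
    (map (embed (Pair j)) (map (map_sum (\<lambda>X. (X, \<eta>)) id) \<beta>))
    (map (map_sum (\<lambda>X. (X, map (\<lambda>f. Some (j, f)) \<eta> @ None # \<delta>)) id) (map (embed_index j) \<beta>))"
proof -
  have "rel_sum screened (=) (embed (Pair j) (map_sum (\<lambda>X. (X, \<eta>)) id y))
      (map_sum (\<lambda>X. (X, map (\<lambda>f. Some (j, f)) \<eta> @ None # \<delta>)) id (embed_index j y))" for y
    using screened.intros assms by (cases "(j, y)" rule: embed_index.cases) auto
  then show ?thesis by (simp add: list.rel_map list.rel_refl)
qed

lemma mid_to_rules:
  assumes "screened v v'" "\<beta> \<in> mid v"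
  shows "\<exists>\<beta>'\<in>rules Ps Is v'. list_all2 (rel_sum screened (=)) \<beta> \<beta>'"
  using assms(1)
proof cases
  case (1 x \<delta>)
  then obtain j where j: "j \<in> J" "lhs j = x" "\<beta> = [Inl (Inr (j, s j, []))]" using assms(2) by auto
  then have "(Inl x, [Inl (Inr (j, s j), [None])]) \<in> Ps" by (auto simp: Ps_def)
  from rules_prod[OF this, of \<delta> Is] have "[Inl (Inr (j, s j), None # \<delta>)] \<in> rules Ps Is v'"
    using 1 by simp
  moreover have "screened (Inr (j, s j, [])) (Inr (j, s j), None # \<delta>)"
    using screened.intros(2)[OF j(1), of "s j" "[]" \<delta>] by simp
  ultimately show ?thesis using j by (intro bexI[of _ "[Inl (Inr (j, s j), None # \<delta>)]"]) auto
next
  case (2 j X \<eta> \<delta>)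
  then obtain \<gamma> where \<gamma>: "\<gamma> \<in> rules (P j) (I j) (X, \<eta>)" "\<beta> = map (embed (Pair j)) \<gamma>"
    using assms(2) by auto
  from \<gamma>(1) show ?thesis
  proof (cases rule: rules_cases)
    case (prod \<alpha>)
    then have "(Inr (j, X), map (embed_flag j) \<alpha>) \<in> Ps" using 2 by (auto simp: Ps_def)
    from screened_flag[OF 2(3)] rules_prod[OF this] show ?thesis unfolding 2(2) \<gamma>(2) prod(2) by (rule bexI)
  next
    case (index f \<eta>' \<alpha>)
    then have "(Inr (j, X), map (embed_index j) \<alpha>) \<in> Is (Some (j, f))" using 2 by (auto simp: Is_def)
    note r = rules_index[of _ _ Is, OF this]
    have v': "v' = (Inr (j, X), Some (j, f) # map (\<lambda>f. Some (j, f)) \<eta>' @ None # \<delta>)" using 2 index by simp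
    from screened_index[OF 2(3)] r show ?thesis unfolding v' \<gamma>(2) index(3) by (rule bexI)
  qed
qed

lemma rules_to_mid:
  assumes "screened v v'" "\<beta>' \<in> rules Ps Is v'"
  shows "\<exists>\<beta>\<in>mid v. list_all2 (rel_sum screened (=)) \<beta> \<beta>'"
  using assms(1)
proof cases
  case (1 x \<delta>)
  then have "\<beta>' \<in> rules Ps Is (Inl x, \<delta>)" using assms(2) by simp
  then obtain j where j: "j \<in> J" "lhs j = x" "\<beta>' = [Inl (Inr (j, s j), None # \<delta>)]"
    by (cases rule: rules_cases) (auto simp: Ps_def Is_def split: option.splits)
  moreover have "screened (Inr (j, s j, [])) (Inr (j, s j), None # \<delta>)"
    using screened.intros(2)[OF j(1), of "s j" "[]" \<delta>] by simp
  ultimately show ?thesis using 1 by (intro bexI[of _ "[Inl (Inr (j, s j, []))]"]) auto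
next
  case (2 j X \<eta> \<delta>)
  then have "\<beta>' \<in> rules Ps Is (Inr (j, X), map (\<lambda>f. Some (j, f)) \<eta> @ None # \<delta>)" using assms(2) by simp
  then show ?thesis
  proof (cases rule: rules_cases)
    case (prod \<alpha>')
    then obtain \<alpha> where \<alpha>: "(X, \<alpha>) \<in> P j" "\<alpha>' = map (embed_flag j) \<alpha>" by (auto simp: Ps_def)
    from screened_flag[OF 2(3)] imageI[OF rules_prod[OF \<alpha>(1), of \<eta> "I j"], of "map (embed (Pair j))"]
    show ?thesis unfolding 2(1) mid.simps prod(2) \<alpha>(2) by (rule bexI)
  next
    case (index f' \<delta>' \<alpha>')
    then obtain f \<eta>' where f: "\<eta> = f # \<eta>'" "f' = Some (j, f)" "\<delta>' = map (\<lambda>f. Some (j, f)) \<eta>' @ None # \<delta>"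
      by (cases \<eta>) (auto simp: Is_def)
    then obtain \<alpha> where \<alpha>: "(X, \<alpha>) \<in> I j f" "\<alpha>' = map (embed_index j) \<alpha>"
      using index(2) by (auto simp: Is_def)
    from screened_index[OF 2(3)] imageI[OF rules_index[of _ _ "I j", OF \<alpha>(1), of \<eta>' "P j"], of "map (embed (Pair j))"]
    show ?thesis unfolding 2(1) mid.simps f(1,3) index(3) \<alpha>(2) by (rule bexI)
  qed
qed

lemma flat_IND: "{w. yields flat [Inl x] w} \<in> IND"
proof -
  have "yields (rules Ps Is) [Inl (Inl x, [])] w \<longleftrightarrow> yields flat [Inl x] w" for w
  proof
    assume "yields flat [Inl x] w"
    then have "yields mid [Inl (Inl x)] w" using mid_complete by fastforce
    then show "yields (rules Ps Is) [Inl (Inl x, [])] w"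
      by (rule yields_sim[OF _ _ mid_to_rules]) (auto intro: screened.intros)
  next
    assume "yields (rules Ps Is) [Inl (Inl x, [])] w"
    then have "yields mid [Inl (Inl x)] w"
    proof (rule yields_sim[where R = "\<lambda>a b. screened b a"])
      show "\<exists>\<beta>'\<in>mid v'. list_all2 (rel_sum (\<lambda>a b. screened b a) (=)) \<beta> \<beta>'"
        if g: "screened v' v" and \<beta>: "\<beta> \<in> rules Ps Is v" for v v' \<beta>
      proof -
        have flip: "list_all2 (rel_sum (\<lambda>a b. screened b a) (=)) \<beta> \<beta>'"
          if "list_all2 (rel_sum screened (=)) \<beta>' \<beta>" for \<beta>'
          using that by (auto simp: list_all2_conv_all_nth rel_sum.simps)
        from rules_to_mid[OF g \<beta>] flip show ?thesis by blast
      qed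
    qed (auto intro: screened.intros)
    then obtain j where "j \<in> J" "lhs j = x" "yields mid (map (embed (Pair j)) [Inl (s j, [])]) w"
      by (auto simp: yields_single simp del: mid.simps(2))
    with mid_sound[OF this(3) this(1) refl] show "yields flat [Inl x] w"
      by (auto simp: yields_single flat_def lang_def)
  qed
  then show ?thesis using IND_I[OF indexed_rules_nested, of "{Inl x}"] by (auto simp: Ns_def)
qed

end

theorem IND_nested:
  fixes R :: "('x :: finite \<times> ('x + 't) list set) set"
  assumes "finite R" "\<And>x L. (x, L) \<in> R \<Longrightarrow> L \<in> IND"
  shows "{w. yields (\<lambda>x. \<Union>{L. (x, L) \<in> R}) [Inl x] w} \<in> IND"
proof -
  have "\<forall>r\<in>R. \<exists>N :: nat set. \<exists>F :: (nat, 'x + 't) index set. \<exists>T P I s.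
      indexed_rules N F T P I \<and> s \<in> N \<and> snd r = {w. yields (rules P I) [Inl (s, [])] w}"
    using assms(2) by (metis IND_E prod.collapse)
  then obtain N :: "_ \<Rightarrow> nat set" and F :: "_ \<Rightarrow> (nat, 'x + 't) index set" and T P I s
    where r: "\<And>r. r \<in> R \<Longrightarrow> indexed_rules (N r) (F r) (T r) (P r) (I r) \<and> s r \<in> N r \<and>
      snd r = {w. yields (rules (P r) (I r)) [Inl (s r, [])] w}"
    by metis
  interpret nested R fst N F T P I s
    using assms(1) r by unfold_locales auto
  have "lang r = snd r" if "r \<in> R" for r using r[OF that] by (simp add: lang_def)
  then have "flat = (\<lambda>x. \<Union>{L. (x, L) \<in> R})"
    by (intro ext) (force simp: flat_def)
  then show ?thesis using flat_IND[of x] by simp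
qed

section \<open>Normal forms in free products\<close>

text \<open>Both factors live in one type and are told apart by a tag, so that each argument about
  syllables is given once. Products are constrained only for syllables of the same tag.\<close>

locale tagged_groups =
  fixes L :: "'l set" and tag :: "'l \<Rightarrow> bool" and mul :: "'l \<Rightarrow> 'l \<Rightarrow> 'l"
    and one :: "bool \<Rightarrow> 'l" and ginv :: "'l \<Rightarrow> 'l"
  assumes mul_closed: "\<lbrakk>x \<in> L; y \<in> L; tag x = tag y\<rbrakk> \<Longrightarrow> mul x y \<in> L"
    and tag_mul: "\<lbrakk>x \<in> L; y \<in> L; tag x = tag y\<rbrakk> \<Longrightarrow> tag (mul x y) = tag y"
    and one_closed: "one t \<in> L"
    and tag_one: "tag (one t) = t"
    and inv_closed: "x \<in> L \<Longrightarrow> ginv x \<in> L"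
    and tag_inv: "x \<in> L \<Longrightarrow> tag (ginv x) = tag x"
    and mul_assoc: "\<lbrakk>x \<in> L; y \<in> L; z \<in> L; tag x = tag z; tag y = tag z\<rbrakk> \<Longrightarrow>
      mul (mul x y) z = mul x (mul y z)"
    and mul_one_left: "\<lbrakk>x \<in> L; tag x = t\<rbrakk> \<Longrightarrow> mul (one t) x = x"
    and mul_one_right: "\<lbrakk>x \<in> L; tag x = t\<rbrakk> \<Longrightarrow> mul x (one t) = x"
    and mul_inv_left: "x \<in> L \<Longrightarrow> mul (ginv x) x = one (tag x)"
    and mul_inv_right: "x \<in> L \<Longrightarrow> mul x (ginv x) = one (tag x)"
begin

lemma inv_unique:
  assumes "x \<in> L" "y \<in> L" "tag x = tag y" "mul x y = one (tag y)"
  shows "y = ginv x"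
proof -
  have "mul (mul (ginv x) x) y = mul (ginv x) (one (tag y))"
    using assms by (simp add: mul_assoc inv_closed tag_inv)
  then show ?thesis
    using assms by (simp add: mul_inv_left mul_one_left mul_one_right inv_closed tag_inv)
qed

lemma inv_eq_one:
  assumes "x \<in> L" "ginv x = one t"
  shows "x = one t"
proof -
  have "t = tag x" using assms tag_inv[of x] tag_one[of t] by simp
  then show ?thesis using mul_inv_left[OF assms(1)] assms mul_one_left[of x t] by simp
qed

text \<open>The tag of the first syllable is kept as an argument so that a grammar rule can ensure
  that the syllable it puts in front alternates with the rest.\<close>

fun red :: "bool \<Rightarrow> 'l list \<Rightarrow> bool" where
  "red t [] \<longleftrightarrow> True"
| "red t (x # s) \<longleftrightarrow> x \<in> L \<and> tag x = t \<and> x \<noteq> one t \<and> red (\<not> t) s"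

definition reduced :: "'l list \<Rightarrow> bool" where "reduced s \<longleftrightarrow> (\<exists>t. red t s)"

lemma red_reduced: "red t s \<Longrightarrow> reduced s"
  by (auto simp: reduced_def)

lemma red_closed: "red t s \<Longrightarrow> set s \<subseteq> L"
  by (induction t s rule: red.induct) auto

lemma reduced_closed: "reduced s \<Longrightarrow> set s \<subseteq> L"
  using red_closed by (auto simp: reduced_def)

lemma red_append: "red t (s @ s') \<longleftrightarrow> red t s \<and> red (if even (length s) then t else \<not> t) s'"
  by (induction t s rule: red.induct) auto

lemma reduced_appendD: "reduced (s @ s') \<Longrightarrow> reduced s \<and> reduced s'"
  by (auto simp: reduced_def red_append)

text \<open>Left multiplication of a reduced word by a syllable, as in van der Waerden's proof of
  the normal form theorem: words act on the reduced words, and one shows that the action respects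
  the defining relations.\<close>

fun push :: "'l \<Rightarrow> 'l list \<Rightarrow> 'l list" where
  "push x [] = (if x = one (tag x) then [] else [x])"
| "push x (y # s) =
    (if x = one (tag x) then y # s
     else if tag x \<noteq> tag y then x # y # s
     else if mul x y = one (tag x) then s else mul x y # s)"

lemma push_one: "push (one t) s = s"
  by (cases s) (auto simp: tag_one)

lemma push_red: "red (\<not> tag x) s \<Longrightarrow> push x s = (if x = one (tag x) then s else x # s)"
  by (cases s) auto

lemma reduced_push: "x \<in> L \<Longrightarrow> reduced s \<Longrightarrow> reduced (push x s)"
proof (cases s)
  case (Cons y s')
  assume x: "x \<in> L" and s: "reduced s"
  then obtain y: "y \<in> L" "y \<noteq> one (tag y)" "red (\<not> tag y) s'" using Cons by (auto simp: reduced_def)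
  show ?thesis
  proof (cases "tag x = tag y")
    case True
    then have "red (tag y) (mul x y # s')" if "mul x y \<noteq> one (tag y)"
      using that x y by (auto simp: mul_closed tag_mul)
    then show ?thesis using True s y Cons red_reduced[of "tag y" "mul x y # s'"] by (auto intro: red_reduced)
  next
    case False
    then have "red (tag x) (x # s)" if "x \<noteq> one (tag x)" using that x y Cons by auto
    then show ?thesis using False s Cons red_reduced[of "tag x" "x # s"] by (auto intro: red_reduced)
  qed
qed (auto intro: red_reduced[of "tag x"])

text \<open>The only case with content is a word whose first syllable \<open>z\<close> has the same
  tag as \<open>x\<close> and \<open>y\<close>. Then all three are multiplied in one group, and
  associativity shows that both sides meet the identity in the same situations.\<close>

lemma push_push:
  assumes "x \<in> L" "y \<in> L" "tag x = tag y" "reduced s"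
  shows "push x (push y s) = push (mul x y) s"
proof (cases "y = one (tag y) \<or> red (\<not> tag y) s")
  case True
  then show ?thesis
  proof
    assume "y = one (tag y)"
    then show ?thesis using assms by (metis mul_one_right push_one)
  next
    assume "red (\<not> tag y) s"
    then show ?thesis
      using assms mul_one_left[of y "tag x"] mul_one_right[of x "tag y"] push_one[of "tag y"]
      by (cases "y = one (tag y)") (auto simp: push_red tag_mul)
  qed
next
  case False
  obtain t where t: "red t s" using assms(4) by (auto simp: reduced_def)
  with False have "t = tag y" by (cases t; cases "tag y") auto
  with t have "red (tag y) s" by simp
  with False obtain z s' where s: "s = z # s'" "z \<in> L" "tag z = tag y" "z \<noteq> one (tag y)" "red (\<not> tag y) s'"
    by (cases s) auto
  have a: "mul (mul x y) z = mul x (mul y z)" using assms s by (simp add: mul_assoc)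
  have xy: "mul x y \<in> L" "tag (mul x y) = tag y" using assms by (simp_all add: mul_closed tag_mul)
  show ?thesis
  \<comment> \<open>If \<open>y\<close> cancels \<open>z\<close>, then \<open>x\<close> meets the
    word \<open>s'\<close>, which does not begin with its tag, so nothing merges on the left; on the
    right, \<open>mul (mul x y) z\<close> is \<open>x\<close> again.\<close>
  proof (cases "mul y z = one (tag y)")
    case True
    then have "mul (mul x y) z = x" using a assms by (simp add: mul_one_right)
    moreover have "x = z" if "mul x y = one (tag y)"
      using that calculation s by (simp add: mul_one_left)
    ultimately show ?thesis
      using assms s False True xy by (auto simp: push_red)
  next
    case yz: False
    have "tag (mul y z) = tag y" using assms s by (simp add: tag_mul)
    moreover have "mul x (mul y z) = z" if "mul x y = one (tag y)"
      using that a s by (simp add: mul_one_left)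
    moreover have "mul x y = y" "mul x (mul y z) = mul y z" if "x = one (tag y)"
      using that assms s by (simp_all add: mul_one_left mul_closed tag_mul)
    ultimately show ?thesis
      using assms s False yz xy a by auto
  qed
qed

section \<open>Words acting on reduced words\<close>

abbreviation act :: "'l list \<Rightarrow> 'l list \<Rightarrow> 'l list" where "act \<equiv> foldr push"

definition nf :: "'l list \<Rightarrow> 'l list" where "nf u = act u []"

lemma nf_append: "nf (u @ v) = act u (nf v)"
  by (simp add: nf_def)

lemma reduced_act: "set u \<subseteq> L \<Longrightarrow> reduced s \<Longrightarrow> reduced (act u s)"
  by (induction u) (auto intro: reduced_push)

lemma reduced_nf: "set u \<subseteq> L \<Longrightarrow> reduced (nf u)"
  by (simp add: nf_def reduced_act red_reduced[of True])

lemma act_red: "red t (u @ s) \<Longrightarrow> act u s = u @ s"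
proof (induction u arbitrary: t)
  case (Cons x u)
  then have "act u s = u @ s" by auto
  then show ?case using Cons.prems by (auto simp: push_red)
qed simp

lemma nf_red: "red t s \<Longrightarrow> nf s = s"
  using act_red[of t s "[]"] by (simp add: nf_def)

lemma nf_reduced: "reduced s \<Longrightarrow> nf s = s"
  using nf_red by (auto simp: reduced_def)

definition sinv :: "'l list \<Rightarrow> 'l list" where "sinv s = rev (map ginv s)"

lemma sinv_simps [simp]: "sinv [] = []" "sinv (x # s) = sinv s @ [ginv x]"
  "sinv (s @ s') = sinv s' @ sinv s" "length (sinv s) = length s"
  by (simp_all add: sinv_def)

text \<open>The inverse of a nonempty \<open>s\<close> begins with the tag of the last syllable of
  \<open>s\<close>. This is \<open>t\<close> for odd length and \<open>\<not> t\<close> for even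
  length, hence the truth value of \<open>t = odd (length s)\<close>.\<close>

lemma red_sinv: "red t s \<Longrightarrow> red (t = odd (length s)) (sinv s)"
proof (induction t s rule: red.induct)
  case (2 t x s)
  then have "ginv x \<in> L" "tag (ginv x) = t" "ginv x \<noteq> one t"
    using inv_eq_one by (auto simp: inv_closed tag_inv)
  then show ?case using 2 by (auto simp: red_append)
qed simp

lemma act_sinv: "set s \<subseteq> L \<Longrightarrow> reduced z \<Longrightarrow> act s (act (sinv s) z) = z"
proof (induction s arbitrary: z)
  case (Cons x s)
  then have "reduced (push (ginv x) z)" by (simp add: reduced_push inv_closed)
  then have "act (x # s) (act (sinv (x # s)) z) = push x (push (ginv x) z)"
    using Cons by simp
  also have "\<dots> = z"
    using Cons.prems by (simp add: push_push inv_closed tag_inv mul_inv_right push_one)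
  finally show ?case .
qed simp

text \<open>The end of \<open>u\<close> is compared with the beginning of \<open>v\<close> for as
  long as the two syllables have product the identity. By \<open>inv_unique\<close> such syllables
  are inverse to each other, so what is removed from \<open>v\<close> is exactly
  \<open>sinv s\<close>.\<close>

lemma cancellation:
  assumes "reduced u" "reduced v"
  obtains p s q where "u = p @ s" "v = sinv s @ q"
    "p = [] \<or> q = [] \<or> tag (last p) \<noteq> tag (hd q) \<or> mul (last p) (hd q) \<noteq> one (tag (hd q))"
proof -
  have "\<exists>p s q. u = p @ s \<and> v = sinv s @ q \<and>
    (p = [] \<or> q = [] \<or> tag (last p) \<noteq> tag (hd q) \<or> mul (last p) (hd q) \<noteq> one (tag (hd q)))"
    using assms
  proof (induction u arbitrary: v rule: rev_induct)
    case Nil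
    then show ?case by (intro exI[of _ "[]"] exI[of _ v]) auto
  next
    case (snoc a u)
    show ?case
    proof (cases "v = [] \<or> tag a \<noteq> tag (hd v) \<or> mul a (hd v) \<noteq> one (tag (hd v))")
      case True
      then show ?thesis by (intro exI[of _ "u @ [a]"] exI[of _ "[]"] exI[of _ v]) auto
    next
      case False
      then obtain b v' where v: "v = b # v'" "tag a = tag b" "mul a b = one (tag b)"
        by (cases v) auto
      have "a \<in> L" "b \<in> L" using snoc.prems v reduced_closed by fastforce+
      then have "b = ginv a" using v by (simp add: inv_unique)
      moreover have "reduced u" "reduced v'"
        using snoc.prems v reduced_appendD[of u "[a]"] reduced_appendD[of "[b]" v'] by auto
      then obtain p s q where "u = p @ s" "v' = sinv s @ q"
        "p = [] \<or> q = [] \<or> tag (last p) \<noteq> tag (hd q) \<or> mul (last p) (hd q) \<noteq> one (tag (hd q))"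
        using snoc.IH by blast
      ultimately show ?thesis using v(1)
        by (intro exI[of _ p] exI[of _ "s @ [a]"] exI[of _ q]) auto
    qed
  qed
  then show ?thesis using that by blast
qed

lemma nf_cancel:
  assumes "reduced (p @ s)" "reduced q"
  shows "nf ((p @ s) @ sinv s @ q) = act p q"
  using assms reduced_closed reduced_appendD[of p s]
  by (simp add: nf_append act_sinv nf_reduced)

end

section \<open>The normal form theorem for free products\<close>

fun fp_mul :: "('a, 'c) monoid_scheme \<Rightarrow> ('b, 'd) monoid_scheme \<Rightarrow> 'a + 'b \<Rightarrow> 'a + 'b \<Rightarrow> 'a + 'b" where
  "fp_mul G H (Inl x) (Inl y) = Inl (x \<otimes>\<^bsub>G\<^esub> y)"
| "fp_mul G H (Inr x) (Inr y) = Inr (x \<otimes>\<^bsub>H\<^esub> y)"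
| "fp_mul G H x y = x"

fun fp_one :: "('a, 'c) monoid_scheme \<Rightarrow> ('b, 'd) monoid_scheme \<Rightarrow> bool \<Rightarrow> 'a + 'b" where
  "fp_one G H True = Inl \<one>\<^bsub>G\<^esub>"
| "fp_one G H False = Inr \<one>\<^bsub>H\<^esub>"

locale group_pair = G: group G + H: group H
  for G :: "('a, 'c) monoid_scheme" and H :: "('b, 'd) monoid_scheme"
begin

sublocale tagged_groups "carrier G <+> carrier H" isl "fp_mul G H" "fp_one G H"
  "map_sum (\<lambda>x. inv\<^bsub>G\<^esub> x) (\<lambda>y. inv\<^bsub>H\<^esub> y)"
proof
  fix t show "fp_one G H t \<in> carrier G <+> carrier H" "isl (fp_one G H t) = t"
    by (cases t; simp)+
qed (auto simp: G.m_assoc H.m_assoc elim!: PlusE)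

text \<open>The common suffix contributes a reduced word, on which both sides of the defining
  relation act alike; the common prefix then acts on equal words.\<close>

lemma nf_step: "fp_step G H u v \<Longrightarrow> nf u = nf v"
proof (induction rule: fp_step.induct)
  case (mult1 u v x y)
  then have "reduced (nf v)" by (intro reduced_nf) auto
  then show ?case using mult1 push_push[of "Inl x" "Inl y" "nf v"] by (simp add: nf_append) (simp add: nf_def)
next
  case (mult2 u v x y)
  then have "reduced (nf v)" by (intro reduced_nf) auto
  then show ?case using mult2 push_push[of "Inr x" "Inr y" "nf v"] by (simp add: nf_append) (simp add: nf_def)
next
  case (one1 u v)
  then show ?case using push_one[of True] by (simp add: nf_append) (simp add: nf_def)
next
  case (one2 u v)
  then show ?case using push_one[of False] by (simp add: nf_append) (simp add: nf_def)
qed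

lemma fp_rel_trans: "(u, v) \<in> fp_rel G H \<Longrightarrow> (v, w) \<in> fp_rel G H \<Longrightarrow> (u, w) \<in> fp_rel G H"
  using equiv_fp_rel[of G H] by (meson equivE transD)

lemma fp_rel_sym: "(u, v) \<in> fp_rel G H \<Longrightarrow> (v, u) \<in> fp_rel G H"
  using equiv_fp_rel[of G H] by (meson equivE symD)

lemma fp_rel_refl: "u \<in> fp_words G H \<Longrightarrow> (u, u) \<in> fp_rel G H"
  by (simp add: fp_rel_def)

lemma fp_rel_mul:
  assumes "x \<in> carrier G <+> carrier H" "y \<in> carrier G <+> carrier H" "isl x = isl y" "v \<in> fp_words G H"
  shows "(x # y # v, fp_mul G H x y # v) \<in> fp_rel G H"
  using assms fp_step.mult1[of "[]" G H v "projl x" "projl y"] fp_step.mult2[of "[]" G H v "projr x" "projr y"]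
  by (cases x; cases y) (auto intro!: fp_rel_stepI)

lemma fp_rel_one: "v \<in> fp_words G H \<Longrightarrow> (fp_one G H t # v, v) \<in> fp_rel G H"
  using fp_step.one1[of "[]" G H v] fp_step.one2[of "[]" G H v] by (cases t) (auto intro!: fp_rel_stepI)

text \<open>Each case of \<open>push\<close> is an instance of a defining relation, of two of them
  when the product is the identity, or leaves the word unchanged. Hence a word is congruent to its
  normal form.\<close>

lemma fp_rel_push:
  assumes "x \<in> carrier G <+> carrier H" "s \<in> fp_words G H"
  shows "(x # s, push x s) \<in> fp_rel G H"
proof (cases s)
  case Nil
  then show ?thesis using assms fp_rel_one[of "[]" "isl x"] by (auto intro: fp_rel_refl)
next
  case (Cons y s')
  have s': "y \<in> carrier G <+> carrier H" "s' \<in> fp_words G H" using assms Cons by auto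
  have "(x # s, s') \<in> fp_rel G H" if "isl x = isl y" "fp_mul G H x y = fp_one G H (isl x)"
    using fp_rel_trans[OF fp_rel_mul[OF assms(1) s'(1) that(1) s'(2)]] fp_rel_one[OF s'(2)] that Cons by simp
  then show ?thesis
    using assms s' Cons fp_rel_one[OF assms(2), of "isl x"] fp_rel_mul[OF assms(1) s'(1) _ s'(2)]
      fp_rel_refl[of "x # s"]
    by auto
qed

lemma fp_rel_nf: "u \<in> fp_words G H \<Longrightarrow> (u, nf u) \<in> fp_rel G H"
proof (induction u)
  case Nil
  then show ?case by (simp add: nf_def fp_rel_refl)
next
  case (Cons x u)
  then have "([x], [x]) \<in> fp_rel G H" "(u, nf u) \<in> fp_rel G H" by (auto intro: fp_rel_refl)
  then have "(x # u, x # nf u) \<in> fp_rel G H" using fp_rel_append by fastforce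
  moreover have "nf u \<in> fp_words G H" using Cons by (auto simp: fp_rel_def)
  then have "(x # nf u, nf (x # u)) \<in> fp_rel G H"
    using fp_rel_push[of x "nf u"] Cons by (simp add: nf_def)
  ultimately show ?case by (rule fp_rel_trans)
qed

lemma fp_rel_iff:
  assumes "u \<in> fp_words G H" "v \<in> fp_words G H"
  shows "(u, v) \<in> fp_rel G H \<longleftrightarrow> nf u = nf v"
proof
  assume "(u, v) \<in> fp_rel G H"
  then have "equivclp (fp_step G H) u v" by (simp add: fp_rel_def)
  then show "nf u = nf v"
    by (induction rule: equivclp_induct) (use nf_step in force)+
next
  assume "nf u = nf v"
  then show "(u, v) \<in> fp_rel G H"
    using fp_rel_nf[OF assms(1)] fp_rel_sym[OF fp_rel_nf[OF assms(2)]] fp_rel_trans by simp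
qed

end

section \<open>The grammar of the multiplication table\<close>

text \<open>\<open>Can\<close> derives cancelling syllables around the first separator and
  \<open>Pal\<close> mirrored syllables around the second. \<open>Mul\<close> derives those words of
  the table in which the left factor and the product begin in the same factor group, where an empty
  word fits either. The argument is the tag of the first syllable.\<close>

datatype nonterm = Start | Can bool | Pal bool | Mul bool

instance nonterm :: finite
proof
  have "x \<in> insert Start (range Can \<union> range Pal \<union> range Mul)" for x
    by (cases x) auto
  then show "finite (UNIV :: nonterm set)"
    by (intro finite_subset[of UNIV "insert Start (range Can \<union> range Pal \<union> range Mul)"] subsetI) simp_all
qed

lemma expand_NilI: "[] \<in> expand M []"
  by simp

lemma expand_InlI: "u \<in> M x \<Longrightarrow> w \<in> expand M \<alpha> \<Longrightarrow> u @ w \<in> expand M (Inl x # \<alpha>)"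
  by auto

lemma expand_InrI: "w \<in> expand M \<alpha> \<Longrightarrow> a # w \<in> expand M (Inr a # \<alpha>)"
  by auto

lemma expand_map_Inr_append [simp]: "expand M (map Inr u @ \<alpha>) = (@) u ` expand M \<alpha>"
  by (auto simp: expand_append)

lemma expand_mapI: "w \<in> expand M \<alpha> \<Longrightarrow> u @ w \<in> expand M (map Inr u @ \<alpha>)"
  by simp

lemma expand_map_Inr_comp [simp]:
  "expand M (map (Inr \<circ> f) u) = {map f u}"
  "expand M (map (Inr \<circ> f) u @ \<alpha>) = (@) (map f u) ` expand M \<alpha>"
  using expand_map_Inr[of M "map f u"] expand_map_Inr_append[of M "map f u" \<alpha>] by simp_all

locale spelled_groups = tagged_groups +
  fixes spell :: "'a \<Rightarrow> nat list"
begin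

definition spells :: "'a list \<Rightarrow> nat list" where "spells s = concat (map spell s)"

abbreviation letters :: "'a list \<Rightarrow> nat tsym list" where "letters s \<equiv> map Letter (spells s)"

lemma spells_simps [simp]: "spells [] = []" "spells (x # s) = spell x @ spells s"
  "spells (s @ s') = spells s @ spells s'"
  by (simp_all add: spells_def)

abbreviation erase :: "bool \<Rightarrow> 'a \<Rightarrow> nat tsym list"
  where "erase b x \<equiv> if b then [] else map Letter (spell x)"

text \<open>
  The flags \<open>a\<close>, \<open>b\<close>, \<open>c\<close> say which of the three entries are the identity; those are erased, since
  the identity is spelled by the empty word in the free product but not necessarily in a factor.
\<close>

definition table :: "bool \<Rightarrow> bool \<Rightarrow> bool \<Rightarrow> bool \<Rightarrow> (nonterm + nat tsym) list \<Rightarrow>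
    (nonterm + nat tsym) list \<Rightarrow> (nonterm + nat tsym) list set"
  where "table t a b c \<alpha> \<beta> =
    {map Inr (erase a x) @ \<alpha> @ map Inr (erase b y) @ \<beta> @ map Inr (rev (erase c (mul x y))) | x y.
      x \<in> L \<and> y \<in> L \<and> tag x = t \<and> tag y = t \<and>
      (x = one t \<longleftrightarrow> a) \<and> (y = one t \<longleftrightarrow> b) \<and> (mul x y = one t \<longleftrightarrow> c)}"

text \<open>\<open>Mul\<close> peels off the syllables shared by the left factor and the product. It
  stops with \<open>q\<close> empty, with \<open>s\<close> empty and nothing to merge, or with the
  genuine product of the last syllable of \<open>p\<close> and the first of \<open>q\<close>. The
  second kind of rule for \<open>Start\<close> covers empty \<open>p\<close>, where the left factor
  and the product may begin in different factor groups.\<close>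

definition table_rules :: "(nonterm \<times> (nonterm + nat tsym) list set) set"
  where "table_rules = (\<Union>t.
    {(Start, {[Inl (Mul t)]}),
     (Start, {[Inl (Can t), Inl (Pal (\<not> t))]}),
     (Can t, {[Inr Hash1]}),
     (Can t, table t False False True [Inl (Can (\<not> t))] []),
     (Pal t, {[Inr Hash2]}),
     (Pal t, table t True False False [] [Inl (Pal (\<not> t))]),
     (Mul t, {[Inl (Can t), Inr Hash2]}),
     (Mul t, {[Inr Hash1, Inl (Pal t)]}),
     (Mul t, table t True False False [] [Inl (Mul (\<not> t))]),
     (Mul t, table t False False False [Inl (Can (\<not> t))] [Inl (Pal (\<not> t))])})"

text \<open>In \<open>Mul t\<close> the product \<open>w\<close> has to be reduced with the tag
  \<open>t\<close> as well. Then a syllable of the opposite tag put in front of \<open>u\<close>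
  neither merges nor cancels, and it reappears in front of \<open>w\<close>.\<close>

fun meaning :: "nonterm \<Rightarrow> nat tsym list set" where
  "meaning Start = {letters u @ [Hash1] @ letters v @ [Hash2] @ rev (letters w) | u v w.
     reduced u \<and> reduced v \<and> reduced w \<and> nf (u @ v) = w}"
| "meaning (Can t) = {letters s @ [Hash1] @ letters (sinv s) | s. red t s}"
| "meaning (Pal t) = {letters s @ [Hash2] @ rev (letters s) | s. red t s}"
| "meaning (Mul t) = {letters u @ [Hash1] @ letters v @ [Hash2] @ rev (letters w) | u v w.
     red t u \<and> reduced v \<and> red t w \<and> nf (u @ v) = w}"

abbreviation S :: "nonterm \<Rightarrow> (nonterm + nat tsym) list set" where
  "S \<equiv> \<lambda>x. \<Union>{K. (x, K) \<in> table_rules}"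

lemma red_sinv_append:
  "red t s \<Longrightarrow> red (\<not> t) q \<Longrightarrow> red (t = odd (length s)) (sinv s @ q)"
  using red_sinv[of t s] by (simp add: red_append)

lemma red_unique: "red t s \<Longrightarrow> red t' s \<Longrightarrow> s \<noteq> [] \<Longrightarrow> t = t'"
  by (cases s) auto

text \<open>The last syllable of \<open>sinv s\<close> is the inverse of the first syllable of
  \<open>s\<close>, so it has the tag \<open>t\<close>, and \<open>q\<close> has to continue with
  the other one.\<close>

lemma red_sinv_appendD:
  assumes "red t s" "s \<noteq> []" "reduced (sinv s @ q)"
  shows "red (\<not> t) q"
proof -
  obtain t' where t': "red t' (sinv s @ q)" using assms(3) by (auto simp: reduced_def)
  moreover have "sinv s \<noteq> []" using assms(2) by (simp add: sinv_def)
  ultimately have "t' = (t = odd (length s))"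
    using red_unique[OF _ red_sinv[OF assms(1)]] by (simp add: red_append)
  with t' show ?thesis by (simp add: red_append split: if_splits)
qed

lemma table_rules_cases:
  assumes "(X, K) \<in> table_rules"
  shows "\<exists>t.
     X = Start \<and> K = {[Inl (Mul t)]} \<or>
     X = Start \<and> K = {[Inl (Can t), Inl (Pal (\<not> t))]} \<or>
     X = Can t \<and> K = {[Inr Hash1]} \<or>
     X = Can t \<and> K = table t False False True [Inl (Can (\<not> t))] [] \<or>
     X = Pal t \<and> K = {[Inr Hash2]} \<or>
     X = Pal t \<and> K = table t True False False [] [Inl (Pal (\<not> t))] \<or>
     X = Mul t \<and> K = {[Inl (Can t), Inr Hash2]} \<or>
     X = Mul t \<and> K = {[Inr Hash1, Inl (Pal t)]} \<or>
     X = Mul t \<and> K = table t True False False [] [Inl (Mul (\<not> t))] \<or>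
     X = Mul t \<and> K = table t False False False [Inl (Can (\<not> t))] [Inl (Pal (\<not> t))]"
  using assms unfolding table_rules_def UN_iff bex_UNIV insert_iff empty_iff prod.inject
  by (simp only: simp_thms)

section \<open>Soundness of the grammar\<close>

lemma table_sound:
  assumes "(X, K) \<in> table_rules" "\<alpha> \<in> K"
  shows "expand meaning \<alpha> \<subseteq> meaning X"
proof
  fix w assume w: "w \<in> expand meaning \<alpha>"
  from table_rules_cases[OF assms(1)] show "w \<in> meaning X"
  proof (elim exE disjE conjE)
    fix t assume X: "X = Start" "K = {[Inl (Mul t)]}"
    with w assms(2) obtain u v z where
      "w = letters u @ [Hash1] @ letters v @ [Hash2] @ rev (letters z)"
      "red t u" "reduced v" "red t z" "nf (u @ v) = z" by auto
    then show ?thesis unfolding X(1) meaning.simps using red_reduced by blast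
  next
    fix t assume X: "X = Start" "K = {[Inl (Can t), Inl (Pal (\<not> t))]}"
    with w assms(2) obtain s q where sq: "red t s" "red (\<not> t) q"
      "w = letters s @ [Hash1] @ letters (sinv s @ q) @ [Hash2] @ rev (letters q)" by auto
    moreover have "nf (s @ sinv s @ q) = q"
      using nf_cancel[of "[]" s q] sq red_reduced by auto
    ultimately show ?thesis
      unfolding X(1) meaning.simps using red_reduced red_sinv_append by blast
  next
    fix t assume X: "X = Can t" "K = {[Inr Hash1]}"
    with w assms(2) show ?thesis by (auto intro!: exI[of _ "[]"])
  next
    fix t assume X: "X = Can t" "K = table t False False True [Inl (Can (\<not> t))] []"
    with w assms(2) obtain x y s where xy: "x \<in> L" "y \<in> L" "tag x = t" "tag y = t" "x \<noteq> one t"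
      "mul x y = one t" "red (\<not> t) s"
      "w = map Letter (spell x) @ letters s @ [Hash1] @ letters (sinv s) @ map Letter (spell y)"
      by (auto simp: table_def)
    then have "y = ginv x" by (simp add: inv_unique)
    then show ?thesis using X xy by (auto intro!: exI[of _ "x # s"])
  next
    fix t assume X: "X = Pal t" "K = {[Inr Hash2]}"
    with w assms(2) show ?thesis by (auto intro!: exI[of _ "[]"])
  next
    fix t assume X: "X = Pal t" "K = table t True False False [] [Inl (Pal (\<not> t))]"
    with w assms(2) obtain y s where "y \<in> L" "tag y = t" "y \<noteq> one t" "red (\<not> t) s"
      "w = map Letter (spell y) @ letters s @ [Hash2] @ rev (letters s) @ rev (map Letter (spell y))"
      by (auto simp: table_def mul_one_left)
    then show ?thesis using X by (auto intro!: exI[of _ "y # s"])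
  next
    fix t assume X: "X = Mul t" "K = {[Inl (Can t), Inr Hash2]}"
    with w assms(2) obtain s where s: "red t s"
      "w = letters s @ [Hash1] @ letters (sinv s) @ [Hash2] @ rev (letters [])" by auto
    moreover have "nf (s @ sinv s) = []"
      using nf_cancel[of "[]" s "[]"] s red_reduced[of t] by auto
    moreover have "reduced (sinv s)" "red t []" using red_sinv[OF s(1)] red_reduced by auto
    ultimately show ?thesis unfolding X(1) meaning.simps by blast
  next
    fix t assume X: "X = Mul t" "K = {[Inr Hash1, Inl (Pal t)]}"
    with w assms(2) obtain q where q: "red t q"
      "w = letters [] @ [Hash1] @ letters q @ [Hash2] @ rev (letters q)" by auto
    moreover have "nf ([] @ q) = q" "red t []" using nf_red[OF q(1)] by auto
    ultimately show ?thesis unfolding X(1) meaning.simps using red_reduced by blast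
  next
    fix t assume X: "X = Mul t" "K = table t True False False [] [Inl (Mul (\<not> t))]"
    with w assms(2) obtain y u v z where y: "y \<in> L" "tag y = t" "y \<noteq> one t"
      "w = letters (y # u) @ [Hash1] @ letters v @ [Hash2] @ rev (letters (y # z))"
      and uv: "red (\<not> t) u" "reduced v" "red (\<not> t) z" "nf (u @ v) = z"
      by (auto simp: table_def mul_one_left)
    then have "nf ((y # u) @ v) = y # z" by (simp add: nf_def push_red)
    moreover have "red t (y # u)" "red t (y # z)" using y uv by auto
    ultimately show ?thesis unfolding X(1) meaning.simps using y(4) uv(2) by blast
  next
    fix t assume X: "X = Mul t" "K = table t False False False [Inl (Can (\<not> t))] [Inl (Pal (\<not> t))]"
    with w assms(2) obtain x y s q where xy: "x \<in> L" "y \<in> L" "tag x = t" "tag y = t" "x \<noteq> one t"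
      "y \<noteq> one t" "mul x y \<noteq> one t" and sq: "red (\<not> t) s" "red (\<not> t) q" and
      w: "w = letters (x # s) @ [Hash1] @ letters (sinv s @ y # q) @ [Hash2] @ rev (letters (mul x y # q))"
      by (auto simp: table_def)
    have "red t (x # s)" "red t (y # q)" "red t (mul x y # q)"
      using xy sq by (auto simp: mul_closed tag_mul)
    moreover from this have "nf ((x # s) @ sinv s @ y # q) = mul x y # q"
      using nf_cancel[of "[x]" s "y # q"] xy red_reduced by auto
    moreover have "reduced (sinv s @ y # q)"
      using red_reduced[OF red_sinv_append[OF sq(1), of "y # q"]] calculation(2) by simp
    ultimately show ?thesis unfolding X(1) meaning.simps w by blast
  qed
qed

section \<open>Completeness of the grammar\<close>

abbreviation gen :: "nonterm \<Rightarrow> nat tsym list set" where "gen X \<equiv> {w. yields S [Inl X] w}"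

lemma gen_step:
  assumes "(X, K) \<in> table_rules" "\<alpha> \<in> K" "w \<in> expand gen \<alpha>"
  shows "w \<in> gen X"
proof -
  have "\<alpha> \<in> S X" using assms(1,2) by blast
  moreover have "yields S \<alpha> w" using assms(3) by (simp only: yields_iff_expand[of S \<alpha>])
  ultimately show ?thesis by (auto simp only: mem_Collect_eq yields_single)
qed

lemma table_rulesI:
  "(Start, {[Inl (Mul t)]}) \<in> table_rules"
  "(Start, {[Inl (Can t), Inl (Pal (\<not> t))]}) \<in> table_rules"
  "(Can t, {[Inr Hash1]}) \<in> table_rules"
  "(Can t, table t False False True [Inl (Can (\<not> t))] []) \<in> table_rules"
  "(Pal t, {[Inr Hash2]}) \<in> table_rules"
  "(Pal t, table t True False False [] [Inl (Pal (\<not> t))]) \<in> table_rules"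
  "(Mul t, {[Inl (Can t), Inr Hash2]}) \<in> table_rules"
  "(Mul t, {[Inr Hash1, Inl (Pal t)]}) \<in> table_rules"
  "(Mul t, table t True False False [] [Inl (Mul (\<not> t))]) \<in> table_rules"
  "(Mul t, table t False False False [Inl (Can (\<not> t))] [Inl (Pal (\<not> t))]) \<in> table_rules"
  unfolding table_rules_def by (intro UN_I[where a = t] UNIV_I insertI1 insertI2)+

lemma tableI:
  assumes "x \<in> L" "y \<in> L" "tag x = t" "tag y = t"
  shows "map Inr (erase (x = one t) x) @ \<alpha> @ map Inr (erase (y = one t) y) @ \<beta> @
      map Inr (rev (erase (mul x y = one t) (mul x y)))
    \<in> table t (x = one t) (y = one t) (mul x y = one t) \<alpha> \<beta>"
  unfolding table_def using assms by (intro CollectI exI[of _ x] exI[of _ y]) simp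

lemma table_cancelI:
  assumes "x \<in> L" "tag x = t" "x \<noteq> one t"
  shows "map Inr (map Letter (spell x)) @ \<alpha> @ map Inr (map Letter (spell (ginv x))) \<in>
    table t False False True \<alpha> []"
proof -
  have "ginv x \<noteq> one t" using assms inv_eq_one by blast
  then show ?thesis
    using tableI[of x "ginv x" t \<alpha> "[]"] assms by (simp add: inv_closed tag_inv mul_inv_right)
qed

lemma table_copyI:
  assumes "x \<in> L" "tag x = t" "x \<noteq> one t"
  shows "map Inr (map Letter (spell x)) @ \<beta> @ map Inr (rev (map Letter (spell x))) \<in>
    table t True False False [] \<beta>"
  using tableI[of "one t" x t "[]" \<beta>] assms by (simp add: one_closed tag_one mul_one_left)

lemma table_mulI:
  assumes "x \<in> L" "tag x = t" "x \<noteq> one t" "y \<in> L" "tag y = t" "y \<noteq> one t" "mul x y \<noteq> one t"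
  shows "map Inr (map Letter (spell x)) @ \<alpha> @ map Inr (map Letter (spell y)) @ \<beta> @
      map Inr (rev (map Letter (spell (mul x y)))) \<in> table t False False False \<alpha> \<beta>"
  using tableI[of x y t \<alpha> \<beta>] assms by simp

lemma gen_Can: "red t s \<Longrightarrow> letters s @ Hash1 # letters (sinv s) \<in> gen (Can t)"
proof (induction t s rule: red.induct)
  case (1 t)
  show ?case by (rule gen_step[OF table_rulesI(3) singletonI]) auto
next
  case (2 t x s)
  then have x: "x \<in> L" "tag x = t" "x \<noteq> one t" and s: "letters s @ Hash1 # letters (sinv s) \<in> gen (Can (\<not> t))"
    by auto
  show ?case
    by (rule gen_step[OF table_rulesI(4) table_cancelI[OF x]]) (use s in auto)
qed

lemma gen_Pal: "red t s \<Longrightarrow> letters s @ Hash2 # rev (letters s) \<in> gen (Pal t)"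
proof (induction t s rule: red.induct)
  case (1 t)
  show ?case by (rule gen_step[OF table_rulesI(5) singletonI]) auto
next
  case (2 t x s)
  then have x: "x \<in> L" "tag x = t" "x \<noteq> one t" and s: "letters s @ Hash2 # rev (letters s) \<in> gen (Pal (\<not> t))"
    by auto
  show ?case
    by (rule gen_step[OF table_rulesI(6) table_copyI[OF x]]) (use s in auto)
qed

text \<open>The tags alternate along \<open>p\<close>, so the parity of its length gives the tag
  with which the inner word must begin.\<close>

lemma gen_Mul_wrap:
  "red t p \<Longrightarrow> w \<in> gen (Mul (if even (length p) then t else \<not> t)) \<Longrightarrow>
    letters p @ w @ rev (letters p) \<in> gen (Mul t)"
proof (induction t p rule: red.induct)
  case (2 t x p)
  then have x: "x \<in> L" "tag x = t" "x \<noteq> one t" and p: "letters p @ w @ rev (letters p) \<in> gen (Mul (\<not> t))"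
    by (auto split: if_splits)
  show ?case
    by (rule gen_step[OF table_rulesI(9) table_copyI[OF x]]) (use p in auto)
qed simp

lemma gen_Start:
  assumes "reduced u" "reduced v"
  shows "letters u @ Hash1 # letters v @ Hash2 # rev (letters (nf (u @ v))) \<in> gen Start"
proof -
  obtain p s q where u: "u = p @ s" and v: "v = sinv s @ q" and
    psq: "p = [] \<or> q = [] \<or> tag (last p) \<noteq> tag (hd q) \<or> mul (last p) (hd q) \<noteq> one (tag (hd q))"
    using cancellation[OF assms] by blast
  have q: "reduced q" using assms(2) v reduced_appendD by blast
  have nf: "nf (u @ v) = act p q" using assms q u v nf_cancel[of p s q] by simp
  obtain t where "red t u" using assms by (auto simp: reduced_def)
  \<comment> \<open>The tag with which \<open>u\<close> continues after \<open>p\<close>, read off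
    from the parity of the length of \<open>p\<close>.\<close>
  define t' where "t' = (if even (length p) then t else \<not> t)"
  have p: "red t p" and s: "red t' s" using \<open>red t u\<close> u by (auto simp: red_append t'_def)
  have start_Mul: "w \<in> gen Start" if "w \<in> gen (Mul t)" for w
    using gen_step[OF table_rulesI(1) singletonI expand_InlI[of w gen, OF that expand_NilI]] by simp
  have start: "letters p @ w @ rev (letters p) \<in> gen Start" if "w \<in> gen (Mul t')" for w
    using start_Mul[OF gen_Mul_wrap[OF p]] that unfolding t'_def .
  show ?thesis
  proof (cases "p = [] \<or> q = []")
    case True
    then show ?thesis
    proof
      assume "p = []"
      \<comment> \<open>If \<open>s\<close> is not empty, its tag is forced and reducedness of
        \<open>v\<close> makes \<open>q\<close> begin with the other one. If \<open>s\<close> is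
        empty, it fits any tag, so the one opposite to \<open>q\<close> is taken.\<close>
      have "\<exists>t. red t s \<and> red (\<not> t) q"
      proof (cases "s = []")
        case True
        obtain t where "red t q" using q by (auto simp: reduced_def)
        then show ?thesis using True by (intro exI[of _ "\<not> t"]) auto
      next
        case False
        then show ?thesis using s red_sinv_appendD assms(2) v by blast
      qed
      then obtain t where t: "red t s" "red (\<not> t) q" by blast
      have "(letters s @ Hash1 # letters (sinv s)) @ (letters q @ Hash2 # rev (letters q)) @ [] \<in> gen Start"
        by (intro gen_step[OF table_rulesI(2)[of t] singletonI] expand_InlI expand_NilI gen_Can gen_Pal t)
      then show ?thesis using \<open>p = []\<close> nf u v by simp
    next
      assume "q = []"
      have "(letters s @ Hash1 # letters (sinv s)) @ [Hash2] \<in> gen (Mul t')"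
        by (intro gen_step[OF table_rulesI(7) singletonI] expand_InlI expand_InrI expand_NilI gen_Can s)
      from start[OF this] show ?thesis
        using \<open>q = []\<close> nf u v act_red[of t p "[]"] p by simp
    qed
  next
    case False
    then obtain p' a b q' where p': "p = p' @ [a]" and q': "q = b # q'"
      by (metis neq_Nil_conv rev_exhaust)
    have a: "a \<in> L" "a \<noteq> one (tag a)" "t' = (\<not> tag a)" "red t p'"
      "tag a = (if even (length p') then t else \<not> t)"
      using p p' by (auto simp: red_append t'_def)
    have b: "b \<in> L" "b \<noteq> one (tag b)" "red (tag b) q" "red (\<not> tag b) q'"
      using q q' by (auto simp: reduced_def)
    show ?thesis
    proof (cases "tag a = tag b")
      case True
      let ?z = "mul a b"
      have z: "?z \<noteq> one (tag a)" "?z \<in> L" "tag ?z = tag a"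
        using psq p' q' a b True by (auto simp: mul_closed tag_mul)
      then have "red t (p' @ ?z # q')" using a b True by (auto simp: red_append)
      then have "act p' (?z # q') = p' @ ?z # q'" by (rule act_red)
      moreover have "push a q = ?z # q'" using True z a q' by simp
      ultimately have w: "nf (u @ v) = p' @ ?z # q'" using nf p' by simp
      \<comment> \<open>What remains between the outer copies of \<open>p'\<close>: a single use of
        the product rule, with a cancelling piece in place of the first separator and a mirrored
        piece in place of the second.\<close>
      let ?m = "map Letter (spell a) @ (letters s @ Hash1 # letters (sinv s)) @ map Letter (spell b) @
        (letters q' @ Hash2 # rev (letters q')) @ rev (map Letter (spell ?z))"
      have sq: "red (\<not> tag a) s" "red (\<not> tag a) q'" using s a b True by auto
      note m = expand_InlI[of _ gen, OF gen_Can[OF sq(1)]] expand_InlI[of _ gen, OF gen_Pal[OF sq(2)]]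
      have "?m \<in> gen (Mul (tag a))"
      proof (rule gen_step[OF table_rulesI(10) table_mulI[of a _ b]])
        show "?m \<in> expand gen (map Inr (map Letter (spell a)) @ [Inl (Can (\<not> tag a))] @
          map Inr (map Letter (spell b)) @ [Inl (Pal (\<not> tag a))] @ map Inr (rev (map Letter (spell ?z))))"
          unfolding append_Cons append_Nil
          by (intro expand_mapI m) (simp only: expand_map_Inr singleton_iff)
      qed (use a b z True in auto)
      then have "letters p' @ ?m @ rev (letters p') \<in> gen (Mul t)"
        unfolding a(5) by (rule gen_Mul_wrap[OF a(4)])
      then have "letters p' @ ?m @ rev (letters p') \<in> gen Start" by (rule start_Mul)
      then show ?thesis using u v p' q' w by simp
    next
      case False
      \<comment> \<open>A nonempty \<open>s\<close> would be adjacent to \<open>a\<close> in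
        \<open>u\<close> and its inverse adjacent to \<open>b\<close> in \<open>v\<close>, at the
        same end of \<open>s\<close>. Both would then have the tag opposite to that of its first
        syllable, against the assumption that they differ.\<close>
      have "s = []"
      proof (rule ccontr)
        assume "s \<noteq> []"
        then have "red (\<not> t') q" using red_sinv_appendD[OF s] assms(2) v by simp
        then show False using q' a False by auto
      qed
      have "t' = tag b" using a(3) False by auto
      then have "red t' q" using b(3) by simp
      then have "Hash1 # letters q @ Hash2 # rev (letters q) \<in> gen (Mul t')"
        using expand_InrI[OF expand_InlI[of _ gen, OF gen_Pal expand_NilI], of t' q Hash1]
        by (intro gen_step[OF table_rulesI(8) singletonI]) simp
      moreover have "red t (p @ q)" using p \<open>red t' q\<close> by (simp add: red_append t'_def)
      then have "nf (u @ v) = p @ q" using nf act_red by simp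
      ultimately show ?thesis using start[of "Hash1 # letters q @ Hash2 # rev (letters q)"] u v \<open>s = []\<close>
        by simp
    qed
  qed
qed

theorem gen_eq: "gen Start = meaning Start"
proof
  show "gen Start \<subseteq> meaning Start"
  proof
    fix w assume "w \<in> gen Start"
    then have "w \<in> expand meaning [Inl Start]"
      by (intro yields_least[where S = S]) (use table_sound in blast)+
    then show "w \<in> meaning Start" by simp
  qed
  show "meaning Start \<subseteq> gen Start"
  proof
    fix w assume "w \<in> meaning Start"
    then obtain u v where "reduced u" "reduced v"
      "w = letters u @ Hash1 # letters v @ Hash2 # rev (letters (nf (u @ v)))" by auto
    then show "w \<in> gen Start" using gen_Start by simp
  qed
qed

theorem meaning_IND:
  assumes "\<And>t a b c \<alpha> \<beta>. table t a b c \<alpha> \<beta> \<in> IND"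
  shows "meaning Start \<in> IND"
proof -
  have "finite table_rules" by (simp add: table_rules_def)
  moreover have "K \<in> IND" if "(X, K) \<in> table_rules" for X K
    using table_rules_cases[OF that] by (elim exE disjE conjE) (simp_all only: assms singleton_IND)
  ultimately have "gen Start \<in> IND" by (rule IND_nested)
  then show ?thesis by (simp only: gen_eq)
qed

end

section \<open>Regular languages and tables of the factors\<close>

text \<open>Regularity in the style of Myhill and Nerode: a finite family of languages closed under
  left quotients by letters is the state set of an automaton. Operations on languages thus replace
  constructions on automata.\<close>

definition residual_family :: "'a set \<Rightarrow> 'a list set set \<Rightarrow> bool"
  where "residual_family A \<Q> \<longleftrightarrow>
    finite \<Q> \<and> (\<forall>X\<in>\<Q>. X \<subseteq> lists A \<and> (\<forall>a\<in>A. {w. a # w \<in> X} \<in> \<Q>))"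

lemma regular_languageI:
  assumes "finite A" "residual_family A \<Q>" "R \<in> \<Q>"
  shows "regular_language A R"
proof -
  have fin: "finite \<Q>" and sub: "\<And>X. X \<in> \<Q> \<Longrightarrow> X \<subseteq> lists A"
    and res: "\<And>X a. \<lbrakk>X \<in> \<Q>; a \<in> A\<rbrakk> \<Longrightarrow> {w. a # w \<in> X} \<in> \<Q>"
    using assms(2) by (auto simp: residual_family_def)
  obtain f :: "'a list set \<Rightarrow> nat" where f: "inj_on f \<Q>"
    using finite_imp_inj_to_nat_seg[OF fin] by blast
  define \<delta> where "\<delta> q a = f {w. a # w \<in> inv_into \<Q> f q}" for q a
  have \<delta>: "\<delta> (f X) a = f {w. a # w \<in> X}" if "X \<in> \<Q>" for X a
    using that f by (simp add: \<delta>_def)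
  have fold: "foldl \<delta> (f X) w = f {v. w @ v \<in> X} \<and> {v. w @ v \<in> X} \<in> \<Q>"
    if "X \<in> \<Q>" "w \<in> lists A" for X w
    using that(2,1)
  proof (induction w arbitrary: X)
    case (Cons a w)
    then show ?case using res[of X a] Cons.IH[of "{w. a # w \<in> X}"] by (simp add: \<delta>)
  qed simp
  let ?E = "f ` {X \<in> \<Q>. [] \<in> X}"
  have acc: "foldl \<delta> (f R) w \<in> ?E \<longleftrightarrow> w \<in> R" if "w \<in> lists A" for w
    using fold[OF assms(3) that] inj_on_image_mem_iff[OF f, of "{v. w @ v \<in> R}" "{X \<in> \<Q>. [] \<in> X}"]
    by auto
  show ?thesis unfolding regular_language_def
  proof (intro exI conjI)
    show "finite (f ` \<Q>)" "f R \<in> f ` \<Q>" "?E \<subseteq> f ` \<Q>" using fin assms(3) by auto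
    show "\<forall>q\<in>f ` \<Q>. \<forall>a\<in>A. \<delta> q a \<in> f ` \<Q>" using res by (auto simp: \<delta>)
    show "R = {w \<in> lists A. foldl \<delta> (f R) w \<in> ?E}" using acc sub[OF assms(3)] by blast
  qed (rule assms(1))
qed

lemma regular_residual_family:
  assumes "regular_language A R"
  obtains \<Q> where "residual_family A \<Q>" "R \<in> \<Q>"
proof -
  obtain Q :: "nat set" and q\<^sub>0 E \<delta> where Q: "finite Q" "q\<^sub>0 \<in> Q" "\<forall>q\<in>Q. \<forall>a\<in>A. \<delta> q a \<in> Q"
    and R: "R = {w \<in> lists A. foldl \<delta> q\<^sub>0 w \<in> E}"
    using assms unfolding regular_language_def by blast
  let ?L = "\<lambda>q. {w \<in> lists A. foldl \<delta> q w \<in> E}"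
  have "{w. a # w \<in> ?L q} = ?L (\<delta> q a)" if "a \<in> A" for q a using that by auto
  then have "residual_family A (?L ` Q)" using Q by (auto simp: residual_family_def)
  then show ?thesis using that R Q(2) by blast
qed

text \<open>The quotients of a single word are its suffixes, and the empty language after a
  mismatch.\<close>

lemma residual_family_singleton:
  assumes "e \<in> lists A"
  shows "residual_family A (insert {} ((\<lambda>n. {drop n e}) ` {..length e}))"
proof -
  have "{w. a # w \<in> {drop n e}} \<in> insert {} ((\<lambda>n. {drop n e}) ` {..length e})" if "n \<le> length e" for n a
  proof (cases "n < length e \<and> e ! n = a")
    case True
    then have "drop n e = a # drop (Suc n) e" by (metis Cons_nth_drop_Suc)
    then have "{w. a # w \<in> {drop n e}} = {drop (Suc n) e}" by auto
    then show ?thesis using True by auto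
  next
    case False
    then have "{w. a # w \<in> {drop n e}} = {}"
      using that by (cases "n < length e") (auto simp: Cons_nth_drop_Suc[symmetric])
    then show ?thesis by simp
  qed
  moreover have "drop n e \<in> lists A" for n using assms set_drop_subset[of n e] by auto
  ultimately show ?thesis by (simp add: residual_family_def)
qed

lemma residual_family_diff:
  assumes "residual_family A \<Q>" "residual_family A \<Q>'"
  shows "residual_family A ((\<lambda>(X, Y). X - Y) ` (\<Q> \<times> \<Q>'))"
  unfolding residual_family_def
proof (intro conjI ballI)
  show "finite ((\<lambda>(X, Y). X - Y) ` (\<Q> \<times> \<Q>'))" using assms by (auto simp: residual_family_def)
  fix Z assume "Z \<in> (\<lambda>(X, Y). X - Y) ` (\<Q> \<times> \<Q>')"
  then obtain X Y where Z: "Z = X - Y" "X \<in> \<Q>" "Y \<in> \<Q>'" by auto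
  then show "Z \<subseteq> lists A" using assms(1) by (auto simp: residual_family_def)
  fix a assume "a \<in> A"
  then have "{w. a # w \<in> X} \<in> \<Q>" "{w. a # w \<in> Y} \<in> \<Q>'"
    using assms Z by (auto simp: residual_family_def)
  moreover have "{w. a # w \<in> Z} = {w. a # w \<in> X} - {w. a # w \<in> Y}" using Z(1) by auto
  ultimately show "{w. a # w \<in> Z} \<in> (\<lambda>(X, Y). X - Y) ` (\<Q> \<times> \<Q>')" by blast
qed

lemma residual_family_image:
  assumes "residual_family A \<Q>" "inj f"
  shows "residual_family (f ` A) ((`) (map f) ` \<Q>)"
proof -
  have "{w. f a # w \<in> map f ` X} = map f ` {w. a # w \<in> X}" for a X
    using assms(2) by (auto simp: image_iff inj_eq) (metis list.simps(9))
  then show ?thesis using assms(1) unfolding residual_family_def by fastforce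
qed

definition conc :: "'a list set \<Rightarrow> 'a list set \<Rightarrow> 'a list set" where "conc X Y = {x @ y | x y. x \<in> X \<and> y \<in> Y}"

lemma conc_empty [simp]: "conc {} Y = {}"
  by (simp add: conc_def)

text \<open>The alphabets are disjoint and no block is empty, so the next letter decides between
  continuing the current block and beginning the next one. Every quotient is therefore empty or a
  single product \<open>conc X (F (\<not> t))\<close>, and no unions of such products have to be
  added to the family.\<close>

lemma regular_alternating:
  fixes A :: "bool \<Rightarrow> 'a set" and K F :: "bool \<Rightarrow> 'a list set"
  assumes fin: "\<And>t. finite (A t)" and disj: "A True \<inter> A False = {}"
    and fam: "\<And>t. residual_family (A t) (\<Q> t)" and K: "\<And>t. K t \<in> \<Q> t" and nil: "\<And>t. [] \<notin> K t"
    and F: "\<And>t. F t = insert [] (conc (K t) (F (\<not> t)))" and sub: "\<And>t. F t \<subseteq> lists (A True \<union> A False)"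
  shows "regular_language (A True \<union> A False) (F True \<union> F False)"
proof -
  have sub': "X \<subseteq> lists (A t)" and res: "\<And>a. a \<in> A t \<Longrightarrow> {w. a # w \<in> X} \<in> \<Q> t" if "X \<in> \<Q> t" for X t
    using fam[of t] that by (auto simp: residual_family_def)
  have disj': "a \<notin> A (\<not> t)" if "a \<in> A t" for a t using disj that by (cases t) auto
  have res_conc: "{w. a # w \<in> conc X Y} =
      conc {w. a # w \<in> X} Y \<union> (if [] \<in> X then {w. a # w \<in> Y} else {})" for a :: 'a and X Y
    unfolding conc_def by (auto simp: Cons_eq_append_conv)
  have res_F: "{w. a # w \<in> F t} = conc {w. a # w \<in> K t} (F (\<not> t))" for a t
    by (subst F) (simp add: res_conc nil)
  have no: "{w. a # w \<in> X} = {}" if "X \<in> \<Q> t" "a \<notin> A t" for X t a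
    using sub'[OF that(1)] that(2) by auto
  define \<Z> where "\<Z> = {F True \<union> F False, {}} \<union> (\<Union>t. (\<lambda>X. conc X (F (\<not> t))) ` \<Q> t)"
  have conc_Z: "conc X (F (\<not> t)) \<in> \<Z>" if "X \<in> \<Q> t" for X t
    unfolding \<Z>_def using that by blast
  have F_Z: "{w. a # w \<in> F t} = (if a \<in> A t then conc {w. a # w \<in> K t} (F (\<not> t)) else {})" for a t
    using res_F no[OF K, of a t] by (auto simp: conc_def)
  have "residual_family (A True \<union> A False) \<Z>"
    unfolding residual_family_def
  proof (intro conjI ballI)
    show "finite \<Z>" using fam by (simp add: \<Z>_def residual_family_def)
    fix Z assume Z: "Z \<in> \<Z>"
    have "conc X (F (\<not> t)) \<subseteq> lists (A True \<union> A False)" if "X \<in> \<Q> t" for X t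
    proof -
      have "A t \<subseteq> A True \<union> A False" by (cases t) auto
      then show ?thesis using sub'[OF that] sub[of "\<not> t"] unfolding conc_def by (auto 0 4)
    qed
    then show "Z \<subseteq> lists (A True \<union> A False)" using Z sub unfolding \<Z>_def by blast
    fix a assume "a \<in> A True \<union> A False"
    then obtain s where a: "a \<in> A s" by auto
    from Z consider "Z = F True \<union> F False" | "Z = {}" | t X where "X \<in> \<Q> t" "Z = conc X (F (\<not> t))"
      unfolding \<Z>_def by blast
    then show "{w. a # w \<in> Z} \<in> \<Z>"
    proof cases
      case 1
      then have "{w. a # w \<in> Z} = {w. a # w \<in> F s} \<union> {w. a # w \<in> F (\<not> s)}" by (cases s) auto
      also have "\<dots> = conc {w. a # w \<in> K s} (F (\<not> s))" using a disj'[OF a] by (simp add: F_Z)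
      finally show ?thesis using conc_Z[OF res[OF K a]] by simp
    next
      case 2
      then show ?thesis by (simp add: \<Z>_def)
    next
      case (3 t X)
      show ?thesis
      proof (cases "t = s")
        case True
        then have "{w. a # w \<in> Z} = conc {w. a # w \<in> X} (F (\<not> t))"
          using 3 disj'[OF a] by (simp add: res_conc F_Z)
        then show ?thesis using conc_Z[OF res[OF 3(1)]] a True by simp
      next
        case False
        then have t: "t = (\<not> s)" by auto
        have "{w. a # w \<in> X} = {}" using no[OF 3(1)] disj'[OF a] t by simp
        then have "{w. a # w \<in> Z} = (if [] \<in> X then conc {w. a # w \<in> K s} (F (\<not> s)) else {})"
          using 3 a t by (simp add: res_conc F_Z)
        then show ?thesis using conc_Z[OF res[OF K a]] by (simp add: \<Z>_def)
      qed
    qed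
  qed
  then show ?thesis
    by (rule regular_languageI[rotated]) (use fin in \<open>auto simp: \<Z>_def\<close>)
qed

lemma run_Cons_if:
  assumes "\<delta> p a = (if b then {(u, q)} else {})"
  shows "(out, r) \<in> run \<delta> p (a # w) \<longleftrightarrow> b \<and> (\<exists>out'. out = u @ out' \<and> (out', r) \<in> run \<delta> q w)"
  using assms by (cases b) auto

text \<open>The state is the part of an expected word still to be read. It becomes
  \<open>None\<close> at a mismatch, and also on reading beyond the end.\<close>

fun track :: "'a list option \<Rightarrow> 'a \<Rightarrow> 'a list option" where
  "track (Some (x # xs)) y = (if x = y then Some xs else None)"
| "track _ y = None"

lemma foldl_track_None [simp]: "foldl track None u = None"
  by (induction u) auto

lemma foldl_track: "foldl track (Some e) u = Some [] \<longleftrightarrow> u = e"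
proof (induction u arbitrary: e)
  case (Cons a u)
  then show ?case by (cases e) auto
qed auto

definition suffix_states :: "'a list \<Rightarrow> 'a list option set"
  where "suffix_states e = insert None ((\<lambda>n. Some (drop n e)) ` {..length e})"

lemma finite_suffix_states: "finite (suffix_states e)"
  by (simp add: suffix_states_def)

lemma suffix_states_start: "Some e \<in> suffix_states e"
  by (force simp: suffix_states_def)

lemma suffix_states_track: "m \<in> suffix_states e \<Longrightarrow> track m x \<in> suffix_states e"
proof -
  assume "m \<in> suffix_states e"
  then consider "m = None" | n where "n \<le> length e" "m = Some (drop n e)" by (auto simp: suffix_states_def)
  then show ?thesis
  proof cases
    case (2 n)
    then show ?thesis
      by (cases "n < length e") (auto simp: suffix_states_def Cons_nth_drop_Suc[symmetric])
  qed (simp add: suffix_states_def)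
qed

section \<open>Normal forms and multiplication table of one factor\<close>

locale normal_forms = group G for G :: "('g, 'm) monoid_scheme" (structure) +
  fixes A :: "nat set" and \<pi> :: "nat list \<Rightarrow> 'g" and R :: "nat list set"
  assumes generators: "monoid_generators G A \<pi>" and normal: "regular_normal_forms G A \<pi> R"
begin

lemma finite_A: "finite A"
  using generators by (simp add: monoid_generators_def)

lemma \<pi>_hom: "\<pi> \<in> hom (free_monoid A) G"
  using generators by (simp add: monoid_generators_def epi_def)

lemma \<pi>_closed: "w \<in> lists A \<Longrightarrow> \<pi> w \<in> carrier G"
  using \<pi>_hom by (auto simp: hom_def free_monoid_def)

lemma \<pi>_append: "u \<in> lists A \<Longrightarrow> v \<in> lists A \<Longrightarrow> \<pi> (u @ v) = \<pi> u \<otimes> \<pi> v"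
  using hom_mult[OF \<pi>_hom] by (simp add: free_monoid_def)

lemma \<pi>_Nil: "\<pi> [] = \<one>"
  using \<pi>_append[of "[]" "[]"] \<pi>_closed[of "[]"] by simp

lemma regular_R: "regular_language A R"
  using normal by (simp add: regular_normal_forms_def)

lemma R_lists: "w \<in> R \<Longrightarrow> w \<in> lists A"
  using regular_R by (auto simp: regular_language_def)

definition rep :: "'g \<Rightarrow> nat list" where "rep g = (THE w. w \<in> R \<and> \<pi> w = g)"

lemma ex1_rep: "g \<in> carrier G \<Longrightarrow> \<exists>!w. w \<in> R \<and> \<pi> w = g"
  using normal by (simp add: regular_normal_forms_def)

lemma rep: "g \<in> carrier G \<Longrightarrow> rep g \<in> R \<and> \<pi> (rep g) = g"
  unfolding rep_def by (rule theI'[OF ex1_rep])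

lemma rep_\<pi>: "w \<in> R \<Longrightarrow> rep (\<pi> w) = w"
  unfolding rep_def by (rule the1_equality[OF ex1_rep]) (simp_all add: \<pi>_closed R_lists)

lemma rep_eq_iff: "g \<in> carrier G \<Longrightarrow> h \<in> carrier G \<Longrightarrow> rep g = rep h \<longleftrightarrow> g = h"
  using rep by metis

lemma rep_lists: "g \<in> carrier G \<Longrightarrow> rep g \<in> lists A"
  using rep R_lists by blast

text \<open>The syllables of a reduced word exclude the identity, so its normal form is removed. The
  map \<open>f\<close> recodes letters to give the two factors disjoint alphabets.\<close>

lemma residual_family_nontrivial:
  assumes "inj f"
  obtains \<Q> where "residual_family (f ` A) \<Q>" "map f ` (R - {rep \<one>}) \<in> \<Q>"
proof -
  obtain \<Q> where \<Q>: "residual_family A \<Q>" "R \<in> \<Q>"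
    using regular_residual_family[OF regular_R] by blast
  have "rep \<one> \<in> lists A" using rep_lists by simp
  note fam = residual_family_image[OF residual_family_diff[OF \<Q>(1) residual_family_singleton[OF this]] assms]
  have "{rep \<one>} = {drop 0 (rep \<one>)}" by simp
  then have "R - {rep \<one>} \<in> (\<lambda>(X, Y). X - Y) ` (\<Q> \<times> insert {} ((\<lambda>n. {drop n (rep \<one>)}) ` {..length (rep \<one>)}))"
    using \<Q>(2) by (intro image_eqI[of _ _ "(R, {rep \<one>})"]) force+
  then show ?thesis using that[OF fam] by blast
qed

lemma mult_table_eq: "mult_table G \<pi> R =
  {map Letter (rep g) @ [Hash1] @ map Letter (rep h) @ [Hash2] @ map Letter (rev (rep (g \<otimes> h))) | g h.
    g \<in> carrier G \<and> h \<in> carrier G}"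
proof -
  have "\<exists>g h. g \<in> carrier G \<and> h \<in> carrier G \<and> u = rep g \<and> v = rep h \<and> w = rep (g \<otimes> h)"
    if "u \<in> R" "v \<in> R" "w \<in> R" "\<pi> u \<otimes> \<pi> v = \<pi> w" for u v w
    using that rep_\<pi> \<pi>_closed R_lists by metis
  moreover have "\<exists>u v w. u \<in> R \<and> v \<in> R \<and> w \<in> R \<and> \<pi> u \<otimes> \<pi> v = \<pi> w \<and> u = rep g \<and> v = rep h \<and> w = rep (g \<otimes> h)"
    if "g \<in> carrier G" "h \<in> carrier G" for g h
    using that rep by auto
  ultimately show ?thesis unfolding mult_table_def by blast
qed

text \<open>The flags are fixed in advance, so the transducer knows from the first letter of an
  entry whether to erase it. Meanwhile it compares the entry with the normal form of the identity.
  The result is checked against the flag at the following separator, and for the last entry by the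
  choice of final states.\<close>

lemma IND_table:
  fixes f :: "nat \<Rightarrow> nat" and \<alpha> \<beta> :: "('x + nat tsym) list"
  assumes "mult_table G \<pi> R \<in> IND"
  defines "er \<equiv> \<lambda>b g. if b then [] else map Letter (map f (rep g))"
  shows "{map Inr (er a g) @ \<alpha> @ map Inr (er b h) @ \<beta> @ map Inr (rev (er c (g \<otimes> h))) | g h.
    g \<in> carrier G \<and> h \<in> carrier G \<and> (g = \<one> \<longleftrightarrow> a) \<and> (h = \<one> \<longleftrightarrow> b) \<and> (g \<otimes> h = \<one> \<longleftrightarrow> c)} \<in> IND"
    (is "?T \<in> IND")
proof -
  define e where "e = rep \<one>"
  \<comment> \<open>The third entry is written backwards and is therefore compared with
    \<open>rev e\<close>.\<close>
  define M where "M = suffix_states e \<union> suffix_states (rev e)"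
  define cond where "cond i = (if i = 0 then a else if i = Suc 0 then b else c)" for i
  define \<delta> :: "nat \<times> nat list option \<Rightarrow> nat tsym \<Rightarrow> (('x + nat tsym) list \<times> nat \<times> nat list option) set"
    where "\<delta> = (\<lambda>(i, m) s. case s of
      Letter x \<Rightarrow> {(if cond i then [] else [Inr (Letter (f x))], i, track m x)}
    | Hash1 \<Rightarrow> if i = 0 \<and> (m = Some [] \<longleftrightarrow> a) then {(\<alpha>, Suc 0, Some e)} else {}
    | Hash2 \<Rightarrow> if i = Suc 0 \<and> (m = Some [] \<longleftrightarrow> b) then {(\<beta>, 2, Some (rev e))} else {})"
  have M_start: "Some e \<in> M" "Some (rev e) \<in> M"
    by (simp_all add: M_def suffix_states_start)
  have M_track: "track m x \<in> M" if "m \<in> M" for m x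
    using that suffix_states_track[of m e x] suffix_states_track[of m "rev e" x] by (auto simp: M_def)
  interpret transducer \<delta> "{0, Suc 0, 2} \<times> M"
  proof
    show "finite ({0, Suc 0, 2} \<times> M)" by (simp add: M_def finite_suffix_states)
    show "finite (\<delta> p s)" for p s by (auto simp: \<delta>_def split: prod.split tsym.split)
    show "q \<in> {0, Suc 0, 2} \<times> M" if "p \<in> {0, Suc 0, 2} \<times> M" "(u, q) \<in> \<delta> p s" for p q u s
      using that M_start M_track
      by (auto simp: \<delta>_def split: prod.splits tsym.splits if_splits)
  qed
  define emit :: "nat \<Rightarrow> nat list \<Rightarrow> ('x + nat tsym) list"
    where "emit i w = (if cond i then [] else map Inr (map Letter (map f w)))" for i w
  have letters: "run \<delta> (i, m) (map Letter w) = {(emit i w, i, foldl track m w)}" for i m w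
    by (induction w arbitrary: m) (auto simp: \<delta>_def emit_def)
  have letters_append: "(out, q) \<in> run \<delta> (i, m) (map Letter w @ z) \<longleftrightarrow>
      (\<exists>out'. out = emit i w @ out' \<and> (out', q) \<in> run \<delta> (i, foldl track m w) z)" for i m w z out q
    unfolding run_append letters by blast
  have hash1: "(out, q) \<in> run \<delta> (0, m) (Hash1 # z) \<longleftrightarrow>
      (m = Some [] \<longleftrightarrow> a) \<and> (\<exists>out'. out = \<alpha> @ out' \<and> (out', q) \<in> run \<delta> (Suc 0, Some e) z)" for m z out q
    by (intro run_Cons_if) (simp add: \<delta>_def)
  have hash2: "(out, q) \<in> run \<delta> (Suc 0, m) (Hash2 # z) \<longleftrightarrow>
      (m = Some [] \<longleftrightarrow> b) \<and> (\<exists>out'. out = \<beta> @ out' \<and> (out', q) \<in> run \<delta> (2, Some (rev e)) z)" for m z out q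
    by (intro run_Cons_if) (simp add: \<delta>_def)
  let ?E = "{q \<in> {2} \<times> M. snd q = Some [] \<longleftrightarrow> c}"
  have run: "(out, q) \<in> run \<delta> (0, Some e)
      (map Letter (rep g) @ [Hash1] @ map Letter (rep h) @ [Hash2] @ map Letter (rev (rep (g \<otimes> h)))) \<longleftrightarrow>
      (g = \<one> \<longleftrightarrow> a) \<and> (h = \<one> \<longleftrightarrow> b) \<and> q = (2, foldl track (Some (rev e)) (rev (rep (g \<otimes> h)))) \<and>
      out = map Inr (er a g) @ \<alpha> @ map Inr (er b h) @ \<beta> @ map Inr (rev (er c (g \<otimes> h)))"
    if "g \<in> carrier G" "h \<in> carrier G" for g h out q
  proof -
    have "rep g = e \<longleftrightarrow> g = \<one>" "rep h = e \<longleftrightarrow> h = \<one>" using that rep_eq_iff by (simp_all add: e_def)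
    moreover have "map Inr (er a g) = emit 0 (rep g)" "map Inr (er b h) = emit (Suc 0) (rep h)"
      "map Inr (rev (er c (g \<otimes> h))) = emit 2 (rev (rep (g \<otimes> h)))"
      by (simp_all add: emit_def cond_def er_def rev_map)
    ultimately show ?thesis
      by (simp add: letters_append hash1 hash2 letters foldl_track del: run.simps map_map) blast
  qed
  have track_M: "foldl track m w \<in> M" if "m \<in> M" for m w
    using that by (induction w arbitrary: m) (auto intro: M_track)
  have final: "(2, foldl track (Some (rev e)) (rev (rep (g \<otimes> h)))) \<in> ?E \<longleftrightarrow> (g \<otimes> h = \<one> \<longleftrightarrow> c)"
    if "g \<in> carrier G" "h \<in> carrier G" for g h
    using that track_M[OF M_start(2)] by (simp add: foldl_track) (simp add: e_def rep_eq_iff)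
  have "{out. \<exists>w\<in>mult_table G \<pi> R. \<exists>q\<in>?E. (out, q) \<in> run \<delta> (0, Some e) w} \<in> IND"
    by (rule IND_transduce[OF assms(1)]) (auto simp: M_start)
  moreover have "{out. \<exists>w\<in>mult_table G \<pi> R. \<exists>q\<in>?E. (out, q) \<in> run \<delta> (0, Some e) w} = ?T"
  proof (rule Set.set_eqI)
    fix out
    have "(\<exists>w\<in>mult_table G \<pi> R. \<exists>q\<in>?E. (out, q) \<in> run \<delta> (0, Some e) w) \<longleftrightarrow>
        (\<exists>g h. g \<in> carrier G \<and> h \<in> carrier G \<and> (\<exists>q\<in>?E. (out, q) \<in> run \<delta> (0, Some e)
      (map Letter (rep g) @ [Hash1] @ map Letter (rep h) @ [Hash2] @ map Letter (rev (rep (g \<otimes> h))))))"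
      unfolding mult_table_eq by blast
    also have "\<dots> \<longleftrightarrow> out \<in> ?T"
      using run final by (simp cong: conj_cong) blast
    finally show "out \<in> {out. \<exists>w\<in>mult_table G \<pi> R. \<exists>q\<in>?E. (out, q) \<in> run \<delta> (0, Some e) w} \<longleftrightarrow> out \<in> ?T"
      by simp
  qed
  ultimately show ?thesis by simp
qed

end

section \<open>The free product of two tabled groups\<close>

context normal_forms
begin

lemma nontrivial_forms: "R - {rep \<one>} = rep ` (carrier G - {\<one>})"
proof (rule equalityI; rule subsetI)
  fix w assume w: "w \<in> R - {rep \<one>}"
  then have "w = rep (\<pi> w)" "\<pi> w \<in> carrier G" by (simp_all add: rep_\<pi> \<pi>_closed R_lists)
  moreover from this w have "\<pi> w \<noteq> \<one>" by auto
  ultimately show "w \<in> rep ` (carrier G - {\<one>})" by blast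
next
  fix w assume "w \<in> rep ` (carrier G - {\<one>})"
  then obtain g where "g \<in> carrier G" "g \<noteq> \<one>" "w = rep g" by blast
  then show "w \<in> R - {rep \<one>}" using rep[of g] rep_eq_iff[of g \<one>] by simp
qed

lemma rep_nonempty: "g \<in> carrier G \<Longrightarrow> g \<noteq> \<one> \<Longrightarrow> rep g \<noteq> []"
  using rep[of g] \<pi>_Nil by auto

end

locale tabled_pair = G: normal_forms G A \<pi> R + H: normal_forms H B \<psi> R'
  for G :: "('a, 'c) monoid_scheme" and A \<pi> R and H :: "('b, 'd) monoid_scheme" and B \<psi> R' +
  assumes IND_G: "mult_table G \<pi> R \<in> IND" and IND_H: "mult_table H \<psi> R' \<in> IND"
begin

sublocale group_pair G H ..

text \<open>Even numbers serve as letters of the first factor and odd numbers as letters of the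
  second.\<close>

definition spell :: "'a + 'b \<Rightarrow> nat list"
  where "spell = case_sum (\<lambda>g. map (\<lambda>a. 2 * a) (G.rep g)) (\<lambda>h. map (\<lambda>b. Suc (2 * b)) (H.rep h))"

sublocale spelled_groups "carrier G <+> carrier H" isl "fp_mul G H" "fp_one G H"
  "map_sum (\<lambda>x. inv\<^bsub>G\<^esub> x) (\<lambda>y. inv\<^bsub>H\<^esub> y)" spell ..

definition alph :: "bool \<Rightarrow> nat set"
  where "alph t = (if t then (\<lambda>a. 2 * a) ` A else (\<lambda>b. Suc (2 * b)) ` B)"

definition letter_val :: "nat \<Rightarrow> 'a + 'b"
  where "letter_val c = (if even c then Inl (\<pi> [c div 2]) else Inr (\<psi> [c div 2]))"

text \<open>Each letter counts as a syllable of its own, and syllables are multiplied only in the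
  quotient. Concatenation is thereby respected by construction.\<close>

definition val :: "nat list \<Rightarrow> ('a + 'b) list set"
  where "val w = fp_rel G H `` {map letter_val w}"

lemma letter_val_closed: "w \<in> lists (alph True \<union> alph False) \<Longrightarrow> map letter_val w \<in> fp_words G H"
  by (induction w) (auto simp: letter_val_def alph_def G.\<pi>_closed H.\<pi>_closed)

lemma spell_closed: "x \<in> carrier G <+> carrier H \<Longrightarrow> spell x \<in> lists (alph (isl x))"
  using G.rep_lists H.rep_lists by (auto simp: spell_def alph_def in_lists_conv_set)

lemma spells_closed: "u \<in> fp_words G H \<Longrightarrow> spells u \<in> lists (alph True \<union> alph False)"
proof (induction u)
  case (Cons x u)
  then have "spell x \<in> lists (alph (isl x))" using spell_closed by simp
  moreover have "alph (isl x) \<subseteq> alph True \<union> alph False" by (cases "isl x") auto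
  ultimately have "spell x \<in> lists (alph True \<union> alph False)" by (meson lists_mono subsetD)
  then show ?case using Cons by simp
qed simp

text \<open>The empty word is congruent to the identity syllable; the letters are then multiplied
  onto it one by one, from the last to the first.\<close>

lemma fp_rel_word_G: "w \<in> lists A \<Longrightarrow> (map (\<lambda>a. Inl (\<pi> [a])) w, [Inl (\<pi> w)]) \<in> fp_rel G H"
proof (induction w)
  case Nil
  then show ?case using fp_rel_sym[OF fp_rel_one[of "[]" True]] by (simp add: G.\<pi>_Nil)
next
  case (Cons a w)
  then have c: "\<pi> [a] \<in> carrier G" "\<pi> w \<in> carrier G" by (simp_all add: G.\<pi>_closed)
  then have "([Inl (\<pi> [a])], [Inl (\<pi> [a])]) \<in> fp_rel G H" by (intro fp_rel_refl) simp
  from fp_rel_append[OF this Cons.IH] Cons.prems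
  have "(map (\<lambda>a. Inl (\<pi> [a])) (a # w), [Inl (\<pi> [a]), Inl (\<pi> w)]) \<in> fp_rel G H" by simp
  also have "([Inl (\<pi> [a]), Inl (\<pi> w)], [Inl (\<pi> (a # w))]) \<in> fp_rel G H"
    using fp_rel_mul[of "Inl (\<pi> [a])" "Inl (\<pi> w)" "[]"] c G.\<pi>_append[of "[a]" w] Cons.prems by simp
  finally (fp_rel_trans) show ?case .
qed

lemma fp_rel_word_H: "w \<in> lists B \<Longrightarrow> (map (\<lambda>b. Inr (\<psi> [b])) w, [Inr (\<psi> w)]) \<in> fp_rel G H"
proof (induction w)
  case Nil
  then show ?case using fp_rel_sym[OF fp_rel_one[of "[]" False]] by (simp add: H.\<pi>_Nil)
next
  case (Cons b w)
  then have c: "\<psi> [b] \<in> carrier H" "\<psi> w \<in> carrier H" by (simp_all add: H.\<pi>_closed)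
  then have "([Inr (\<psi> [b])], [Inr (\<psi> [b])]) \<in> fp_rel G H" by (intro fp_rel_refl) simp
  from fp_rel_append[OF this Cons.IH] Cons.prems
  have "(map (\<lambda>b. Inr (\<psi> [b])) (b # w), [Inr (\<psi> [b]), Inr (\<psi> w)]) \<in> fp_rel G H" by simp
  also have "([Inr (\<psi> [b]), Inr (\<psi> w)], [Inr (\<psi> (b # w))]) \<in> fp_rel G H"
    using fp_rel_mul[of "Inr (\<psi> [b])" "Inr (\<psi> w)" "[]"] c H.\<pi>_append[of "[b]" w] Cons.prems by simp
  finally (fp_rel_trans) show ?case .
qed

lemma fp_rel_spell: "x \<in> carrier G <+> carrier H \<Longrightarrow> (map letter_val (spell x), [x]) \<in> fp_rel G H"
proof (cases x)
  case (Inl g)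
  assume "x \<in> carrier G <+> carrier H"
  then have "g \<in> carrier G" using Inl by simp
  then show ?thesis
    using fp_rel_word_G[OF G.rep_lists] G.rep Inl by (simp add: spell_def letter_val_def comp_def)
next
  case (Inr h)
  assume "x \<in> carrier G <+> carrier H"
  then have "h \<in> carrier H" using Inr by simp
  then show ?thesis
    using fp_rel_word_H[OF H.rep_lists] H.rep Inr by (simp add: spell_def letter_val_def comp_def)
qed

lemma fp_rel_spells: "u \<in> fp_words G H \<Longrightarrow> (map letter_val (spells u), u) \<in> fp_rel G H"
proof (induction u)
  case (Cons x u)
  then show ?case using fp_rel_append[OF fp_rel_spell, of x "map letter_val (spells u)" u] by simp
qed (simp add: fp_rel_refl)

lemma val_spells: "u \<in> fp_words G H \<Longrightarrow> val (spells u) = fp_rel G H `` {u}"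
  unfolding val_def by (rule equiv_class_eq[OF equiv_fp_rel fp_rel_spells])

lemma reduced_words: "reduced s \<Longrightarrow> s \<in> fp_words G H"
  using reduced_closed by auto

lemma class_eq_iff:
  assumes "u \<in> fp_words G H" "v \<in> fp_words G H"
  shows "fp_rel G H `` {u} = fp_rel G H `` {v} \<longleftrightarrow> nf u = nf v"
  using eq_equiv_class_iff[OF equiv_fp_rel assms] fp_rel_iff[OF assms] by simp

lemma val_generators: "monoid_generators (free_product G H) (alph True \<union> alph False) val"
proof -
  have "val \<in> hom (free_monoid (alph True \<union> alph False)) (free_product G H)"
  proof (rule homI)
    fix u v assume "u \<in> carrier (free_monoid (alph True \<union> alph False))"
      "v \<in> carrier (free_monoid (alph True \<union> alph False))"
    then show "val (u \<otimes>\<^bsub>free_monoid (alph True \<union> alph False)\<^esub> v) = val u \<otimes>\<^bsub>free_product G H\<^esub> val v"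
      by (simp add: val_def free_monoid_def free_product_mult_class letter_val_closed)
  next
    fix u assume "u \<in> carrier (free_monoid (alph True \<union> alph False))"
    then show "val u \<in> carrier (free_product G H)"
      by (simp add: val_def free_monoid_def free_product_classI letter_val_closed)
  qed
  moreover have "X \<in> val ` carrier (free_monoid (alph True \<union> alph False))"
    if X: "X \<in> carrier (free_product G H)" for X
  proof -
    obtain u where "u \<in> fp_words G H" "X = fp_rel G H `` {u}" using X by (rule free_product_carrierE)
    then have "X = val (spells u)" "spells u \<in> lists (alph True \<union> alph False)"
      using val_spells spells_closed by simp_all
    then show ?thesis by (simp add: free_monoid_def)
  qed
  ultimately show ?thesis
    using G.finite_A H.finite_A
    by (auto simp: monoid_generators_def epi_def alph_def hom_def)
qed

definition NF :: "nat list set" where "NF = spells ` {s. reduced s}"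

lemma spell_nontrivial_G:
  "spell ` {x \<in> carrier G <+> carrier H. isl x \<and> x \<noteq> fp_one G H True} =
    map (\<lambda>a. 2 * a) ` (R - {G.rep \<one>\<^bsub>G\<^esub>})"
proof -
  have "{x \<in> carrier G <+> carrier H. isl x \<and> x \<noteq> fp_one G H True} = Inl ` (carrier G - {\<one>\<^bsub>G\<^esub>})"
    by auto
  then show ?thesis by (simp add: G.nontrivial_forms image_image spell_def)
qed

lemma spell_nontrivial_H:
  "spell ` {x \<in> carrier G <+> carrier H. \<not> isl x \<and> x \<noteq> fp_one G H False} =
    map (\<lambda>b. Suc (2 * b)) ` (R' - {H.rep \<one>\<^bsub>H\<^esub>})"
proof -
  have "{x \<in> carrier G <+> carrier H. \<not> isl x \<and> x \<noteq> fp_one G H False} = Inr ` (carrier H - {\<one>\<^bsub>H\<^esub>})"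
    by auto
  then show ?thesis by (simp add: H.nontrivial_forms image_image spell_def)
qed

lemma spell_nonempty:
  assumes "x \<in> carrier G <+> carrier H" "x \<noteq> fp_one G H (isl x)"
  shows "spell x \<noteq> []"
  using assms G.rep_nonempty H.rep_nonempty by (auto simp: spell_def)

text \<open>A nonidentity element has a nonempty normal form, since the empty word represents the
  identity. Reduced words are thus alternating sequences of nonempty blocks over disjoint alphabets,
  as \<open>regular_alternating\<close> requires.\<close>

lemma regular_NF: "regular_language (alph True \<union> alph False) NF"
proof -
  define K where "K t = spell ` {x \<in> carrier G <+> carrier H. isl x = t \<and> x \<noteq> fp_one G H t}" for t
  define F where "F t = spells ` {s. red t s}" for t
  have "\<exists>\<Q>. residual_family (alph t) \<Q> \<and> K t \<in> \<Q>" for t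
  proof (cases t)
    case True
    have "inj (\<lambda>a :: nat. 2 * a)" by (simp add: inj_def)
    from G.residual_family_nontrivial[OF this] obtain \<Q> where "residual_family (alph t) \<Q>"
      "map (\<lambda>a. 2 * a) ` (R - {G.rep \<one>\<^bsub>G\<^esub>}) \<in> \<Q>"
      using True by (auto simp: alph_def)
    then show ?thesis using True spell_nontrivial_G by (auto simp: K_def)
  next
    case False
    have "inj (\<lambda>b :: nat. Suc (2 * b))" by (simp add: inj_def)
    from H.residual_family_nontrivial[OF this] obtain \<Q> where "residual_family (alph t) \<Q>"
      "map (\<lambda>b. Suc (2 * b)) ` (R' - {H.rep \<one>\<^bsub>H\<^esub>}) \<in> \<Q>"
      using False by (auto simp: alph_def)
    then show ?thesis using False spell_nontrivial_H by (auto simp: K_def)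
  qed
  then obtain \<Q> where \<Q>: "\<And>t. residual_family (alph t) (\<Q> t)" "\<And>t. K t \<in> \<Q> t" by metis
  have red_eq: "{s. red t s} = insert [] {x # s | x s.
      (x \<in> carrier G <+> carrier H \<and> isl x = t \<and> x \<noteq> fp_one G H t) \<and> red (\<not> t) s}" for t
  proof (rule Set.set_eqI)
    fix s show "s \<in> {s. red t s} \<longleftrightarrow> s \<in> insert [] {x # s | x s.
      (x \<in> carrier G <+> carrier H \<and> isl x = t \<and> x \<noteq> fp_one G H t) \<and> red (\<not> t) s}"
      by (cases s) auto
  qed
  have "regular_language (alph True \<union> alph False) (F True \<union> F False)"
  proof (rule regular_alternating[OF _ _ \<Q>])
    show "finite (alph t)" for t by (simp add: alph_def G.finite_A H.finite_A)
    show "alph True \<inter> alph False = {}" by (auto simp: alph_def) presburger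
    show "[] \<notin> K t" for t using spell_nonempty by (force simp: K_def)
    show "F t = insert [] (conc (K t) (F (\<not> t)))" for t
    proof -
      have "F t = insert [] {spell x @ spells s | x s.
          (x \<in> carrier G <+> carrier H \<and> isl x = t \<and> x \<noteq> fp_one G H t) \<and> red (\<not> t) s}"
        unfolding F_def red_eq[of t] image_insert spells_simps(1) spells_simps(2)[symmetric] by blast
      also have "\<dots> = insert [] (conc (K t) (F (\<not> t)))"
        unfolding K_def conc_def F_def by blast
      finally show ?thesis .
    qed
    show "F t \<subseteq> lists (alph True \<union> alph False)" for t
      using spells_closed reduced_words red_reduced by (auto simp: F_def)
  qed
  moreover have "NF = F True \<union> F False"
    unfolding NF_def F_def reduced_def ex_bool_eq by blast
  ultimately show ?thesis by simp
qed

text \<open>By the normal form theorem an element determines its reduced word of syllables, and that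
  word determines its spelling.\<close>

lemma normal_NF: "regular_normal_forms (free_product G H) (alph True \<union> alph False) val NF"
  unfolding regular_normal_forms_def
proof (intro conjI ballI regular_NF)
  fix X assume "X \<in> carrier (free_product G H)"
  then obtain u where u: "u \<in> fp_words G H" "X = fp_rel G H `` {u}" by (rule free_product_carrierE)
  have val: "val (spells s) = X \<longleftrightarrow> s = nf u" if "reduced s" for s
    using that u class_eq_iff[OF reduced_words[OF that] u(1)] by (simp add: val_spells reduced_words nf_reduced)
  have "reduced (nf u)" using u by (intro reduced_nf) auto
  then show "\<exists>!w. w \<in> NF \<and> val w = X"
    using val by (intro ex1I[of _ "spells (nf u)"]) (auto simp: NF_def)
qed

lemma mult_table_NF: "mult_table (free_product G H) val NF = meaning Start"
proof -
  have prod: "val (spells u) \<otimes>\<^bsub>free_product G H\<^esub> val (spells v) = val (spells w) \<longleftrightarrow> nf (u @ v) = w"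
    if "reduced u" "reduced v" "reduced w" for u v w
    using that class_eq_iff[of "u @ v" w] reduced_words
    by (simp add: val_spells free_product_mult_class nf_reduced)
  show ?thesis
    unfolding mult_table_def NF_def meaning.simps rev_map using prod by blast
qed

text \<open>The tag selects the factor; once \<open>Inl\<close> or \<open>Inr\<close> is removed
  from the syllables, the set is the transduced table of that factor, with letters recoded as in
  \<open>spell\<close>.\<close>

lemma table_IND: "table t a b c \<alpha> \<beta> \<in> IND"
proof (cases t)
  case True
  have "table True a b c \<alpha> \<beta> =
    {map Inr (if a then [] else map Letter (map ((*) 2) (G.rep g))) @ \<alpha> @
     map Inr (if b then [] else map Letter (map ((*) 2) (G.rep h))) @ \<beta> @
     map Inr (rev (if c then [] else map Letter (map ((*) 2) (G.rep (g \<otimes>\<^bsub>G\<^esub> h))))) | g h.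
     g \<in> carrier G \<and> h \<in> carrier G \<and> (g = \<one>\<^bsub>G\<^esub> \<longleftrightarrow> a) \<and> (h = \<one>\<^bsub>G\<^esub> \<longleftrightarrow> b) \<and> (g \<otimes>\<^bsub>G\<^esub> h = \<one>\<^bsub>G\<^esub> \<longleftrightarrow> c)}"
    (is "_ = ?T")
  proof (rule equalityI; rule subsetI)
    fix w assume "w \<in> table True a b c \<alpha> \<beta>"
    then obtain x y where xy: "x \<in> carrier G <+> carrier H" "y \<in> carrier G <+> carrier H" "isl x" "isl y"
      "(x = fp_one G H True) = a" "(y = fp_one G H True) = b" "(fp_mul G H x y = fp_one G H True) = c"
      "w = map Inr (erase a x) @ \<alpha> @ map Inr (erase b y) @ \<beta> @ map Inr (rev (erase c (fp_mul G H x y)))"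
      unfolding table_def by auto
    then obtain g h where "x = Inl g" "y = Inl h" "g \<in> carrier G" "h \<in> carrier G" by (auto simp: isl_def)
    with xy show "w \<in> ?T" by (intro CollectI exI[of _ g] exI[of _ h]) (simp add: spell_def)
  next
    fix w assume "w \<in> ?T"
    then obtain g h where "g \<in> carrier G" "h \<in> carrier G" "(g = \<one>\<^bsub>G\<^esub>) = a" "(h = \<one>\<^bsub>G\<^esub>) = b"
      "(g \<otimes>\<^bsub>G\<^esub> h = \<one>\<^bsub>G\<^esub>) = c" "w = map Inr (erase a (Inl g)) @ \<alpha> @ map Inr (erase b (Inl h)) @ \<beta> @
        map Inr (rev (erase c (Inl (g \<otimes>\<^bsub>G\<^esub> h))))"
      by (auto simp: spell_def)
    then show "w \<in> table True a b c \<alpha> \<beta>"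
      unfolding table_def by (intro CollectI exI[of _ "Inl g"] exI[of _ "Inl h"]) simp
  qed
  then show ?thesis using G.IND_table[OF IND_G, of a "(*) 2" \<alpha> b \<beta> c] True by simp
next
  case False
  have "table False a b c \<alpha> \<beta> =
    {map Inr (if a then [] else map Letter (map (\<lambda>b. Suc (2 * b)) (H.rep g))) @ \<alpha> @
     map Inr (if b then [] else map Letter (map (\<lambda>b. Suc (2 * b)) (H.rep h))) @ \<beta> @
     map Inr (rev (if c then [] else map Letter (map (\<lambda>b. Suc (2 * b)) (H.rep (g \<otimes>\<^bsub>H\<^esub> h))))) | g h.
     g \<in> carrier H \<and> h \<in> carrier H \<and> (g = \<one>\<^bsub>H\<^esub> \<longleftrightarrow> a) \<and> (h = \<one>\<^bsub>H\<^esub> \<longleftrightarrow> b) \<and> (g \<otimes>\<^bsub>H\<^esub> h = \<one>\<^bsub>H\<^esub> \<longleftrightarrow> c)}"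
    (is "_ = ?T")
  proof (rule equalityI; rule subsetI)
    fix w assume "w \<in> table False a b c \<alpha> \<beta>"
    then obtain x y where xy: "x \<in> carrier G <+> carrier H" "y \<in> carrier G <+> carrier H" "\<not> isl x" "\<not> isl y"
      "(x = fp_one G H False) = a" "(y = fp_one G H False) = b" "(fp_mul G H x y = fp_one G H False) = c"
      "w = map Inr (erase a x) @ \<alpha> @ map Inr (erase b y) @ \<beta> @ map Inr (rev (erase c (fp_mul G H x y)))"
      unfolding table_def by auto
    then obtain g h where "x = Inr g" "y = Inr h" "g \<in> carrier H" "h \<in> carrier H" by (auto simp: isl_def)
    with xy show "w \<in> ?T" by (intro CollectI exI[of _ g] exI[of _ h]) (simp add: spell_def)
  next
    fix w assume "w \<in> ?T"
    then obtain g h where "g \<in> carrier H" "h \<in> carrier H" "(g = \<one>\<^bsub>H\<^esub>) = a" "(h = \<one>\<^bsub>H\<^esub>) = b"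
      "(g \<otimes>\<^bsub>H\<^esub> h = \<one>\<^bsub>H\<^esub>) = c" "w = map Inr (erase a (Inr g)) @ \<alpha> @ map Inr (erase b (Inr h)) @ \<beta> @
        map Inr (rev (erase c (Inr (g \<otimes>\<^bsub>H\<^esub> h))))"
      by (auto simp: spell_def)
    then show "w \<in> table False a b c \<alpha> \<beta>"
      unfolding table_def by (intro CollectI exI[of _ "Inr g"] exI[of _ "Inr h"]) simp
  qed
  then show ?thesis using H.IND_table[OF IND_H, of a "\<lambda>b. Suc (2 * b)" \<alpha> b \<beta> c] False by simp
qed

theorem tabled_free_product: "tabled IND (free_product G H)"
  unfolding tabled_def
proof (intro exI conjI)
  show "mult_table (free_product G H) val NF \<in> IND"
    unfolding mult_table_NF by (rule meaning_IND[OF table_IND])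
qed (rule val_generators normal_NF)+

end

theorem corollary5p2:
  fixes G :: "('a, 'm) monoid_scheme" and H :: "('b, 'n) monoid_scheme"
  assumes "group G" and "group H"
    and "tabled IND G" and "tabled IND H"
  shows "tabled IND (free_product G H)"
proof -
  obtain A :: "nat set" and \<pi> R where G: "monoid_generators G A \<pi>" "regular_normal_forms G A \<pi> R" "mult_table G \<pi> R \<in> IND"
    using assms(3) unfolding tabled_def by blast
  obtain B :: "nat set" and \<psi> R' where H: "monoid_generators H B \<psi>" "regular_normal_forms H B \<psi> R'" "mult_table H \<psi> R' \<in> IND"
    using assms(4) unfolding tabled_def by blast
  interpret G: group G by fact
  interpret H: group H by fact
  interpret tabled_pair G A \<pi> R H B \<psi> R'
    by unfold_locales (fact G H)+
  show ?thesis by (rule tabled_free_product)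
qed

end
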